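(* There are absolute constants such that the following holds. Let $n$ and $k$ be positive integers with $k\leq\frac{1}{3}\log_2 n-1$, and let $U\in\mathbb{R}^{n\times n}$ be a uniformly random (Haar-distributed) orthogonal matrix. Then with probability $1-o(1)$ (as $n\to\infty$), \[ R_{1/2^{k+1}}(f_{n,k,U})=\Omega\!\left(\frac{n^{1-\frac{1}{k}}}{(\log n)^{2-\frac{1}{k}}}\right) \] and in particular \[ R_{\frac{1}{2}-\gamma}(f_{n,k,U})=\Omega\!\left(\frac{\gamma^{2}}{k}\cdot\frac{n^{1-\frac{1}{k}}}{(\log n)^{2-\frac{1}{k}}}\right)\qquad\text{for all }0\leq\gamma\leq\tfrac12 . \]
   Context: For an orthogonal $U\in\mathbb{R}^{n\times n}$ define $\phi_{n,k,U}\colon(\{-1,1\}^n)^k\to\mathbb{R}$ by $\phi_{n,k,U}(x_1,\dots,x_k)=\frac1n\mathbf{1}^{\intercal}D_{x_1}UD_{x_2}U\cdots UD_{x_k}\mathbf{1}$, where $\mathbf 1$ is the all-ones vector and $D_{x_i}$ is the diagonal matrix with $x_i$ on the diagonal. The partial Boolean function $f_{n,k,U}\colon\{-1,1\}^{n\times k}\to\{0,1,*\}$ is $1$ if $\phi_{n,k,U}(x)\geq 2^{-k}$, $0$ if $|\phi_{n,k,U}(x)|\le 2^{-k-1}$, and $*$ otherwise. A randomized query algorithm of cost $d$ is a probability distribution over decision trees of depth at most $d$; it computes a partial function $f$ with error $\epsilon$ if on every input $x$ with $f(x)\in\{0,1\}$ it outputs $f(x)$ with probability at least $1-\epsilon$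 (behavior on inputs with $f(x)=*$ is arbitrary). $R_\epsilon(f)$ is the minimum cost of such an algorithm. *)

theory Defs
  imports "HOL-Probability.Probability" "Jordan_Normal_Form.Matrix"
begin

no_notation Matrix.scalar_prod (infix "\<bullet>" 70)

(* Jordan_Normal_Form's orthogonal_mat only asks for pairwise orthogonal, nonzero columns,
   hence the explicit condition here. *)
definition orthogonal_group :: "nat \<Rightarrow> real mat set" where
  "orthogonal_group n = {U \<in> carrier_mat n n. transpose_mat U * U = 1\<^sub>m n}"

(* The type of matrices carries no topology in the library. The Borel sets of O(n) are those
   induced by the embedding of n x n matrices into R^(n x n) through their entries. *)
definition orthogonal_borel :: "nat \<Rightarrow> real mat measure" where
  "orthogonal_borel n =
     vimage_algebra (orthogonal_group n)
       (\<lambda>U. \<lambda>p \<in> {..<n} \<times> {..<n}. U $$ p)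
       (\<Pi>\<^sub>M p \<in> {..<n} \<times> {..<n}. (borel :: real measure))"

(* The translation-invariant Borel probability measure on O(n). It is unique, and since
   O(n) is compact, left invariance implies right invariance. *)
definition haar_orthogonal :: "nat \<Rightarrow> real mat measure \<Rightarrow> bool" where
  "haar_orthogonal n M \<longleftrightarrow>
     prob_space M \<and> space M = orthogonal_group n \<and> sets M = sets (orthogonal_borel n) \<and>
     (\<forall>Q \<in> orthogonal_group n. distr M M (\<lambda>U. Q * U) = M)"

(* D_{x_1} U D_{x_2} U ... U D_{x_{m+1}} for blocks x_1, ..., x_{m+1} of length n. Blocks and
   coordinates are numbered from 0: the j-th coordinate of x_i is x (i - 1, j - 1). *)
primrec alternating_prod :: "nat \<Rightarrow> real mat \<Rightarrow> (nat \<times> nat \<Rightarrow> real) \<Rightarrow> nat \<Rightarrow> real mat" where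
  "alternating_prod n U x 0 = mat_diag n (\<lambda>j. x (0, j))"
| "alternating_prod n U x (Suc m) = alternating_prod n U x m * U * mat_diag n (\<lambda>j. x (Suc m, j))"

definition ones_vec :: "nat \<Rightarrow> real Matrix.vec" where
  "ones_vec n = Matrix.vec n (\<lambda>_. 1)"

(* Meant for k > 0; there are k diagonal factors. *)
definition forrelation :: "nat \<Rightarrow> nat \<Rightarrow> real mat \<Rightarrow> (nat \<times> nat \<Rightarrow> real) \<Rightarrow> real" where
  "forrelation n k U x =
     1 / real n * Matrix.scalar_prod (ones_vec n) (alternating_prod n U x (k - 1) *\<^sub>v ones_vec n)"

(* None stands for the undefined value *. *)
definition forrelation_fun ::
  "nat \<Rightarrow> nat \<Rightarrow> real mat \<Rightarrow> (nat \<times> nat \<Rightarrow> real) \<Rightarrow> bool option" where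
  "forrelation_fun n k U x =
     (if forrelation n k U x \<ge> 1 / 2 ^ k then Some True
      else if \<bar>forrelation n k U x\<bar> \<le> 1 / 2 ^ (k + 1) then Some False
      else None)"

definition sign_inputs :: "'v set \<Rightarrow> ('v \<Rightarrow> real) set" where
  "sign_inputs I = I \<rightarrow>\<^sub>E {-1, 1}"

(* Query v s t reads the variable v and continues with s if its value is 1, with t if it is -1. *)
datatype (dtree_vars: 'v) dtree = Leaf bool | Query 'v "'v dtree" "'v dtree"

primrec dtree_depth :: "'v dtree \<Rightarrow> nat" where
  "dtree_depth (Leaf b) = 0"
| "dtree_depth (Query v s t) = Suc (max (dtree_depth s) (dtree_depth t))"

primrec dtree_run :: "'v dtree \<Rightarrow> ('v \<Rightarrow> real) \<Rightarrow> bool" where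
  "dtree_run (Leaf b) x = b"
| "dtree_run (Query v s t) x = (if x v = 1 then dtree_run s x else dtree_run t x)"

(* For finite I there are only finitely many decision trees over I of depth at most d, so
   probability mass functions capture all distributions on them. *)
definition randomized_algorithm :: "'v set \<Rightarrow> nat \<Rightarrow> 'v dtree pmf \<Rightarrow> bool" where
  "randomized_algorithm I d p \<longleftrightarrow>
     (\<forall>t \<in> set_pmf p. dtree_vars t \<subseteq> I \<and> dtree_depth t \<le> d)"

definition computes_with_error ::
  "'v set \<Rightarrow> 'v dtree pmf \<Rightarrow> (('v \<Rightarrow> real) \<Rightarrow> bool option) \<Rightarrow> real \<Rightarrow> bool" where
  "computes_with_error I p f \<epsilon> \<longleftrightarrow>
     (\<forall>x \<in> sign_inputs I. \<forall>b. f x = Some b \<longrightarrow>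
        measure_pmf.prob p {t. dtree_run t x = b} \<ge> 1 - \<epsilon>)"

(* For finite I and \<epsilon> \<ge> 0 the minimum exists: the tree reading all of I makes no error. *)
definition randomized_query_complexity ::
  "'v set \<Rightarrow> real \<Rightarrow> (('v \<Rightarrow> real) \<Rightarrow> bool option) \<Rightarrow> nat" where
  "randomized_query_complexity I \<epsilon> f =
     (LEAST d. \<exists>p. randomized_algorithm I d p \<and> computes_with_error I p f \<epsilon>)"

definition forrelation_complexity :: "real \<Rightarrow> nat \<Rightarrow> nat \<Rightarrow> real mat \<Rightarrow> nat" where
  "forrelation_complexity \<epsilon> n k U =
     randomized_query_complexity ({..<k} \<times> {..<n}) \<epsilon> (forrelation_fun n k U)"

end

theory Submission
  imports Defs "Jordan_Normal_Form.Determinant"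
begin

text \<open>
  The hard input distribution is a chain of \<open>k - 1\<close> independent standard Gaussian vectors
  \<open>z\<^sub>1, \<dots>, z\<^sub>k\<^sub>-\<^sub>1\<close>: given these, the bit \<open>x\<^sub>m(v)\<close> is an independent sign whose bias is the product of
  \<open>g((U\<^sup>T z\<^sub>m\<^sub>-\<^sub>1)\<^sub>v)\<close> and \<open>g(z\<^sub>m(v))\<close> for a bounded odd function \<open>g\<close>. Under it the forrelation has mean at
  least \<open>\<delta>\<^sup>k\<^sup>-\<^sup>1\<close> with \<open>\<delta> = (E[y g(y)])\<^sup>2 > 1/2\<close>, which beats the
  threshold \<open>2\<^bsup>-k\<^esup>\<close>, whereas it has mean \<open>0\<close> and variance \<open>1/n\<close> under uniform inputs, so an algorithm must
  tell the two apart.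

  The Fourier coefficients factor along the chain into kernels \<open>\<kappa>(S, T)\<close>. As \<open>g\<close> is a trigonometric
  polynomial, these are explicit, and the larger of the two sets contributes one small factor per
  element, which gives \<open>\<bar>\<kappa>(S, T)\<bar> \<le> (C s ln n / n)\<^bsup>s/2\<^esup>\<close> with \<open>s = max \<bar>S\<bar> \<bar>T\<bar>\<close> as soon as all \<open>s \<times> s\<close>
  blocks of \<open>U\<close> are flat. For Haar-distributed \<open>U\<close> this holds with high probability, because every
  bilinear form \<open>a\<^sup>T U b\<close> is subgaussian by left invariance.

  A decision tree of depth \<open>d\<close> is related to these coefficients by an \<open>L\<^sub>p\<close> martingale argument with
  \<open>p \<approx> ln N\<close> for \<open>N\<close> variables: the sum of the level \<open>r\<close> characters of the queried variables is a martingale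
  whose increments are sums of level \<open>r - 1\<close>, the two-point inequality bounds its \<open>L\<^sub>p\<close> norm by that of its
  quadratic variation, and the adaptive choice of the next variable costs only a factor \<open>N\<^bsup>1/p\<^esup> = O(1)\<close>. This
  yields level weights of order \<open>(C d ln N / l)\<^bsup>l/2\<^esup>\<close>. The bound for larger errors follows by majority votes.
\<close>

section \<open>Averages over the sign cube\<close>

text \<open>The exponents come from one series. In a chain of \<open>k\<close> blocks the maxima
  over neighbouring slices add up to at least \<open>1 - 1/k\<close> of the whole set, so a
  coefficient of level \<open>l\<close> is at most \<open>C l ln n / n\<close> to the power
  \<open>(l/2) (1 - 1/k)\<close>. Multiplied by the level weight, the powers of \<open>l\<close>
  cancel up to a factor at most 1, and the power \<open>l/2\<close> of
  \<open>C d (ln n)^(2 - 1/k) / n^(1 - 1/k)\<close> remains; the claimed depth is the one that makes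
  this geometric. Oddness of \<open>g\<close> kills the levels \<open>1, ..., k - 1\<close>, so the
  series starts at \<open>64^(-k)\<close>. This matters because the two distributions differ by a
  gap of order \<open>2^(-k)\<close> only, which is also why the argument is run with error
  \<open>2^(-k-1)\<close> and larger errors are reduced to it. The range of \<open>k\<close> amounts
  to \<open>8^(k+1) <= n\<close>, which keeps Chebyshev's bound \<open>4^(k+1) / n\<close> for
  uniform inputs within that gap.\<close>

definition cube_avg :: "'v set \<Rightarrow> (('v \<Rightarrow> real) \<Rightarrow> real) \<Rightarrow> real" where
  "cube_avg I F = (\<Sum>x\<in>sign_inputs I. F x) / 2 ^ card I"

definition monomial :: "'v set \<Rightarrow> ('v \<Rightarrow> real) \<Rightarrow> real" where
  "monomial S x = (\<Prod>v\<in>S. x v)"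

lemma finite_sign_inputs [simp]: "finite I \<Longrightarrow> finite (sign_inputs I)"
  unfolding sign_inputs_def by (intro finite_PiE) auto

lemma card_sign_inputs: "finite I \<Longrightarrow> card (sign_inputs I) = 2 ^ card I"
  unfolding sign_inputs_def by (subst card_PiE) (auto simp: card_insert_if numeral_2_eq_2)

lemma sign_inputs_cases: "x \<in> sign_inputs I \<Longrightarrow> v \<in> I \<Longrightarrow> x v = 1 \<or> x v = -1"
  unfolding sign_inputs_def by (auto simp: PiE_iff)

lemma sign_inputs_square: "x \<in> sign_inputs I \<Longrightarrow> v \<in> I \<Longrightarrow> x v * x v = 1"
  using sign_inputs_cases[of x I v] by auto

lemma sign_inputs_flip: "x \<in> sign_inputs I \<Longrightarrow> v \<in> I \<Longrightarrow> x(v := - x v) \<in> sign_inputs I"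
  using sign_inputs_cases[of x I v] unfolding sign_inputs_def
  by (auto simp: PiE_iff extensional_def)

lemma cube_avg_const [simp]: "finite I \<Longrightarrow> cube_avg I (\<lambda>x. c) = c"
  unfolding cube_avg_def by (simp add: card_sign_inputs)

lemma cube_avg_add: "cube_avg I (\<lambda>x. F x + G x) = cube_avg I F + cube_avg I G"
  unfolding cube_avg_def by (simp add: sum.distrib add_divide_distrib)

lemma cube_avg_diff: "cube_avg I (\<lambda>x. F x - G x) = cube_avg I F - cube_avg I G"
  unfolding cube_avg_def by (simp add: sum_subtractf diff_divide_distrib)

lemma cube_avg_cmult: "cube_avg I (\<lambda>x. c * F x) = c * cube_avg I F"
  unfolding cube_avg_def by (simp add: sum_distrib_left)

lemma cube_avg_sum: "cube_avg I (\<lambda>x. \<Sum>j\<in>J. F j x) = (\<Sum>j\<in>J. cube_avg I (F j))"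
  unfolding cube_avg_def by (subst sum.swap) (simp add: sum_divide_distrib)

lemma cube_avg_lincomb:
  "cube_avg I (\<lambda>x. f x * (\<Sum>j\<in>J. c j * F j x)) = (\<Sum>j\<in>J. c j * cube_avg I (\<lambda>x. f x * F j x))"
proof -
  have "f x * (\<Sum>j\<in>J. c j * F j x) = (\<Sum>j\<in>J. c j * (f x * F j x))" for x
    by (simp add: sum_distrib_left mult.left_commute)
  then show ?thesis by (simp only: cube_avg_sum cube_avg_cmult)
qed

lemma cube_avg_mono:
  assumes "\<And>x. x \<in> sign_inputs I \<Longrightarrow> F x \<le> G x"
  shows "cube_avg I F \<le> cube_avg I G"
  unfolding cube_avg_def by (intro divide_right_mono sum_mono assms) auto

lemma cube_avg_cong:
  assumes "\<And>x. x \<in> sign_inputs I \<Longrightarrow> F x = G x"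
  shows "cube_avg I F = cube_avg I G"
  unfolding cube_avg_def using assms by (simp cong: sum.cong)

lemma cube_avg_abs: "\<bar>cube_avg I F\<bar> \<le> cube_avg I (\<lambda>x. \<bar>F x\<bar>)"
  unfolding cube_avg_def by (simp add: divide_right_mono sum_abs)

lemma cube_avg_involution:
  assumes "\<And>x. x \<in> sign_inputs I \<Longrightarrow> h x \<in> sign_inputs I"
    and "\<And>x. x \<in> sign_inputs I \<Longrightarrow> h (h x) = x"
  shows "cube_avg I (\<lambda>x. F (h x)) = cube_avg I F"
  unfolding cube_avg_def
  by (rule arg_cong[where f = "\<lambda>s. s / _"], rule sum.reindex_bij_witness[of _ h h])
    (use assms in auto)

text \<open>The source of all cancellations over the cube below: \<open>h\<close> flips one bit, and
  which bit it flips may depend on the input.\<close>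

lemma cube_avg_antisymmetric:
  assumes "\<And>x. x \<in> sign_inputs I \<Longrightarrow> h x \<in> sign_inputs I"
    and "\<And>x. x \<in> sign_inputs I \<Longrightarrow> h (h x) = x"
    and "\<And>x. x \<in> sign_inputs I \<Longrightarrow> F (h x) = - F x"
  shows "cube_avg I F = 0"
proof -
  have "cube_avg I F = cube_avg I (\<lambda>x. F (h x))"
    using cube_avg_involution[of I h F] assms(1,2) by simp
  also have "\<dots> = cube_avg I (\<lambda>x. - 1 * F x)"
    by (rule cube_avg_cong) (use assms(3) in auto)
  also have "\<dots> = - cube_avg I F"
    by (subst cube_avg_cmult) simp
  finally show ?thesis by simp
qed

lemma monomial_flip:
  assumes "finite S"
  shows "monomial S (x(v := - x v)) = (if v \<in> S then - monomial S x else monomial S x)"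
proof (cases "v \<in> S")
  case True
  have "monomial S y = y v * (\<Prod>u\<in>S - {v}. y u)" for y
    unfolding monomial_def using True assms by (simp add: prod.remove)
  moreover have "(\<Prod>u\<in>S - {v}. (x(v := - x v)) u) = (\<Prod>u\<in>S - {v}. x u)"
    by (rule prod.cong) auto
  ultimately show ?thesis using True by simp
next
  case False
  then show ?thesis unfolding monomial_def by (auto intro!: prod.cong)
qed

lemma monomial_mult:
  assumes "finite S" "finite T" "x \<in> sign_inputs I" "S \<subseteq> I"
  shows "monomial S x * monomial T x = monomial ((S - T) \<union> (T - S)) x"
proof -
  have 1: "monomial S x = monomial (S - T) x * monomial (S \<inter> T) x"
    unfolding monomial_def using assms
    by (subst prod.union_disjoint[symmetric]) (auto intro!: prod.cong)
  have 2: "monomial T x = monomial (T - S) x * monomial (S \<inter> T) x"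
    unfolding monomial_def using assms
    by (subst prod.union_disjoint[symmetric]) (auto intro!: prod.cong)
  have 3: "monomial (S \<inter> T) x * monomial (S \<inter> T) x = 1"
    unfolding monomial_def prod.distrib[symmetric]
    by (rule prod.neutral) (use assms(4) sign_inputs_square[OF assms(3)] in auto)
  have 4: "monomial ((S - T) \<union> (T - S)) x = monomial (S - T) x * monomial (T - S) x"
    unfolding monomial_def using assms by (intro prod.union_disjoint) auto
  show ?thesis unfolding 1 2 4 using 3
    by (metis (no_types, opaque_lifting) mult.assoc mult.commute mult.right_neutral)
qed

lemma cube_avg_monomial:
  assumes "finite I" "S \<subseteq> I"
  shows "cube_avg I (monomial S) = (if S = {} then 1 else 0)"
proof (cases "S = {}")
  case True
  have "monomial S = (\<lambda>x. 1)" by (simp add: True monomial_def fun_eq_iff)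
  then show ?thesis using True assms by simp
next
  case False
  then obtain v where v: "v \<in> S" by auto
  have "cube_avg I (monomial S) = 0"
    by (rule cube_avg_antisymmetric[where h = "\<lambda>x. x(v := - x v)"])
      (use v assms in \<open>auto simp: monomial_flip finite_subset intro!: sign_inputs_flip\<close>)
  then show ?thesis using False by simp
qed

lemma cube_avg_monomial_mult:
  assumes "finite I" "S \<subseteq> I" "T \<subseteq> I"
  shows "cube_avg I (\<lambda>x. monomial S x * monomial T x) = (if S = T then 1 else 0)"
proof -
  have "cube_avg I (\<lambda>x. monomial S x * monomial T x) = cube_avg I (monomial ((S - T) \<union> (T - S)))"
    by (rule cube_avg_cong) (use assms in \<open>auto intro!: monomial_mult intro: finite_subset\<close>)
  also have "\<dots> = (if S = T then 1 else 0)"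
    using assms by (subst cube_avg_monomial) auto
  finally show ?thesis .
qed

lemma monomial_insert: "finite S \<Longrightarrow> v \<notin> S \<Longrightarrow> monomial (insert v S) x = x v * monomial S x"
  unfolding monomial_def by simp

section \<open>The level inequality for decision trees\<close>

primrec dtree_step :: "('v \<Rightarrow> real) \<Rightarrow> 'v dtree \<Rightarrow> 'v dtree" where
  "dtree_step x (Leaf b) = Leaf b"
| "dtree_step x (Query v s t) = (if x v = 1 then s else t)"

primrec dtree_root :: "'v dtree \<Rightarrow> 'v set" where
  "dtree_root (Leaf b) = {}"
| "dtree_root (Query v s t) = {v}"

text \<open>A leaf is its own successor, so that every time \<open>t\<close> has a node, also after
  the answer is known.\<close>

definition dtree_node :: "'v dtree \<Rightarrow> ('v \<Rightarrow> real) \<Rightarrow> nat \<Rightarrow> 'v dtree" where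
  "dtree_node T x t = (dtree_step x ^^ t) T"

lemma dtree_node_Suc: "dtree_node T x (Suc t) = dtree_step x (dtree_node T x t)"
  unfolding dtree_node_def by simp

primrec dtree_seen :: "'v dtree \<Rightarrow> ('v \<Rightarrow> real) \<Rightarrow> nat \<Rightarrow> 'v set" where
  "dtree_seen T x 0 = {}"
| "dtree_seen T x (Suc t) = dtree_seen T x t \<union> dtree_root (dtree_node T x t)"

text \<open>Adaptedness: the course up to time \<open>t\<close> is decided by the bits read so far.
  Flipping an unread bit is therefore a symmetry of everything up to time \<open>t\<close>.\<close>

lemma dtree_seen_node_agree:
  assumes "\<And>v. v \<in> dtree_seen T x t \<Longrightarrow> x v = y v"
  shows "dtree_seen T y t = dtree_seen T x t \<and> dtree_node T y t = dtree_node T x t"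
  using assms
proof (induction t)
  case 0
  then show ?case by (simp add: dtree_node_def)
next
  case (Suc t)
  then have IH: "dtree_seen T y t = dtree_seen T x t" "dtree_node T y t = dtree_node T x t" by auto
  have "dtree_step y (dtree_node T x t) = dtree_step x (dtree_node T x t)"
    using Suc.prems by (cases "dtree_node T x t") auto
  then show ?case using IH by (simp add: dtree_node_Suc)
qed

lemma dtree_vars_step: "dtree_vars (dtree_step x T) \<subseteq> dtree_vars T"
  by (cases T) auto

lemma dtree_vars_node: "dtree_vars (dtree_node T x t) \<subseteq> dtree_vars T"
  by (induction t) (use dtree_vars_step in \<open>force simp: dtree_node_def\<close>)+

lemma dtree_root_vars: "dtree_root T \<subseteq> dtree_vars T"
  by (cases T) auto

lemma dtree_seen_vars: "dtree_seen T x t \<subseteq> dtree_vars T"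
  by (induction t) (use dtree_root_vars dtree_vars_node in force)+

lemma dtree_root_node:
  "dtree_root (dtree_node T x t) = {} \<or> (\<exists>v\<in>dtree_vars T. dtree_root (dtree_node T x t) = {v})"
  using dtree_root_vars[of "dtree_node T x t"] dtree_vars_node[of T x t]
  by (cases "dtree_node T x t") auto

lemma finite_dtree_seen [simp]: "finite (dtree_seen T x t)"
  by (induction t) (use dtree_root_node[of T x] in \<open>auto, metis finite.simps\<close>)

lemma card_dtree_seen: "card (dtree_seen T x t) \<le> t"
proof (induction t)
  case (Suc t)
  have "card (dtree_root (dtree_node T x t)) \<le> 1"
    using dtree_root_node[of T x t] by auto
  then show ?case using Suc card_Un_le[of "dtree_seen T x t" "dtree_root (dtree_node T x t)"] by simp
qed simp

lemma dtree_run_step: "dtree_run (dtree_step x T) x = dtree_run T x"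
  by (cases T) auto

lemma dtree_run_node: "dtree_run (dtree_node T x t) x = dtree_run T x"
  by (induction t) (simp_all only: dtree_node_Suc dtree_run_step, simp add: dtree_node_def)

lemma dtree_depth_step: "dtree_depth (dtree_step x T) \<le> dtree_depth T - 1"
  by (cases T) auto

lemma dtree_depth_node: "dtree_depth (dtree_node T x t) \<le> dtree_depth T - t"
proof (induction t)
  case (Suc t)
  then show ?case using dtree_depth_step[of x "dtree_node T x t"] by (simp add: dtree_node_Suc)
qed (simp add: dtree_node_def)

lemma dtree_run_seen:
  assumes "dtree_depth T \<le> d" and "\<And>v. v \<in> dtree_seen T x d \<Longrightarrow> x v = y v"
  shows "dtree_run T y = dtree_run T x"
proof -
  have "dtree_depth (dtree_node T x d) = 0" using dtree_depth_node[of T x d] assms(1) by simp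
  then obtain b where b: "dtree_node T x d = Leaf b" by (cases "dtree_node T x d") auto
  moreover have "dtree_node T y d = Leaf b" using dtree_seen_node_agree[of T x d y] assms(2) b by auto
  ultimately show ?thesis using dtree_run_node[of T x d] dtree_run_node[of T y d] by simp
qed

text \<open>Taking the martingale difference of a level sum moves the most recently queried element of \<open>S\<close>
  into \<open>R\<close>.\<close>

definition level_sum ::
  "('v set \<Rightarrow> real) \<Rightarrow> 'v dtree \<Rightarrow> nat \<Rightarrow> nat \<Rightarrow> 'v set \<Rightarrow> ('v \<Rightarrow> real) \<Rightarrow> real" where
  "level_sum w T t r R x =
     (\<Sum>S | S \<subseteq> dtree_seen T x t \<and> card S = r \<and> S \<inter> R = {}. w (S \<union> R) * monomial S x)"

lemma level_sum_agree:
  assumes "\<And>v. v \<in> dtree_seen T x t \<Longrightarrow> x v = y v"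
  shows "level_sum w T t r R y = level_sum w T t r R x"
proof -
  have "dtree_seen T y t = dtree_seen T x t" using dtree_seen_node_agree[of T x t y] assms by auto
  then show ?thesis unfolding level_sum_def monomial_def
    by (intro sum.cong arg_cong2[where f = "(*)"] prod.cong) (use assms in auto)
qed

lemma level_sum_0: "level_sum w T t 0 R x = w R"
proof -
  have "{S. S \<subseteq> dtree_seen T x t \<and> card S = 0 \<and> S \<inter> R = {}} = {{}}"
    using finite_subset[OF _ finite_dtree_seen[of T x t]] by (auto simp: card_eq_0_iff)
  then show ?thesis unfolding level_sum_def by (simp add: monomial_def)
qed

text \<open>Empty at a leaf and at a repeated query, otherwise the one fresh variable. With a set in
  place of an optional variable all cases share the formula in \<open>level_sum_Suc\<close>.\<close>

definition dtree_new :: "'v dtree \<Rightarrow> ('v \<Rightarrow> real) \<Rightarrow> nat \<Rightarrow> 'v set" where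
  "dtree_new T x t = dtree_root (dtree_node T x t) - dtree_seen T x t"

text \<open>The sum has at most one term. A fresh variable inside \<open>R\<close> contributes
  nothing, since the sets of a level sum avoid \<open>R\<close>.\<close>

definition level_increment ::
  "('v set \<Rightarrow> real) \<Rightarrow> 'v dtree \<Rightarrow> nat \<Rightarrow> nat \<Rightarrow> 'v set \<Rightarrow> ('v \<Rightarrow> real) \<Rightarrow> real" where
  "level_increment w T t r R x =
     (\<Sum>v \<in> dtree_new T x t - R. level_sum w T t r (insert v R) x)"

lemma level_increment_none: "dtree_new T x t = {} \<Longrightarrow> level_increment w T t r R x = 0"
  unfolding level_increment_def by simp

lemma level_increment_new:
  "dtree_new T x t = {v} \<Longrightarrow>
     level_increment w T t r R x = (if v \<in> R then 0 else level_sum w T t r (insert v R) x)"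
  unfolding level_increment_def by (simp add: insert_Diff_if)

lemma level_sum_Suc_none:
  assumes "dtree_root (dtree_node T x t) \<subseteq> dtree_seen T x t"
  shows "level_sum w T (Suc t) r R x = level_sum w T t r R x"
  using assms unfolding level_sum_def by (simp add: Un_absorb2)

text \<open>Split the sets by membership of \<open>v\<close>. Removing \<open>v\<close> leaves an
  \<open>r\<close>-set that avoids \<open>insert v R\<close> and carries the same weight, because
  \<open>v\<close> has only moved from \<open>S\<close> to \<open>R\<close>.\<close>

lemma level_sum_Suc_new:
  assumes v: "dtree_root (dtree_node T x t) = {v}" "v \<notin> dtree_seen T x t"
  shows "level_sum w T (Suc t) (Suc r) R x =
           level_sum w T t (Suc r) R x + x v * level_increment w T t r R x"
proof -
  define A where "A = dtree_seen T x t"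
  have [simp]: "finite A" "v \<notin> A" using v by (auto simp: A_def)
  have new: "dtree_new T x t = {v}" using v by (auto simp: dtree_new_def)
  define X where "X = {S. S \<subseteq> A \<and> card S = Suc r \<and> S \<inter> R = {}}"
  define Y where "Y = {S. S \<subseteq> A \<and> card S = r \<and> S \<inter> insert v R = {}}"
  have fin: "finite S" if "S \<subseteq> A" for S using that finite_subset[of S A] by simp
  have seen: "dtree_seen T x (Suc t) = insert v A" using v by (simp add: A_def)
  have fXY: "finite X" "finite Y" unfolding X_def Y_def by auto
  show ?thesis
  proof (cases "v \<in> R")
    case True
    have "{S. S \<subseteq> insert v A \<and> card S = Suc r \<and> S \<inter> R = {}} = X"
      unfolding X_def using True by auto
    moreover have "level_increment w T t r R x = 0" using True new by (simp add: level_increment_new)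
    ultimately show ?thesis unfolding level_sum_def seen by (simp add: X_def A_def)
  next
    case False
    have split: "{S. S \<subseteq> insert v A \<and> card S = Suc r \<and> S \<inter> R = {}} = X \<union> insert v ` Y"
    proof (intro equalityI subsetI)
      fix S assume S: "S \<in> {S. S \<subseteq> insert v A \<and> card S = Suc r \<and> S \<inter> R = {}}"
      show "S \<in> X \<union> insert v ` Y"
      proof (cases "v \<in> S")
        case True
        have "finite S" using S finite_subset[of S "insert v A"] by auto
        then have "card (S - {v}) = r" using S True by auto
        then have "S - {v} \<in> Y" using S unfolding Y_def by auto
        moreover have "S = insert v (S - {v})" using True by auto
        ultimately show ?thesis by blast
      qed (use S in \<open>auto simp: X_def\<close>)
    next
      fix S assume "S \<in> X \<union> insert v ` Y"
      then show "S \<in> {S. S \<subseteq> insert v A \<and> card S = Suc r \<and> S \<inter> R = {}}"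
        using False fin by (auto simp: X_def Y_def subset_iff)
    qed
    have disj: "X \<inter> insert v ` Y = {}" by (auto simp: X_def)
    have inj: "inj_on (insert v) Y" 
    proof (rule inj_onI)
      fix S S' assume *: "S \<in> Y" "S' \<in> Y" "insert v S = insert v S'"
      then have "v \<notin> S" "v \<notin> S'" unfolding Y_def by auto
      with * show "S = S'" by (metis insert_ident)
    qed
    have "level_sum w T (Suc t) (Suc r) R x =
      (\<Sum>S\<in>X. w (S \<union> R) * monomial S x) + (\<Sum>S\<in>Y. w (insert v S \<union> R) * monomial (insert v S) x)"
      unfolding level_sum_def seen split using fXY disj
      by (subst sum.union_disjoint) (auto simp: sum.reindex[OF inj])
    also have "(\<Sum>S\<in>Y. w (insert v S \<union> R) * monomial (insert v S) x) =
        (\<Sum>S\<in>Y. x v * (w (S \<union> insert v R) * monomial S x))"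
      by (rule sum.cong) (use fin in \<open>auto simp: Y_def monomial_insert\<close>)
    also have "\<dots> = x v * level_sum w T t r (insert v R) x"
      unfolding level_sum_def sum_distrib_left Y_def A_def ..
    also have "level_sum w T t r (insert v R) x = level_increment w T t r R x"
      using False new by (simp add: level_increment_new)
    finally show ?thesis unfolding level_sum_def X_def A_def .
  qed
qed

section \<open>Moment inequalities\<close>

lemma binomial_double_le: "2 * j \<le> 2 * q \<Longrightarrow> real (2 * q choose (2 * j)) \<le> real (q choose j) * (2 * real q - 1) ^ j"
proof (induction j)
  case (Suc j)
  then have j: "Suc j \<le> q" by simp
  have rec: "real (Suc i) * real (m choose Suc i) = (real m - real i) * real (m choose i)" if "i \<le> m" for i m
  proof -
    have "Suc i * (m choose Suc i) = (m - i) * (m choose i)"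
      by (metis binomial_absorb_comp binomial_absorption mult.commute)
    then show ?thesis using that by (metis of_nat_diff of_nat_mult)
  qed
  have a1: "(2 * real j + 1) * real (2 * q choose Suc (2 * j)) = (2 * real q - 2 * real j) * real (2 * q choose (2 * j))"
    using rec[of "2 * j" "2 * q"] j unfolding of_nat_Suc of_nat_mult of_nat_numeral by (simp add: add.commute[of 1])
  have a2: "(2 * real j + 2) * real (2 * q choose Suc (Suc (2 * j))) = (2 * real q - 2 * real j - 1) * real (2 * q choose Suc (2 * j))"
    using rec[of "Suc (2 * j)" "2 * q"] j by (simp add: algebra_simps)
  have b: "(real j + 1) * real (q choose Suc j) = (real q - real j) * real (q choose j)"
    using rec[of j q] j by (simp add: algebra_simps)
  \<comment> \<open>The ratio of the coefficients at \<open>2 * j + 2\<close> and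
    \<open>2 * j\<close> is the ratio of \<open>q choose Suc j\<close> to \<open>q choose j\<close>
    times \<open>(2 q - 2 j - 1) / (2 j + 1)\<close>, and this last factor is at most
    \<open>2 q - 1\<close>.\<close>
  have "(2 * real j + 1) * ((2 * real j + 2) * real (2 * q choose (2 * Suc j)))
     = (2 * real q - 2 * real j - 1) * ((2 * real q - 2 * real j) * real (2 * q choose (2 * j)))"
  proof -
    have "2 * Suc j = Suc (Suc (2 * j))" by simp
    then have "(2 * real j + 1) * ((2 * real j + 2) * real (2 * q choose (2 * Suc j)))
        = (2 * real j + 1) * ((2 * real q - 2 * real j - 1) * real (2 * q choose Suc (2 * j)))"
      using a2 by (simp only:)
    also have "\<dots> = (2 * real q - 2 * real j - 1) * ((2 * real j + 1) * real (2 * q choose Suc (2 * j)))"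
      by (rule mult.left_commute)
    finally show ?thesis using a1 by (simp only:)
  qed
  also have "\<dots> \<le> (2 * real q - 2 * real j - 1) * ((2 * real q - 2 * real j) * (real (q choose j) * (2 * real q - 1) ^ j))"
    using Suc j by (intro mult_left_mono) auto
  also have "\<dots> \<le> (2 * real q - 1) * ((2 * real q - 2 * real j) * (real (q choose j) * (2 * real q - 1) ^ j))"
    using j by (intro mult_right_mono) auto
  also have "\<dots> = (2 * real j + 2) * (real (q choose Suc j) * (2 * real q - 1) ^ Suc j)"
    using arg_cong[OF b, of "\<lambda>y. 2 * y * (2 * real q - 1) ^ Suc j"] by (simp add: algebra_simps)
  also have "\<dots> \<le> (2 * real j + 1) * ((2 * real j + 2) * (real (q choose Suc j) * (2 * real q - 1) ^ Suc j))"
  proof -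
    have "0 \<le> (2 * real j + 2) * (real (q choose Suc j) * (2 * real q - 1) ^ Suc j)"
      using j by (intro mult_nonneg_nonneg zero_le_power) auto
    then have "1 * ((2 * real j + 2) * (real (q choose Suc j) * (2 * real q - 1) ^ Suc j)) \<le> (2 * real j + 1) * ((2 * real j + 2) * (real (q choose Suc j) * (2 * real q - 1) ^ Suc j))"
      by (intro mult_right_mono) auto
    then show ?thesis by simp
  qed
  finally have "(2 * real j + 1) * ((2 * real j + 2) * real (2 * q choose (2 * Suc j)))
     \<le> (2 * real j + 1) * ((2 * real j + 2) * (real (q choose Suc j) * (2 * real q - 1) ^ Suc j))" .
  then have "(2 * real j + 2) * real (2 * q choose (2 * Suc j))
     \<le> (2 * real j + 2) * (real (q choose Suc j) * (2 * real q - 1) ^ Suc j)"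
    by (rule mult_left_le_imp_le) simp
  then show ?case by (rule mult_left_le_imp_le) simp
qed simp

text \<open>Symmetrization keeps only the even powers of \<open>y\<close>, and
  \<open>binomial_double_le\<close> compares the coefficients. The factor \<open>2 q - 1\<close> is
  the hypercontractive constant \<open>p - 1\<close> for \<open>p = 2 q\<close>.\<close>

lemma two_point_inequality:
  fixes x y :: real
  assumes "q > 0"
  shows "((x + y) ^ (2 * q) + (x - y) ^ (2 * q)) / 2 \<le> (x\<^sup>2 + (2 * real q - 1) * y\<^sup>2) ^ q"
proof -
  define f where "f i = real (2 * q choose i) * y ^ i * x ^ (2 * q - i)" for i
  have "(x + y) ^ (2 * q) = (\<Sum>i\<le>2 * q. f i)"
    unfolding f_def by (subst add.commute, subst binomial_ring) simp
  moreover have "(x - y) ^ (2 * q) = (\<Sum>i\<le>2 * q. (- 1) ^ i * f i)"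
  proof -
    have "(x - y) ^ (2 * q) = (- y + x) ^ (2 * q)" by simp
    also have "\<dots> = (\<Sum>i\<le>2 * q. real (2 * q choose i) * (- y) ^ i * x ^ (2 * q - i))"
      by (subst binomial_ring) simp
    also have "\<dots> = (\<Sum>i\<le>2 * q. (- 1) ^ i * f i)"
      unfolding f_def by (intro sum.cong refl, subst power_minus) simp
    finally show ?thesis .
  qed
  ultimately have "((x + y) ^ (2 * q) + (x - y) ^ (2 * q)) / 2 = (\<Sum>i\<le>2 * q. (1 + (- 1) ^ i) / 2 * f i)"
    by (simp add: sum.distrib[symmetric] sum_divide_distrib algebra_simps add_divide_distrib)
  also have "\<dots> = (\<Sum>i\<in>(\<lambda>j. 2 * j) ` {..q}. f i)"
  proof (rule sum.mono_neutral_cong_right)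
    show "\<forall>i\<in>{..2 * q} - (\<lambda>j. 2 * j) ` {..q}. (1 + (- 1) ^ i) / 2 * f i = 0"
    proof
      fix i assume i: "i \<in> {..2 * q} - (\<lambda>j. 2 * j) ` {..q}"
      then have "odd i" by (auto elim!: evenE)
      then show "(1 + (- 1) ^ i) / 2 * f i = 0" by simp
    qed
  qed auto
  also have "\<dots> = (\<Sum>j\<le>q. f (2 * j))"
    by (subst sum.reindex) (auto simp: inj_on_def)
  also have "\<dots> \<le> (\<Sum>j\<le>q. real (q choose j) * ((2 * real q - 1) * y\<^sup>2) ^ j * (x\<^sup>2) ^ (q - j))"
  proof (rule sum_mono)
    fix j assume "j \<in> {..q}"
    then have j: "2 * j \<le> 2 * q" by simp
    have "2 * q - 2 * j = 2 * (q - j)" by simp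
    then have "f (2 * j) = real (2 * q choose (2 * j)) * ((y\<^sup>2) ^ j * (x\<^sup>2) ^ (q - j))"
      unfolding f_def by (simp only: power_mult mult.assoc)
    also have "\<dots> \<le> (real (q choose j) * (2 * real q - 1) ^ j) * ((y\<^sup>2) ^ j * (x\<^sup>2) ^ (q - j))"
      by (intro mult_right_mono binomial_double_le j) auto
    finally show "f (2 * j) \<le> real (q choose j) * ((2 * real q - 1) * y\<^sup>2) ^ j * (x\<^sup>2) ^ (q - j)"
      by (simp add: power_mult_distrib mult_ac)
  qed
  also have "\<dots> = (x\<^sup>2 + (2 * real q - 1) * y\<^sup>2) ^ q"
    by (subst add.commute, subst binomial_ring) simp
  finally show ?thesis .
qed

lemma convex_on_power_nonneg: "convex_on {0..} (\<lambda>y::real. y ^ q)"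
  using convex_power_even[of q] convex_power_odd[of q]
  by (cases "even q") (auto intro: convex_on_subset)

text \<open>Jensen's inequality at the points \<open>u / a\<close> and \<open>v / b\<close> with
  weights proportional to \<open>a\<close> and \<open>b\<close>.\<close>

lemma power_convex_combination:
  fixes u v a b :: real
  assumes "u \<ge> 0" "v \<ge> 0" "a > 0" "b > 0"
  shows "(u + v) ^ q \<le> (a + b) ^ q * (a / (a + b) * (u ^ q / a ^ q) + b / (a + b) * (v ^ q / b ^ q))"
proof -
  have eq: "a / (a + b) = 1 - b / (a + b)" using assms by (simp add: field_simps)
  have "((1 - b / (a + b)) *\<^sub>R (u / a) + (b / (a + b)) *\<^sub>R (v / b)) ^ q
      \<le> (1 - b / (a + b)) * (u / a) ^ q + b / (a + b) * (v / b) ^ q"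
    by (rule convex_onD[OF convex_on_power_nonneg]) (use assms in auto)
  then have "(a / (a + b) * (u / a) + b / (a + b) * (v / b)) ^ q
      \<le> a / (a + b) * (u / a) ^ q + b / (a + b) * (v / b) ^ q"
    unfolding eq by simp
  moreover have "a / (a + b) * (u / a) + b / (a + b) * (v / b) = (u + v) / (a + b)"
    using assms by (simp add: add_divide_distrib)
  ultimately have "((u + v) / (a + b)) ^ q \<le> a / (a + b) * (u ^ q / a ^ q) + b / (a + b) * (v ^ q / b ^ q)"
    by (simp add: power_divide)
  then have "(a + b) ^ q * ((u + v) / (a + b)) ^ q \<le> (a + b) ^ q * (a / (a + b) * (u ^ q / a ^ q) + b / (a + b) * (v ^ q / b ^ q))"
    using assms by (intro mult_left_mono) auto
  then show ?thesis using assms by (simp add: power_divide)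
qed

text \<open>A form of Minkowski's inequality that avoids taking roots.\<close>

lemma cube_avg_power_add:
  assumes I: "finite I" and pos: "a > 0" "b > 0"
    and nn: "\<And>x. x \<in> sign_inputs I \<Longrightarrow> U x \<ge> 0" "\<And>x. x \<in> sign_inputs I \<Longrightarrow> V x \<ge> 0"
    and U: "cube_avg I (\<lambda>x. U x ^ q) \<le> a ^ q" and V: "cube_avg I (\<lambda>x. V x ^ q) \<le> b ^ q"
  shows "cube_avg I (\<lambda>x. (U x + V x) ^ q) \<le> (a + b) ^ q"
proof -
  have "cube_avg I (\<lambda>x. (U x + V x) ^ q) \<le> cube_avg I (\<lambda>x.
      (a + b) ^ q * (a / (a + b) / a ^ q * U x ^ q + b / (a + b) / b ^ q * V x ^ q))"
    by (rule cube_avg_mono, rule order_trans[OF power_convex_combination[of _ _ a b]])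
      (use pos nn in auto)
  also have "\<dots> = (a + b) ^ q * (a / (a + b) / a ^ q * cube_avg I (\<lambda>x. U x ^ q)
      + b / (a + b) / b ^ q * cube_avg I (\<lambda>x. V x ^ q))"
    by (simp only: cube_avg_cmult cube_avg_add)
  also have "\<dots> \<le> (a + b) ^ q * (a / (a + b) / a ^ q * a ^ q + b / (a + b) / b ^ q * b ^ q)"
    using pos by (intro mult_left_mono add_mono U V) auto
  also have "\<dots> = (a + b) ^ q"
    using pos by (simp add: add_divide_distrib[symmetric])
  finally show ?thesis .
qed

text \<open>Bernoulli's inequality for \<open>1 + 1 / t\<close>. It acts as a discrete integration
  in the moment bound: adding the increment moves \<open>t\<close> to \<open>t + 1\<close>.\<close>

lemma power_Suc_diff_ge:
  fixes t :: real
  assumes "t \<ge> 0"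
  shows "t ^ Suc r + real (Suc r) * t ^ r \<le> (t + 1) ^ Suc r"
proof (cases "t = 0")
  case False
  then have t: "t > 0" using assms by simp
  have "1 + real (Suc r) * (1 / t) \<le> (1 + 1 / t) ^ Suc r"
    by (rule Bernoulli_inequality) (use t in \<open>auto intro: order_trans[of _ 0]\<close>)
  then have "t ^ Suc r * (1 + real (Suc r) * (1 / t)) \<le> t ^ Suc r * (1 + 1 / t) ^ Suc r"
    using t by (intro mult_left_mono) auto
  also have "\<dots> = (t + 1) ^ Suc r"
  proof -
    have "t * (1 + 1 / t) = t + 1" using t by (simp add: distrib_left)
    then show ?thesis by (simp only: power_mult_distrib[symmetric])
  qed
  also have "t ^ Suc r * (1 + real (Suc r) * (1 / t)) = t ^ Suc r + real (Suc r) * t ^ r"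
    using t by (simp add: field_simps)
  finally show ?thesis .
qed (cases r; simp)

lemma dtree_new_cases:
  assumes "dtree_vars T \<subseteq> I"
  obtains "dtree_new T x t = {}"
  | v where "v \<in> I" "v \<notin> dtree_seen T x t" "dtree_root (dtree_node T x t) = {v}" "dtree_new T x t = {v}"
proof -
  consider "dtree_root (dtree_node T x t) = {}" | v where "v \<in> dtree_vars T" "dtree_root (dtree_node T x t) = {v}"
    using dtree_root_node[of T x t] by auto
  then show ?thesis
  proof cases
    case 2
    then show ?thesis using that assms unfolding dtree_new_def by (cases "v \<in> dtree_seen T x t") auto
  qed (use that in \<open>auto simp: dtree_new_def\<close>)
qed

text \<open>The martingale difference is the fresh bit times a quantity that does not depend on this
  bit.\<close>

lemma level_sum_Suc:
  assumes "dtree_vars T \<subseteq> I"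
  shows "level_sum w T (Suc t) (Suc r) R x =
           level_sum w T t (Suc r) R x + monomial (dtree_new T x t) x * level_increment w T t r R x"
proof (rule dtree_new_cases[OF assms, of x t])
  assume n: "dtree_new T x t = {}"
  then have "dtree_root (dtree_node T x t) \<subseteq> dtree_seen T x t" unfolding dtree_new_def by auto
  then show ?thesis using level_sum_Suc_none[of T x t w "Suc r" R] n by (simp add: level_increment_none)
next
  fix v assume "v \<in> I" "v \<notin> dtree_seen T x t" "dtree_root (dtree_node T x t) = {v}" "dtree_new T x t = {v}"
  then show ?thesis using level_sum_Suc_new[of T x t v w r R] by (simp add: monomial_def)
qed

text \<open>Induction on time for all \<open>r\<close> and \<open>R\<close> at once, since an
  increment at level \<open>r\<close> is a sum of level \<open>r - 1\<close> with a larger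
  \<open>R\<close>. Time is counted as \<open>t + 1\<close> to keep the bound positive at
  \<open>t = 0\<close>, as \<open>cube_avg_power_add\<close> requires. The divisor
  \<open>fact r\<close> reflects that each set is built in the order in which its variables are
  read.\<close>

theorem level_sum_moment:
  fixes w :: "'v set \<Rightarrow> real"
  assumes I: "finite I" and T: "dtree_vars T \<subseteq> I" and q: "q > 0"
    and B: "B > 0" and c: "c > 0" "real (card I) \<le> c ^ q"
    and w: "\<And>S. S \<subseteq> I \<Longrightarrow> card S = l \<Longrightarrow> \<bar>w S\<bar> \<le> B"
    and R: "R \<subseteq> I" "card R + r = l"
  shows "cube_avg I (\<lambda>x. level_sum w T t r R x ^ (2 * q))
           \<le> (B\<^sup>2 * ((2 * real q - 1) * c * (real t + 1)) ^ r / fact r) ^ q"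
proof -
  have w_power: "w R ^ (2 * q) \<le> (B\<^sup>2) ^ q" if "R \<subseteq> I" "card R = l" for R
  proof -
    have "\<bar>w R\<bar> \<le> \<bar>B\<bar>" using w[OF that] B by simp
    then have "(w R)\<^sup>2 \<le> B\<^sup>2" by (simp only: abs_le_square_iff)
    then show ?thesis unfolding power_mult by (rule power_mono) simp
  qed
  show ?thesis
    using R
  proof (induction t arbitrary: r R)
    case (0 r R)
    show ?case
    proof (cases r)
      case 0
      have "w R ^ (2 * q) \<le> (B\<^sup>2) ^ q" using w_power "0.prems" 0 by simp
      then show ?thesis using I 0 by (simp add: level_sum_0)
    next
      case (Suc r')
      have "{S. S \<subseteq> dtree_seen T x 0 \<and> card S = r \<and> S \<inter> R = {}} = {}" for x
        unfolding Suc by auto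
      then have "level_sum w T 0 r R x = 0" for x unfolding level_sum_def by (simp only: sum.empty)
      then show ?thesis using I q B c Suc by (simp add: power_0_left)
    qed
  next
    case (Suc t r R)
    show ?case
    proof (cases r)
      case 0
      have "w R ^ (2 * q) \<le> (B\<^sup>2) ^ q" using w_power Suc.prems 0 by simp
      then show ?thesis using I 0 by (simp add: level_sum_0)
    next
      case (Suc r')
      define K where "K = (2 * real q - 1) * c"
      have K: "K > 0" unfolding K_def using q c by simp
      define X where "X = level_sum w T t r R"
      define Y where "Y = level_increment w T t r' R"
      define s where "s x = monomial (dtree_new T x t) x" for x
      \<comment> \<open>Flips the bit about to be read, if it is a fresh one. Neither the past nor
        the choice of that bit changes, so this is an involution.\<close>
      define h where "h x = (\<lambda>u. if u \<in> dtree_new T x t then - x u else x u)" for x :: "'v \<Rightarrow> real"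
      define a where "a = B\<^sup>2 * (K * (real t + 1)) ^ r / fact r"
      define \<beta> where "\<beta> = B\<^sup>2 * (K * (real t + 1)) ^ r' / fact r'"
      have ab: "a > 0" "\<beta> > 0" unfolding a_def \<beta>_def using B K by auto
      have h_agree: "x v = h x v" if "v \<in> dtree_seen T x t" for x v
        using that unfolding h_def dtree_new_def by auto
      have h_node: "dtree_node T (h x) t = dtree_node T x t" "dtree_seen T (h x) t = dtree_seen T x t" for x
        using dtree_seen_node_agree[of T x t "h x", OF h_agree] by auto
      have h_new: "dtree_new T (h x) t = dtree_new T x t" for x
        unfolding dtree_new_def h_node ..
      have hh: "h (h x) = x" for x
      proof
        fix v
        show "h (h x) v = x v"
          by (cases "v \<in> dtree_new T x t") (simp_all add: h_def[of "h x"] h_new, simp_all add: h_def)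
      qed
      have h_eq: "h x = (if dtree_new T x t = {} then x else x(the_elem (dtree_new T x t) := - x (the_elem (dtree_new T x t))))" for x
        by (rule dtree_new_cases[OF T, of x t]) (auto simp: h_def)
      have h_in: "h x \<in> sign_inputs I" if "x \<in> sign_inputs I" for x
        using that by (rule_tac dtree_new_cases[OF T, of x t]) (auto simp: h_eq intro: sign_inputs_flip)
      have X_h: "X (h x) = X x" for x
        unfolding X_def by (rule level_sum_agree, rule h_agree)
      have Y_h: "Y (h x) = Y x" for x
        unfolding Y_def level_increment_def h_new
        by (intro sum.cong refl level_sum_agree h_agree)
      have sY_h: "s (h x) * Y (h x) = - (s x * Y x)" for x
      proof (rule dtree_new_cases[OF T, of x t])
        assume "dtree_new T x t = {}"
        then have "Y x = 0" unfolding Y_def by (rule level_increment_none)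
        then show ?thesis using Y_h by simp
      next
        fix v assume v: "dtree_new T x t = {v}"
        then have "s (h x) = - s x" unfolding s_def h_new by (simp add: v monomial_def) (simp add: h_def v)
        then show ?thesis using Y_h by simp
      qed
      have s2: "(s x)\<^sup>2 = 1" if "x \<in> sign_inputs I" for x
        using that sign_inputs_square[OF that]
        by (rule_tac dtree_new_cases[OF T, of x t]) (auto simp: s_def monomial_def power2_eq_square)
      have lev: "level_sum w T (Suc t) r R x = X x + s x * Y x" for x
        unfolding X_def Y_def s_def Suc by (rule level_sum_Suc[OF T])
      have avgX: "cube_avg I (\<lambda>x. (X x)\<^sup>2 ^ q) \<le> a ^ q"
        using Suc.IH[OF Suc.prems] unfolding X_def a_def K_def power_mult .
      \<comment> \<open>Which variable comes next depends on \<open>x\<close>. As the powers are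
        even, the sum over all candidates is an upper bound free of this dependence.\<close>
      have "cube_avg I (\<lambda>x. Y x ^ (2 * q))
          \<le> cube_avg I (\<lambda>x. \<Sum>v\<in>I - R. level_sum w T t r' (insert v R) x ^ (2 * q))"
      proof (rule cube_avg_mono)
        fix x assume "x \<in> sign_inputs I"
        show "Y x ^ (2 * q) \<le> (\<Sum>v\<in>I - R. level_sum w T t r' (insert v R) x ^ (2 * q))"
        proof (rule dtree_new_cases[OF T, of x t])
          assume "dtree_new T x t = {}"
          then have "Y x = 0" unfolding Y_def by (rule level_increment_none)
          then show ?thesis using q by (simp add: power_0_left sum_nonneg)
        next
          fix v assume v: "v \<in> I" "dtree_new T x t = {v}"
          show ?thesis
          proof (cases "v \<in> R")
            case True
            then have "Y x = 0" using v unfolding Y_def by (simp add: level_increment_new)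
            then show ?thesis using q by (simp add: power_0_left sum_nonneg)
          next
            case False
            then have "Y x = level_sum w T t r' (insert v R) x"
              using v unfolding Y_def by (simp add: level_increment_new)
            also have "\<dots> ^ (2 * q) \<le> (\<Sum>v\<in>I - R. level_sum w T t r' (insert v R) x ^ (2 * q))"
              using v False I by (intro member_le_sum) auto
            finally show ?thesis .
          qed
        qed
      qed
      also have "\<dots> \<le> (\<Sum>v\<in>I - R. \<beta> ^ q)"
        unfolding cube_avg_sum
      proof (rule sum_mono)
        fix v assume v: "v \<in> I - R"
        have "finite R" using Suc.prems I finite_subset by auto
        then show "cube_avg I (\<lambda>x. level_sum w T t r' (insert v R) x ^ (2 * q)) \<le> \<beta> ^ q"
          unfolding \<beta>_def K_def using v Suc.prems Suc by (intro Suc.IH) auto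
      qed
      also have "\<dots> \<le> real (card I) * \<beta> ^ q"
        using ab I by (simp add: card_mono mult_right_mono)
      also have "\<dots> \<le> c ^ q * \<beta> ^ q" using c ab by (intro mult_right_mono) auto
      finally have "cube_avg I (\<lambda>x. (2 * real q - 1) ^ q * Y x ^ (2 * q)) \<le> (2 * real q - 1) ^ q * (c ^ q * \<beta> ^ q)"
        unfolding cube_avg_cmult using q by (intro mult_left_mono) auto
      then have avgY: "cube_avg I (\<lambda>x. ((2 * real q - 1) * (Y x)\<^sup>2) ^ q) \<le> (K * \<beta>) ^ q"
        by (simp only: power_mult_distrib K_def power_mult mult.assoc)
      have "cube_avg I (\<lambda>x. level_sum w T (Suc t) r R x ^ (2 * q)) = cube_avg I (\<lambda>x. (X x + s x * Y x) ^ (2 * q))"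
        unfolding lev ..
      \<comment> \<open>Averaging with the copy under \<open>h\<close> produces both signs of the
        fresh bit at the same \<open>X\<close> and \<open>Y\<close>, which is the situation of the
        two-point inequality.\<close>
      also have "\<dots> = (cube_avg I (\<lambda>x. (X x + s x * Y x) ^ (2 * q)) + cube_avg I (\<lambda>x. (X (h x) + s (h x) * Y (h x)) ^ (2 * q))) / 2"
        using cube_avg_involution[of I h "\<lambda>x. (X x + s x * Y x) ^ (2 * q)"] h_in hh by simp
      also have "\<dots> = cube_avg I (\<lambda>x. 1 / 2 * ((X x + s x * Y x) ^ (2 * q) + (X x - s x * Y x) ^ (2 * q)))"
        unfolding cube_avg_cmult cube_avg_add X_h sY_h by simp
      also have "\<dots> \<le> cube_avg I (\<lambda>x. ((X x)\<^sup>2 + (2 * real q - 1) * (Y x)\<^sup>2) ^ q)"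
      proof (rule cube_avg_mono)
        fix x assume x: "x \<in> sign_inputs I"
        show "1 / 2 * ((X x + s x * Y x) ^ (2 * q) + (X x - s x * Y x) ^ (2 * q))
            \<le> ((X x)\<^sup>2 + (2 * real q - 1) * (Y x)\<^sup>2) ^ q"
          using two_point_inequality[OF q, of "X x" "s x * Y x"] s2[OF x] by (simp add: power_mult_distrib)
      qed
      also have "\<dots> \<le> (a + K * \<beta>) ^ q"
        by (rule cube_avg_power_add[OF I]) (use ab K avgX avgY q in auto)
      also have "\<dots> \<le> (B\<^sup>2 * (K * (real (Suc t) + 1)) ^ r / fact r) ^ q"
      proof (rule power_mono)
        have f: "fact r = real r * fact r'" unfolding Suc by simp
        have r0: "real r > 0" using Suc by simp
        have e1: "a = B\<^sup>2 * K ^ r * ((real t + 1) ^ Suc r' / fact r)"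
          unfolding a_def by (simp only: power_mult_distrib Suc mult.assoc times_divide_eq_right)
        have "K * \<beta> = B\<^sup>2 * K ^ r * ((real t + 1) ^ r' / fact r')"
          unfolding \<beta>_def by (simp add: power_mult_distrib Suc)
        also have "(real t + 1) ^ r' / fact r' = real (Suc r') * (real t + 1) ^ r' / fact r"
          unfolding f using r0 Suc by simp
        finally have e2: "K * \<beta> = B\<^sup>2 * K ^ r * (real (Suc r') * (real t + 1) ^ r' / fact r)" .
        have "a + K * \<beta> = B\<^sup>2 * K ^ r * (((real t + 1) ^ Suc r' + real (Suc r') * (real t + 1) ^ r') / fact r)"
          unfolding e1 e2 distrib_left[symmetric] add_divide_distrib ..
        also have "\<dots> \<le> B\<^sup>2 * K ^ r * ((real t + 1 + 1) ^ Suc r' / fact r)"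
          using B K by (intro mult_left_mono divide_right_mono power_Suc_diff_ge) auto
        also have "real t + 1 + 1 = real (Suc t) + 1" by simp
        finally show "a + K * \<beta> \<le> B\<^sup>2 * (K * (real (Suc t) + 1)) ^ r / fact r"
          unfolding Suc by (simp only: power_mult_distrib mult.assoc times_divide_eq_right)
      qed (use ab K in auto)
      finally show ?thesis unfolding K_def .
    qed
  qed
qed

section \<open>From moments to the advantage of a tree\<close>

lemma cube_avg_abs_le_of_moment:
  assumes I: "finite I" and q: "q > 0" and b: "b > 0" and Z: "cube_avg I (\<lambda>x. Z x ^ (2 * q)) \<le> b ^ q"
  shows "cube_avg I (\<lambda>x. \<bar>Z x\<bar>) \<le> sqrt b"
proof -
  have sb: "sqrt b ^ (2 * q) = b ^ q" using b by (simp add: power_mult)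
  have "cube_avg I (\<lambda>x. \<bar>Z x\<bar>) \<le> cube_avg I (\<lambda>x. sqrt b / (2 * q) * (1 / b ^ q * Z x ^ (2 * q) + (2 * real q - 1)))"
  proof (rule cube_avg_mono)
    fix x
    define y where "y = \<bar>Z x\<bar> / sqrt b"
    have y: "y \<ge> 0" unfolding y_def using b by simp
    \<comment> \<open>The tangent of \<open>y ^ (2 * q)\<close> at 1 yields the power mean
      inequality without taking roots.\<close>
    have "1 + real (2 * q) * (y - 1) \<le> (1 + (y - 1)) ^ (2 * q)"
      by (rule Bernoulli_inequality) (use y in auto)
    then have "y \<le> 1 / (2 * q) * (y ^ (2 * q) + (2 * real q - 1))"
      using q by (simp add: field_simps)
    then have "sqrt b * y \<le> sqrt b * (1 / (2 * q) * (y ^ (2 * q) + (2 * real q - 1)))"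
      using b by (intro mult_left_mono) auto
    moreover have "sqrt b * y = \<bar>Z x\<bar>" unfolding y_def using b by simp
    moreover have "y ^ (2 * q) = 1 / b ^ q * Z x ^ (2 * q)"
      unfolding y_def power_divide sb by (simp add: power_mult)
    ultimately show "\<bar>Z x\<bar> \<le> sqrt b / (2 * q) * (1 / b ^ q * Z x ^ (2 * q) + (2 * real q - 1))"
      by simp
  qed
  also have "\<dots> = sqrt b / (2 * q) * (1 / b ^ q * cube_avg I (\<lambda>x. Z x ^ (2 * q)) + (2 * real q - 1))"
    by (simp only: cube_avg_cmult cube_avg_add cube_avg_const[OF I])
  also have "\<dots> \<le> sqrt b / (2 * q) * (1 / b ^ q * b ^ q + (2 * real q - 1))"
    using b q Z by (intro mult_left_mono add_mono) auto
  also have "\<dots> = sqrt b" using b q by simp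
  finally show ?thesis .
qed

text \<open>If \<open>S\<close> has an unread variable, flipping it negates the monomial and leaves
  the answer alone. The choice \<open>u x\<close> depends only on the set of variables read, so it
  survives the flip and the map is an involution.\<close>

lemma cube_avg_dtree_monomial:
  assumes I: "finite I" and T: "dtree_vars T \<subseteq> I" "dtree_depth T \<le> d" and S: "S \<subseteq> I"
  shows "cube_avg I (\<lambda>x. of_bool (dtree_run T x) * monomial S x)
       = cube_avg I (\<lambda>x. of_bool (dtree_run T x) * (of_bool (S \<subseteq> dtree_seen T x d) * monomial S x))"
proof -
  define u where "u x = (SOME v. v \<in> S - dtree_seen T x d)" for x
  have u: "u x \<in> S - dtree_seen T x d" if "\<not> S \<subseteq> dtree_seen T x d" for x
    unfolding u_def by (rule someI_ex) (use that in auto)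
  define h where "h x = (if S \<subseteq> dtree_seen T x d then x else x(u x := - x (u x)))" for x
  have agree: "x v = h x v" if "v \<in> dtree_seen T x d" for x v
    using that u[of x] unfolding h_def by auto
  have seen: "dtree_seen T (h x) d = dtree_seen T x d" for x
    using dtree_seen_node_agree[of T x d "h x", OF agree] by auto
  have uh: "u (h x) = u x" for x unfolding u_def seen ..
  have "cube_avg I (\<lambda>x. of_bool (dtree_run T x) * (of_bool (\<not> S \<subseteq> dtree_seen T x d) * monomial S x)) = 0"
  proof (rule cube_avg_antisymmetric[where h = h])
    fix x assume x: "x \<in> sign_inputs I"
    show "h x \<in> sign_inputs I" using x u[of x] S by (auto simp: h_def intro!: sign_inputs_flip)
    show "h (h x) = x"
    proof (cases "S \<subseteq> dtree_seen T x d")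
      case False
      then have hx: "h x = x(u x := - x (u x))" by (simp add: h_def)
      have "h (h x) = (h x)(u x := - h x (u x))"
        using False by (simp add: h_def[of "h x"] uh seen)
      then show ?thesis by (simp add: hx)
    qed (simp add: h_def)
    have run: "dtree_run T (h x) = dtree_run T x"
      by (rule dtree_run_seen[OF T(2)], rule agree)
    show "of_bool (dtree_run T (h x)) * (of_bool (\<not> S \<subseteq> dtree_seen T (h x) d) * monomial S (h x)) =
      - (of_bool (dtree_run T x) * (of_bool (\<not> S \<subseteq> dtree_seen T x d) * monomial S x) :: real)"
      unfolding run seen using u[of x] finite_subset[OF S I] by (auto simp: h_def monomial_flip)
  qed
  moreover have "cube_avg I (\<lambda>x. of_bool (dtree_run T x) * monomial S x) =
      cube_avg I (\<lambda>x. of_bool (dtree_run T x) * (of_bool (S \<subseteq> dtree_seen T x d) * monomial S x)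
        + of_bool (dtree_run T x) * (of_bool (\<not> S \<subseteq> dtree_seen T x d) * monomial S x))"
    by (rule cube_avg_cong) auto
  ultimately show ?thesis unfolding cube_avg_add by simp
qed

text \<open>A run reads at most \<open>d\<close> variables, so no level above \<open>d\<close>
  appears. Level 0 is the acceptance probability under uniform inputs, which is the term
  subtracted.\<close>

theorem dtree_advantage:
  fixes w :: "'v set \<Rightarrow> real"
  assumes I: "finite I" and T: "dtree_vars T \<subseteq> I" "dtree_depth T \<le> d" and q: "q > 0"
    and c: "c > 0" "real (card I) \<le> c ^ q"
    and w0: "w {} = 1"
    and B: "\<And>l. l \<in> {1..d} \<Longrightarrow> B l \<ge> 0"
    and w: "\<And>S. S \<subseteq> I \<Longrightarrow> card S \<in> {1..d} \<Longrightarrow> \<bar>w S\<bar> \<le> B (card S)"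
  shows "\<bar>cube_avg I (\<lambda>x. (\<Sum>S\<in>Pow I. w S * monomial S x) * of_bool (dtree_run T x))
            - cube_avg I (\<lambda>x. of_bool (dtree_run T x))\<bar>
         \<le> (\<Sum>l=1..d. B l * sqrt (((2 * real q - 1) * c * (real d + 1)) ^ l / fact l))"
proof -
  define f where "f x = (of_bool (dtree_run T x) :: real)" for x
  have f1: "\<bar>f x\<bar> \<le> 1" for x by (simp add: f_def)
  have "cube_avg I (\<lambda>x. (\<Sum>S\<in>Pow I. w S * monomial S x) * f x)
      = (\<Sum>S\<in>Pow I. w S * cube_avg I (\<lambda>x. f x * monomial S x))"
    by (subst cube_avg_lincomb[symmetric]) (simp only: mult.commute)
  also have "\<dots> = (\<Sum>S\<in>Pow I. w S * cube_avg I (\<lambda>x. f x * (of_bool (S \<subseteq> dtree_seen T x d) * monomial S x)))"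
    unfolding f_def by (intro sum.cong refl arg_cong2[where f = "(*)"] cube_avg_dtree_monomial I T) auto
  also have "\<dots> = cube_avg I (\<lambda>x. f x * (\<Sum>S\<in>Pow I. w S * (of_bool (S \<subseteq> dtree_seen T x d) * monomial S x)))"
    by (rule cube_avg_lincomb[symmetric])
  also have "\<dots> = cube_avg I (\<lambda>x. f x * (\<Sum>l\<le>d. level_sum w T d l {} x))"
  proof (rule cube_avg_cong, rule arg_cong2[where f = "(*)"])
    fix x
    have sub: "dtree_seen T x d \<subseteq> I" using dtree_seen_vars[of T x d] T by auto
    have "(\<Sum>S\<in>Pow I. w S * (of_bool (S \<subseteq> dtree_seen T x d) * monomial S x))
        = (\<Sum>S | S \<subseteq> dtree_seen T x d. w S * monomial S x)"
      by (rule sum.mono_neutral_cong_right) (use I sub in auto)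
    also have "\<dots> = (\<Sum>l\<le>d. \<Sum>S | S \<in> {S. S \<subseteq> dtree_seen T x d} \<and> card S = l. w S * monomial S x)"
    proof (rule sum.group[symmetric])
      show "card ` {S. S \<subseteq> dtree_seen T x d} \<subseteq> {..d}"
        by (auto intro!: order_trans[OF card_mono[OF finite_dtree_seen] card_dtree_seen])
    qed auto
    finally show "(\<Sum>S\<in>Pow I. w S * (of_bool (S \<subseteq> dtree_seen T x d) * monomial S x)) = (\<Sum>l\<le>d. level_sum w T d l {} x)"
      unfolding level_sum_def by simp
  qed simp
  also have "\<dots> = cube_avg I f + (\<Sum>l=1..d. cube_avg I (\<lambda>x. f x * level_sum w T d l {} x))"
  proof -
    have "{..d} = insert 0 {1..d}" by auto
    then have "(\<Sum>l\<le>d. level_sum w T d l {} x) = 1 + (\<Sum>l=1..d. level_sum w T d l {} x)" for x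
      by (simp add: level_sum_0 w0)
    then show ?thesis by (simp only: distrib_left cube_avg_add sum_distrib_left cube_avg_sum mult_1_right)
  qed
  finally have "\<bar>cube_avg I (\<lambda>x. (\<Sum>S\<in>Pow I. w S * monomial S x) * f x) - cube_avg I f\<bar>
      \<le> (\<Sum>l=1..d. \<bar>cube_avg I (\<lambda>x. f x * level_sum w T d l {} x)\<bar>)"
    using sum_abs[of "\<lambda>l. cube_avg I (\<lambda>x. f x * level_sum w T d l {} x)" "{1..d}"] by linarith
  also have "\<dots> \<le> (\<Sum>l=1..d. B l * sqrt (((2 * real q - 1) * c * (real d + 1)) ^ l / fact l))"
  proof (rule sum_mono)
    fix l assume l: "l \<in> {1..d}"
    define y where "y = ((2 * real q - 1) * c * (real d + 1)) ^ l / fact l"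
    have y: "y > 0" unfolding y_def using q c by auto
    have "\<bar>cube_avg I (\<lambda>x. f x * level_sum w T d l {} x)\<bar> \<le> cube_avg I (\<lambda>x. \<bar>f x * level_sum w T d l {} x\<bar>)"
      by (rule cube_avg_abs)
    also have "\<dots> \<le> cube_avg I (\<lambda>x. \<bar>level_sum w T d l {} x\<bar>)"
      by (rule cube_avg_mono) (auto simp: abs_mult f_def)
    also have "\<dots> \<le> B l * sqrt y"
    proof (rule field_le_epsilon)
      fix e :: real assume e: "e > 0"
      \<comment> \<open>\<open>B l\<close> may be 0, as it will be for all levels below
        \<open>k\<close>, whereas \<open>level_sum_moment\<close> asks for a positive bound.\<close>
      define B' where "B' = B l + e / sqrt y"
      have B': "B' > 0" unfolding B'_def using B[OF l] e y by (simp add: add_nonneg_pos)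
      have "cube_avg I (\<lambda>x. level_sum w T d l {} x ^ (2 * q)) \<le> (B'\<^sup>2 * ((2 * real q - 1) * c * (real d + 1)) ^ l / fact l) ^ q"
      proof (rule level_sum_moment[OF I T(1) q B' c])
        fix S assume "S \<subseteq> I" "card S = l"
        then have "\<bar>w S\<bar> \<le> B l" using w[of S] l by auto
        also have "\<dots> \<le> B'" unfolding B'_def using e y by simp
        finally show "\<bar>w S\<bar> \<le> B'" .
      qed auto
      then have "cube_avg I (\<lambda>x. \<bar>level_sum w T d l {} x\<bar>) \<le> sqrt (B'\<^sup>2 * y)"
        using B' y by (intro cube_avg_abs_le_of_moment[OF I q]) (simp, simp only: y_def times_divide_eq_right)
      also have "\<dots> = B l * sqrt y + e"
        using B' y by (simp add: real_sqrt_mult B'_def field_simps)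
      finally show "cube_avg I (\<lambda>x. \<bar>level_sum w T d l {} x\<bar>) \<le> B l * sqrt y + e" .
    qed
    finally show "\<bar>cube_avg I (\<lambda>x. f x * level_sum w T d l {} x)\<bar>
        \<le> B l * sqrt (((2 * real q - 1) * c * (real d + 1)) ^ l / fact l)" unfolding y_def .
  qed
  finally show ?thesis unfolding f_def .
qed

section \<open>Gaussian kernels\<close>

text \<open>A trigonometric polynomial makes all Gaussian expectations explicit. A single sine would give
  \<open>(E[y g(y)])\<^sup>2 \<le> 1 / e\<close>, but it must exceed \<open>1 / 2\<close>; the third harmonic flattens the peaks of the
  sine, so that it can be scaled up without leaving \<open>[-1, 1]\<close>.\<close>

definition wave :: "real \<Rightarrow> real" where
  "wave y = 577 / 500 * sin (sqrt (9 / 10) * y) + 193 / 1000 * sin (3 * (sqrt (9 / 10) * y))"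

definition wave_freqs :: "real set" where
  "wave_freqs = {-3, -1, 1, 3}"

text \<open>The Fourier coefficients of \<open>wave\<close> with the common factor \<open>-i\<close>
  split off; on \<open>wave_freqs\<close> what is left is real and odd.\<close>

definition wave_coeff :: "real \<Rightarrow> real" where
  "wave_coeff f = (if f = 1 then 577 / 1000 else if f = -1 then - 577 / 1000
     else if f = 3 then 193 / 2000 else - 193 / 2000)"

lemma finite_wave_freqs [simp]: "finite wave_freqs"
  unfolding wave_freqs_def by simp

lemma sin_triple: "sin (3 * x) = 3 * sin x - 4 * sin x ^ 3" for x :: real
proof -
  have "sin (3 * x) = sin (2 * x + x)" by simp
  also have "\<dots> = 2 * sin x * (cos x)\<^sup>2 + (1 - 2 * (sin x)\<^sup>2) * sin x"
    unfolding sin_add sin_double cos_double_sin by (simp add: power2_eq_square)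
  also have "(cos x)\<^sup>2 = 1 - (sin x)\<^sup>2" by (simp add: cos_squared_eq)
  finally show ?thesis by (simp add: power2_eq_square power3_eq_cube algebra_simps)
qed

lemma abs_wave_le: "\<bar>wave y\<bar> \<le> 1"
proof -
  define s where "s = sin (sqrt (9 / 10) * y)"
  have w: "wave y = 1733 / 1000 * s - 772 / 1000 * s ^ 3"
    unfolding wave_def s_def sin_triple by (simp add: algebra_simps)
  have key: "1733 / 1000 * t - 772 / 1000 * t ^ 3 \<le> 1" if "t \<ge> 0" "t \<le> 1" for t :: real
  proof -
    \<comment> \<open>Close to the maximizer of the cubic, whose maximum is about 0.9994. As
      \<open>(t - a)^2 (t + 2 a) = t^3 - 3 a^2 t + 2 a^3\<close>, the cubic lies below a nearly
      constant linear function that stays under 1.\<close>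
    define a :: real where "a = 173 / 200"
    have "0 \<le> (t - a)\<^sup>2 * (t + 2 * a)"
      using that by (simp add: a_def)
    also have "\<dots> = t ^ 3 - 3 * a\<^sup>2 * t + 2 * a ^ 3"
      by (simp add: power2_eq_square power3_eq_cube algebra_simps)
    finally have "0 \<le> t ^ 3 - 3 * a\<^sup>2 * t + 2 * a ^ 3" .
    moreover have "a\<^sup>2 = 29929 / 40000" "a ^ 3 = 5177717 / 8000000"
      by (simp_all add: a_def power2_eq_square power3_eq_cube)
    ultimately have "0 \<le> t ^ 3 - 89787 / 40000 * t + 5177717 / 4000000" by simp
    then show ?thesis using that by linarith
  qed
  have low: "0 \<le> 1733 / 1000 * t - 772 / 1000 * t ^ 3" if "t \<ge> 0" "t \<le> 1" for t :: real
  proof -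
    have "t ^ 3 \<le> t ^ 1" using that by (intro power_decreasing) auto
    then show ?thesis using that by simp
  qed
  have s1: "\<bar>s\<bar> \<le> 1" unfolding s_def by simp
  show ?thesis
  proof (cases "s \<ge> 0")
    case True
    then show ?thesis unfolding w using key[of s] low[of s] s1 by simp
  next
    case False
    then show ?thesis unfolding w using key[of "- s"] low[of "- s"] s1 by simp
  qed
qed

lemma wave_measurable [measurable]: "wave \<in> borel_measurable borel"
  unfolding wave_def by measurable

lemma wave_expand:
  "complex_of_real (wave y) =
     (\<Sum>f\<in>wave_freqs. (- \<i> * complex_of_real (wave_coeff f)) * iexp (f * (sqrt (9 / 10) * y)))"
proof -
  define x where "x = sqrt (9 / 10) * y"
  have e: "iexp t = Complex (cos t) (sin t)" for t
    by (metis cis.code cis_conv_exp)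
  have "complex_of_real (577 / 500 * sin x + 193 / 1000 * sin (3 * x)) =
      (\<Sum>f\<in>wave_freqs. (- \<i> * complex_of_real (wave_coeff f)) * iexp (f * x))"
    unfolding wave_freqs_def wave_coeff_def e by (simp add: complex_eq_iff)
  then show ?thesis unfolding wave_def x_def .
qed

section \<open>Gaussian expectations of products of waves\<close>

definition gauss_space :: "nat \<Rightarrow> (nat \<Rightarrow> real) measure" where
  "gauss_space n = (\<Pi>\<^sub>M v\<in>{..<n}. std_normal_distribution)"

lemma prob_space_std_normal: "prob_space std_normal_distribution"
  using real_dist_normal_dist unfolding real_distribution_def by blast

lemma prob_space_gauss_space: "prob_space (gauss_space n)"
  unfolding gauss_space_def by (intro prob_space_PiM prob_space_std_normal)

lemma measurable_gauss_component:
  assumes "v < n"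
  shows "(\<lambda>z. z v) \<in> borel_measurable (gauss_space n)"
proof -
  have "(\<lambda>z. z v) \<in> measurable (gauss_space n) std_normal_distribution"
    unfolding gauss_space_def by (rule measurable_component_singleton) (use assms in simp)
  then show ?thesis by simp
qed

lemma gauss_space_char:
  "(CLINT z|gauss_space n. iexp (\<Sum>v<n. \<xi> v * z v)) = complex_of_real (exp (- (\<Sum>v<n. (\<xi> v)\<^sup>2) / 2))"
proof -
  interpret product_prob_space "\<lambda>_. std_normal_distribution" "{..<n}"
    by (rule product_prob_spaceI) (rule prob_space_std_normal)
  have "(CLINT z|gauss_space n. iexp (\<Sum>v<n. \<xi> v * z v)) = (CLINT z|gauss_space n. (\<Prod>v<n. iexp (\<xi> v * z v)))"
    by (simp add: exp_sum sum_distrib_left)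
  also have "\<dots> = (\<Prod>v<n. CLINT y|std_normal_distribution. iexp (\<xi> v * y))"
    unfolding gauss_space_def
  proof (rule product_integral_prod)
    show "integrable std_normal_distribution (\<lambda>y. iexp (\<xi> v * y))" for v
    proof (rule finite_measure.integrable_const_bound[where B = 1])
      show "finite_measure std_normal_distribution"
        by (rule prob_space.finite_measure[OF prob_space_std_normal])
      show "(\<lambda>y. iexp (\<xi> v * y)) \<in> borel_measurable std_normal_distribution" by measurable
    qed simp
  qed simp
  also have "\<dots> = (\<Prod>v<n. complex_of_real (exp (- ((\<xi> v)\<^sup>2) / 2)))"
    using char_std_normal_distribution unfolding char_def fun_eq_iff by simp
  also have "\<dots> = complex_of_real (\<Prod>v<n. exp (- ((\<xi> v)\<^sup>2) / 2))"
    by simp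
  also have "(\<Prod>v<n. exp (- ((\<xi> v)\<^sup>2) / 2)) = exp (\<Sum>v<n. - ((\<xi> v)\<^sup>2) / 2)"
    by (rule exp_sum[symmetric]) simp
  also have "(\<Sum>v<n. - ((\<xi> v)\<^sup>2) / 2) = - (\<Sum>v<n. (\<xi> v)\<^sup>2) / 2"
    by (simp add: sum_divide_distrib sum_negf)
  finally show ?thesis .
qed

text \<open>The share of one hidden vector \<open>z\<close> in a Fourier coefficient:
  \<open>z\<close> acts on the set \<open>S\<close> in the block before it and, through the
  transpose of \<open>U\<close>, on the set \<open>T\<close> in the block after it.\<close>

definition gauss_kernel :: "nat \<Rightarrow> (nat \<Rightarrow> nat \<Rightarrow> real) \<Rightarrow> nat set \<Rightarrow> nat set \<Rightarrow> real" where
  "gauss_kernel n U S T =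
     (LINT z|gauss_space n. (\<Prod>i\<in>S. wave (z i)) * (\<Prod>j\<in>T. wave (\<Sum>v<n. U v j * z v)))"

definition orthonormal_columns :: "nat \<Rightarrow> (nat \<Rightarrow> nat \<Rightarrow> real) \<Rightarrow> bool" where
  "orthonormal_columns n U \<longleftrightarrow>
     (\<forall>i<n. \<forall>j<n. (\<Sum>v<n. U v i * U v j) = (if i = j then 1 else 0))"

text \<open>The exponential is the characteristic function of a standard Gaussian at
  \<open>sqrt (9 / 10) * f\<close>.\<close>

definition damped_coeff :: "real \<Rightarrow> real" where
  "damped_coeff f = wave_coeff f * exp (- 9 / 20 * f\<^sup>2)"

text \<open>The mixed terms are all that remains of \<open>U\<close>, and they become the exponents
  in the kernel. For empty \<open>S\<close> the identity says that \<open>U\<close> preserves norms,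
  and it is used again in that role later.\<close>

lemma sum_combination_square:
  assumes U: "orthonormal_columns n U" and S: "S \<subseteq> {..<n}" and T: "T \<subseteq> {..<n}"
  shows "(\<Sum>v<n. ((if v \<in> S then f v else 0) + (\<Sum>j\<in>T. h j * U v j))\<^sup>2)
       = (\<Sum>i\<in>S. (f i)\<^sup>2) + (\<Sum>j\<in>T. (h j)\<^sup>2) + 2 * (\<Sum>i\<in>S. \<Sum>j\<in>T. f i * U i j * h j)"
proof -
  have fin: "finite S" "finite T" using S T finite_subset by auto
  have "(\<Sum>v<n. (\<Sum>j\<in>T. h j * U v j)\<^sup>2) = (\<Sum>v<n. \<Sum>j\<in>T. \<Sum>l\<in>T. h j * h l * (U v j * U v l))"
    by (simp add: power2_eq_square sum_product mult_ac)
  also have "\<dots> = (\<Sum>j\<in>T. \<Sum>v<n. \<Sum>l\<in>T. h j * h l * (U v j * U v l))"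
    by (rule sum.swap)
  also have "\<dots> = (\<Sum>j\<in>T. \<Sum>l\<in>T. h j * h l * (\<Sum>v<n. U v j * U v l))"
    unfolding sum_distrib_left by (intro sum.cong refl sum.swap)
  also have "\<dots> = (\<Sum>j\<in>T. \<Sum>l\<in>T. h j * h l * (if j = l then 1 else 0))"
  proof (intro sum.cong refl)
    fix j l assume "j \<in> T" "l \<in> T"
    then have "j < n" "l < n" using T by auto
    then have "(\<Sum>v<n. U v j * U v l) = (if j = l then 1 else 0)"
      using U unfolding orthonormal_columns_def by blast
    then show "h j * h l * (\<Sum>v<n. U v j * U v l) = h j * h l * (if j = l then 1 else 0)"
      by (simp only:)
  qed
  also have "\<dots> = (\<Sum>j\<in>T. (h j)\<^sup>2)"
    using fin by (simp add: power2_eq_square if_distrib[of "(*) _"] cong: if_cong)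
  finally have 1: "(\<Sum>v<n. (\<Sum>j\<in>T. h j * U v j)\<^sup>2) = (\<Sum>j\<in>T. (h j)\<^sup>2)" .
  have 2: "(\<Sum>v<n. (if v \<in> S then f v else 0)\<^sup>2) = (\<Sum>i\<in>S. (f i)\<^sup>2)"
    by (rule sum.mono_neutral_cong_right) (use S in auto)
  have "(\<Sum>v<n. 2 * (if v \<in> S then f v else 0) * (\<Sum>j\<in>T. h j * U v j))
      = (\<Sum>i\<in>S. 2 * f i * (\<Sum>j\<in>T. h j * U i j))"
    by (rule sum.mono_neutral_cong_right) (use S in auto)
  also have "\<dots> = 2 * (\<Sum>i\<in>S. \<Sum>j\<in>T. f i * U i j * h j)"
    by (simp add: sum_distrib_left mult_ac)
  finally have 3: "(\<Sum>v<n. 2 * (if v \<in> S then f v else 0) * (\<Sum>j\<in>T. h j * U v j))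
      = 2 * (\<Sum>i\<in>S. \<Sum>j\<in>T. f i * U i j * h j)" .
  show ?thesis unfolding power2_sum sum.distrib 1 2 3 by simp
qed

text \<open>Expanding the waves into characters turns the Gaussian integral into values of the
  characteristic function, and orthonormality evaluates the norms of the frequencies.\<close>

lemma gauss_kernel_expand:
  assumes U: "orthonormal_columns n U" and S: "S \<subseteq> {..<n}" and T: "T \<subseteq> {..<n}"
  shows "complex_of_real (gauss_kernel n U S T) = (- \<i>) ^ (card S + card T) * complex_of_real
    (\<Sum>f\<in>S \<rightarrow>\<^sub>E wave_freqs. \<Sum>h\<in>T \<rightarrow>\<^sub>E wave_freqs.
       (\<Prod>i\<in>S. damped_coeff (f i)) * (\<Prod>j\<in>T. damped_coeff (h j))
         * exp (- 9 / 10 * (\<Sum>i\<in>S. \<Sum>j\<in>T. f i * U i j * h j)))"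
proof -
  have fin: "finite S" "finite T" using S T finite_subset by auto
  define L where "L = sqrt (9 / 10 :: real)"
  have L2: "L\<^sup>2 = 9 / 10" unfolding L_def by simp
  interpret prob_space "gauss_space n" by (rule prob_space_gauss_space)
  \<comment> \<open>The frequency vector, in the variable \<open>z\<close>, of the product of all
    chosen characters.\<close>
  define \<xi> where "\<xi> f h v = L * ((if v \<in> S then f v else 0) + (\<Sum>j\<in>T. h j * U v j))" for f h v
  have expand: "(\<Prod>i\<in>R. complex_of_real (wave (y i))) =
      (\<Sum>f\<in>R \<rightarrow>\<^sub>E wave_freqs. (- \<i>) ^ card R * complex_of_real (\<Prod>i\<in>R. wave_coeff (f i)) * iexp (L * (\<Sum>i\<in>R. f i * y i)))"
    if "finite R" for R :: "nat set" and y
  proof -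
    have "(\<Prod>i\<in>R. complex_of_real (wave (y i))) =
      (\<Prod>i\<in>R. \<Sum>f\<in>wave_freqs. (- \<i> * complex_of_real (wave_coeff f)) * iexp (f * (L * y i)))"
      unfolding wave_expand L_def ..
    also have "\<dots> = (\<Sum>f\<in>R \<rightarrow>\<^sub>E wave_freqs. \<Prod>i\<in>R. (- \<i> * complex_of_real (wave_coeff (f i))) * iexp (f i * (L * y i)))"
      by (rule prod_sum_PiE) (use that in auto)
    also have "\<dots> = (\<Sum>f\<in>R \<rightarrow>\<^sub>E wave_freqs. (- \<i>) ^ card R * complex_of_real (\<Prod>i\<in>R. wave_coeff (f i)) * iexp (L * (\<Sum>i\<in>R. f i * y i)))"
    proof (rule sum.cong[OF refl])
      fix f
      have "(\<Prod>i\<in>R. iexp (f i * (L * y i))) = iexp (L * (\<Sum>i\<in>R. f i * y i))"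
        using that by (simp add: exp_sum[symmetric] sum_distrib_left mult_ac)
      then show "(\<Prod>i\<in>R. (- \<i> * complex_of_real (wave_coeff (f i))) * iexp (f i * (L * y i))) =
        (- \<i>) ^ card R * complex_of_real (\<Prod>i\<in>R. wave_coeff (f i)) * iexp (L * (\<Sum>i\<in>R. f i * y i))"
        by (simp only: prod.distrib prod_constant of_real_prod)
    qed
    finally show ?thesis .
  qed
  define c where "c f h = (- \<i>) ^ (card S + card T) * complex_of_real ((\<Prod>i\<in>S. wave_coeff (f i)) * (\<Prod>j\<in>T. wave_coeff (h j)))" for f h
  have integrand: "complex_of_real ((\<Prod>i\<in>S. wave (z i)) * (\<Prod>j\<in>T. wave (\<Sum>v<n. U v j * z v)))
      = (\<Sum>f\<in>S \<rightarrow>\<^sub>E wave_freqs. \<Sum>h\<in>T \<rightarrow>\<^sub>E wave_freqs. c f h * iexp (\<Sum>v<n. \<xi> f h v * z v))" for z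
  proof -
    have "(\<Sum>v<n. \<xi> f h v * z v) = L * (\<Sum>i\<in>S. f i * z i) + L * (\<Sum>j\<in>T. h j * (\<Sum>v<n. U v j * z v))" for f h
    proof -
      have "(\<Sum>v<n. (if v \<in> S then f v else 0) * z v) = (\<Sum>i\<in>S. f i * z i)"
        by (rule sum.mono_neutral_cong_right) (use S in auto)
      moreover have "(\<Sum>v<n. (\<Sum>j\<in>T. h j * U v j) * z v) = (\<Sum>j\<in>T. h j * (\<Sum>v<n. U v j * z v))"
        unfolding sum_distrib_right sum_distrib_left by (subst sum.swap) (simp add: mult_ac)
      ultimately show ?thesis
        unfolding \<xi>_def by (simp add: distrib_left distrib_right sum.distrib sum_distrib_left[symmetric] mult.assoc)
    qed
    then have "iexp (\<Sum>v<n. \<xi> f h v * z v) = iexp (L * (\<Sum>i\<in>S. f i * z i)) * iexp (L * (\<Sum>j\<in>T. h j * (\<Sum>v<n. U v j * z v)))" for f h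
      by (simp add: exp_add[symmetric] distrib_left)
    then show ?thesis
      unfolding of_real_mult of_real_prod expand[OF fin(1)] expand[OF fin(2)] sum_product
      by (intro sum.cong refl) (simp add: c_def power_add mult_ac)
  qed
  have meas: "(\<lambda>z. \<Sum>v<n. \<xi> v * z v) \<in> borel_measurable (gauss_space n)" for \<xi>
    by (intro borel_measurable_sum borel_measurable_times borel_measurable_const measurable_gauss_component) simp
  have int: "integrable (gauss_space n) (\<lambda>z. a * iexp (\<Sum>v<n. \<xi> v * z v))" for a \<xi>
  proof (rule integrable_mult_right, rule integrable_const_bound[where B = 1])
    note meas[measurable]
    show "(\<lambda>z. iexp (\<Sum>v<n. \<xi> v * z v)) \<in> borel_measurable (gauss_space n)" by measurable
  qed simp
  have "complex_of_real (gauss_kernel n U S T) =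
      (CLINT z|gauss_space n. complex_of_real ((\<Prod>i\<in>S. wave (z i)) * (\<Prod>j\<in>T. wave (\<Sum>v<n. U v j * z v))))"
    unfolding gauss_kernel_def by (rule integral_complex_of_real[symmetric])
  also have "\<dots> = (\<Sum>f\<in>S \<rightarrow>\<^sub>E wave_freqs. \<Sum>h\<in>T \<rightarrow>\<^sub>E wave_freqs. CLINT z|gauss_space n. c f h * iexp (\<Sum>v<n. \<xi> f h v * z v))"
    unfolding integrand
    by (subst Bochner_Integration.integral_sum, intro Bochner_Integration.integrable_sum int,
        intro sum.cong refl, rule Bochner_Integration.integral_sum, rule int)
  also have "\<dots> = (\<Sum>f\<in>S \<rightarrow>\<^sub>E wave_freqs. \<Sum>h\<in>T \<rightarrow>\<^sub>E wave_freqs. c f h * complex_of_real (exp (- (\<Sum>v<n. (\<xi> f h v)\<^sup>2) / 2)))"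
    by (simp only: integral_mult_right_zero gauss_space_char)
  also have "\<dots> = (\<Sum>f\<in>S \<rightarrow>\<^sub>E wave_freqs. \<Sum>h\<in>T \<rightarrow>\<^sub>E wave_freqs. (- \<i>) ^ (card S + card T) * complex_of_real
       ((\<Prod>i\<in>S. damped_coeff (f i)) * (\<Prod>j\<in>T. damped_coeff (h j))
         * exp (- 9 / 10 * (\<Sum>i\<in>S. \<Sum>j\<in>T. f i * U i j * h j))))"
  proof (intro sum.cong refl)
    fix f h
    have "(\<Sum>v<n. (\<xi> f h v)\<^sup>2) = 9 / 10 * ((\<Sum>i\<in>S. (f i)\<^sup>2) + (\<Sum>j\<in>T. (h j)\<^sup>2) + 2 * (\<Sum>i\<in>S. \<Sum>j\<in>T. f i * U i j * h j))"
      unfolding \<xi>_def power_mult_distrib L2 sum_distrib_left[symmetric] sum_combination_square[OF U S T] ..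
    then have "- (\<Sum>v<n. (\<xi> f h v)\<^sup>2) / 2 = (\<Sum>i\<in>S. - 9 / 20 * (f i)\<^sup>2) + (\<Sum>j\<in>T. - 9 / 20 * (h j)\<^sup>2)
        + (- 9 / 10 * (\<Sum>i\<in>S. \<Sum>j\<in>T. f i * U i j * h j))"
      unfolding sum_distrib_left[symmetric] by simp
    then have "exp (- (\<Sum>v<n. (\<xi> f h v)\<^sup>2) / 2) = (\<Prod>i\<in>S. exp (- 9 / 20 * (f i)\<^sup>2)) * (\<Prod>j\<in>T. exp (- 9 / 20 * (h j)\<^sup>2))
        * exp (- 9 / 10 * (\<Sum>i\<in>S. \<Sum>j\<in>T. f i * U i j * h j))"
      by (simp only: exp_add exp_sum[OF fin(1)] exp_sum[OF fin(2)])
    then show "c f h * complex_of_real (exp (- (\<Sum>v<n. (\<xi> f h v)\<^sup>2) / 2)) =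
      (- \<i>) ^ (card S + card T) * complex_of_real ((\<Prod>i\<in>S. damped_coeff (f i)) * (\<Prod>j\<in>T. damped_coeff (h j))
         * exp (- 9 / 10 * (\<Sum>i\<in>S. \<Sum>j\<in>T. f i * U i j * h j)))"
      unfolding c_def damped_coeff_def prod.distrib by (simp only: of_real_mult mult_ac)
  qed
  finally show ?thesis by (simp only: sum_distrib_left[symmetric] of_real_sum[symmetric])
qed

text \<open>What remains of the factor for one \<open>i\<close> in \<open>S\<close> when the
  frequencies on the side of \<open>T\<close> are fixed: they enter only through \<open>c\<close>.
  Odd coefficients make it a combination of sinh, hence small for small \<open>c\<close>.\<close>

definition wave_response :: "real \<Rightarrow> real" where
  "wave_response c = (\<Sum>f\<in>wave_freqs. damped_coeff f * exp (- 9 / 10 * (f * c)))"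

lemma wave_response_eq:
  "wave_response c = - (577 / 500 * exp (- 9 / 20) * sinh (9 / 10 * c) + 193 / 1000 * exp (- 81 / 20) * sinh (27 / 10 * c))"
  unfolding wave_response_def wave_freqs_def damped_coeff_def wave_coeff_def sinh_field_def
  by (simp add: field_simps)

lemma wave_response_0 [simp]: "wave_response 0 = 0"
  unfolding wave_response_eq by simp

lemma abs_wave_response_le: "\<bar>wave_response c\<bar> \<le> 2 * sinh (3 * \<bar>c\<bar>)"
proof -
  have "\<bar>wave_response c\<bar> \<le> 577 / 500 * exp (- 9 / 20) * \<bar>sinh (9 / 10 * c)\<bar> + 193 / 1000 * exp (- 81 / 20) * \<bar>sinh (27 / 10 * c)\<bar>"
    unfolding wave_response_eq abs_minus_cancel by (rule order_trans[OF abs_triangle_ineq]) (simp add: abs_mult)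
  also have "\<dots> \<le> 577 / 500 * 1 * sinh (3 * \<bar>c\<bar>) + 193 / 1000 * 1 * sinh (3 * \<bar>c\<bar>)"
    unfolding sinh_real_abs[symmetric]
    by (intro add_mono mult_mono) (auto simp: abs_mult)
  also have "\<dots> \<le> 2 * sinh (3 * \<bar>c\<bar>)"
    by simp
  finally show ?thesis .
qed

lemma sum_abs_damped_coeff: "(\<Sum>f\<in>wave_freqs. \<bar>damped_coeff f\<bar>) \<le> 2"
proof -
  have "\<bar>damped_coeff f\<bar> \<le> 577 / 1000 * of_bool (f = 1 \<or> f = -1) + 193 / 2000 * of_bool (f = 3 \<or> f = -3)"
    if "f \<in> wave_freqs" for f
    using that unfolding damped_coeff_def wave_freqs_def wave_coeff_def abs_mult by auto
  then have "(\<Sum>f\<in>wave_freqs. \<bar>damped_coeff f\<bar>) \<le> (\<Sum>f\<in>wave_freqs. 577 / 1000 * of_bool (f = 1 \<or> f = -1) + 193 / 2000 * of_bool (f = 3 \<or> f = -3))"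
    by (rule sum_mono)
  also have "\<dots> \<le> 2" unfolding wave_freqs_def by simp
  finally show ?thesis .
qed

text \<open>For fixed \<open>h\<close> the exponent is linear in \<open>f\<close>, so the sum over
  \<open>f\<close> factors over \<open>S\<close>.\<close>

lemma damped_sum_eq_response:
  assumes fin: "finite S" "finite T"
  shows "(\<Sum>f\<in>S \<rightarrow>\<^sub>E wave_freqs. \<Sum>h\<in>T \<rightarrow>\<^sub>E wave_freqs.
       (\<Prod>i\<in>S. damped_coeff (f i)) * (\<Prod>j\<in>T. damped_coeff (h j))
         * exp (- 9 / 10 * (\<Sum>i\<in>S. \<Sum>j\<in>T. f i * U i j * h j)))
     = (\<Sum>h\<in>T \<rightarrow>\<^sub>E wave_freqs. (\<Prod>j\<in>T. damped_coeff (h j)) * (\<Prod>i\<in>S. wave_response (\<Sum>j\<in>T. U i j * h j)))"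
proof (subst sum.swap, rule sum.cong[OF refl])
  fix h
  have "(\<Prod>i\<in>S. wave_response (\<Sum>j\<in>T. U i j * h j))
      = (\<Sum>f\<in>S \<rightarrow>\<^sub>E wave_freqs. \<Prod>i\<in>S. damped_coeff (f i) * exp (- 9 / 10 * (f i * (\<Sum>j\<in>T. U i j * h j))))"
    unfolding wave_response_def by (rule prod_sum_PiE) (use fin in auto)
  also have "\<dots> = (\<Sum>f\<in>S \<rightarrow>\<^sub>E wave_freqs. (\<Prod>i\<in>S. damped_coeff (f i)) * exp (- 9 / 10 * (\<Sum>i\<in>S. \<Sum>j\<in>T. f i * U i j * h j)))"
    unfolding prod.distrib exp_sum[OF fin(1), symmetric] sum_distrib_left
    by (simp add: mult_ac)
  finally show "(\<Sum>f\<in>S \<rightarrow>\<^sub>E wave_freqs. (\<Prod>i\<in>S. damped_coeff (f i)) * (\<Prod>j\<in>T. damped_coeff (h j))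
         * exp (- 9 / 10 * (\<Sum>i\<in>S. \<Sum>j\<in>T. f i * U i j * h j)))
     = (\<Prod>j\<in>T. damped_coeff (h j)) * (\<Prod>i\<in>S. wave_response (\<Sum>j\<in>T. U i j * h j))"
    by (simp add: sum_distrib_left mult_ac)
qed

text \<open>Each element of \<open>S\<close> costs a factor 2 from
  \<open>abs_wave_response_le\<close>, each element of \<open>T\<close> a factor 2 from
  \<open>sum_abs_damped_coeff\<close>.\<close>

lemma abs_response_sum_le:
  assumes fin: "finite S" "finite T"
    and X: "\<And>h. h \<in> T \<rightarrow>\<^sub>E wave_freqs \<Longrightarrow> (\<Prod>i\<in>S. sinh (3 * \<bar>\<Sum>j\<in>T. U i j * h j\<bar>)) \<le> X"
  shows "\<bar>\<Sum>h\<in>T \<rightarrow>\<^sub>E wave_freqs. (\<Prod>j\<in>T. damped_coeff (h j)) * (\<Prod>i\<in>S. wave_response (\<Sum>j\<in>T. U i j * h j))\<bar>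
     \<le> 2 ^ (card S + card T) * X"
proof -
  have ne: "T \<rightarrow>\<^sub>E wave_freqs \<noteq> {}" by (simp add: PiE_eq_empty_iff wave_freqs_def)
  then obtain h0 where h0: "h0 \<in> T \<rightarrow>\<^sub>E wave_freqs" by auto
  have X0: "X \<ge> 0" by (rule order_trans[OF _ X[OF h0]]) (auto intro!: prod_nonneg)
  have "\<bar>\<Sum>h\<in>T \<rightarrow>\<^sub>E wave_freqs. (\<Prod>j\<in>T. damped_coeff (h j)) * (\<Prod>i\<in>S. wave_response (\<Sum>j\<in>T. U i j * h j))\<bar>
      \<le> (\<Sum>h\<in>T \<rightarrow>\<^sub>E wave_freqs. (\<Prod>j\<in>T. \<bar>damped_coeff (h j)\<bar>) * (2 ^ card S * X))"
  proof (rule order_trans[OF sum_abs], rule sum_mono)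
    fix h assume h: "h \<in> T \<rightarrow>\<^sub>E wave_freqs"
    have "(\<Prod>i\<in>S. \<bar>wave_response (\<Sum>j\<in>T. U i j * h j)\<bar>) \<le> (\<Prod>i\<in>S. 2 * sinh (3 * \<bar>\<Sum>j\<in>T. U i j * h j\<bar>))"
      by (intro prod_mono conjI abs_wave_response_le) auto
    also have "\<dots> = 2 ^ card S * (\<Prod>i\<in>S. sinh (3 * \<bar>\<Sum>j\<in>T. U i j * h j\<bar>))"
      by (simp add: prod.distrib)
    also have "\<dots> \<le> 2 ^ card S * X" by (intro mult_left_mono X h) auto
    finally show "\<bar>(\<Prod>j\<in>T. damped_coeff (h j)) * (\<Prod>i\<in>S. wave_response (\<Sum>j\<in>T. U i j * h j))\<bar>
      \<le> (\<Prod>j\<in>T. \<bar>damped_coeff (h j)\<bar>) * (2 ^ card S * X)"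
      unfolding abs_mult abs_prod by (intro mult_left_mono prod_nonneg) auto
  qed
  also have "\<dots> = (\<Prod>j\<in>T. \<Sum>f\<in>wave_freqs. \<bar>damped_coeff f\<bar>) * (2 ^ card S * X)"
    unfolding sum_distrib_right[symmetric] by (subst prod_sum_PiE) (use fin in auto)
  also have "\<dots> \<le> 2 ^ card T * (2 ^ card S * X)"
    using X0 sum_abs_damped_coeff by (intro mult_right_mono) (auto intro!: power_mono sum_nonneg)
  finally show ?thesis by (simp add: power_add mult_ac)
qed

lemma gauss_kernel_complex_norm:
  assumes "complex_of_real r = (- \<i>) ^ m * complex_of_real y"
  shows "\<bar>r\<bar> = \<bar>y\<bar>"
proof -
  have "\<bar>r\<bar> = cmod (complex_of_real r)" by simp
  also have "\<dots> = cmod ((- \<i>) ^ m * complex_of_real y)" unfolding assms ..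
  also have "\<dots> = \<bar>y\<bar>" by (simp add: norm_mult norm_power)
  finally show ?thesis .
qed

text \<open>The exponent is bilinear, so either side can be summed out. Having both forms lets the
  larger set supply the small factors.\<close>

lemma abs_gauss_kernel_eq:
  assumes U: "orthonormal_columns n U" and S: "S \<subseteq> {..<n}" and T: "T \<subseteq> {..<n}"
  shows "\<bar>gauss_kernel n U S T\<bar> = \<bar>\<Sum>h\<in>T \<rightarrow>\<^sub>E wave_freqs.
      (\<Prod>j\<in>T. damped_coeff (h j)) * (\<Prod>i\<in>S. wave_response (\<Sum>j\<in>T. U i j * h j))\<bar>"
    and "\<bar>gauss_kernel n U S T\<bar> = \<bar>\<Sum>f\<in>S \<rightarrow>\<^sub>E wave_freqs.
      (\<Prod>i\<in>S. damped_coeff (f i)) * (\<Prod>j\<in>T. wave_response (\<Sum>i\<in>S. U i j * f i))\<bar>"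
proof -
  have fin: "finite S" "finite T" using S T finite_subset by auto
  note e = gauss_kernel_complex_norm[OF gauss_kernel_expand[OF U S T]]
  show "\<bar>gauss_kernel n U S T\<bar> = \<bar>\<Sum>h\<in>T \<rightarrow>\<^sub>E wave_freqs.
      (\<Prod>j\<in>T. damped_coeff (h j)) * (\<Prod>i\<in>S. wave_response (\<Sum>j\<in>T. U i j * h j))\<bar>"
    unfolding e damped_sum_eq_response[OF fin] ..
  have sw: "(\<Sum>f\<in>S \<rightarrow>\<^sub>E wave_freqs. \<Sum>h\<in>T \<rightarrow>\<^sub>E wave_freqs.
       (\<Prod>i\<in>S. damped_coeff (f i)) * (\<Prod>j\<in>T. damped_coeff (h j))
         * exp (- 9 / 10 * (\<Sum>i\<in>S. \<Sum>j\<in>T. f i * U i j * h j)))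
     = (\<Sum>h\<in>T \<rightarrow>\<^sub>E wave_freqs. \<Sum>f\<in>S \<rightarrow>\<^sub>E wave_freqs.
       (\<Prod>j\<in>T. damped_coeff (h j)) * (\<Prod>i\<in>S. damped_coeff (f i))
         * exp (- 9 / 10 * (\<Sum>j\<in>T. \<Sum>i\<in>S. h j * U i j * f i)))"
  proof (rule trans[OF sum.swap], rule sum.cong[OF refl], rule sum.cong[OF refl])
    fix h f
    have "(\<Sum>i\<in>S. \<Sum>j\<in>T. f i * U i j * h j) = (\<Sum>j\<in>T. \<Sum>i\<in>S. h j * U i j * f i)"
      by (subst sum.swap) (simp add: mult_ac)
    then show "(\<Prod>i\<in>S. damped_coeff (f i)) * (\<Prod>j\<in>T. damped_coeff (h j))
         * exp (- 9 / 10 * (\<Sum>i\<in>S. \<Sum>j\<in>T. f i * U i j * h j))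
      = (\<Prod>j\<in>T. damped_coeff (h j)) * (\<Prod>i\<in>S. damped_coeff (f i))
         * exp (- 9 / 10 * (\<Sum>j\<in>T. \<Sum>i\<in>S. h j * U i j * f i))"
      by (simp only: mult.commute)
  qed
  show "\<bar>gauss_kernel n U S T\<bar> = \<bar>\<Sum>f\<in>S \<rightarrow>\<^sub>E wave_freqs.
      (\<Prod>i\<in>S. damped_coeff (f i)) * (\<Prod>j\<in>T. wave_response (\<Sum>i\<in>S. U i j * f i))\<bar>"
    unfolding e sw damped_sum_eq_response[OF fin(2,1), of "\<lambda>j i. U i j"] ..
qed

text \<open>Against an empty set every response is \<open>wave_response 0\<close>.\<close>

lemma gauss_kernel_empty:
  assumes U: "orthonormal_columns n U" and S: "S \<subseteq> {..<n}" and T: "T \<subseteq> {..<n}"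
    and "S = {} \<or> T = {}" "S \<noteq> {} \<or> T \<noteq> {}"
  shows "gauss_kernel n U S T = 0"
proof -
  have fin: "finite S" "finite T" using S T finite_subset by auto
  show ?thesis
  proof (cases "S = {}")
    case True
    then have "(\<Prod>j\<in>T. wave_response (\<Sum>i\<in>S. U i j * f i)) = 0" for f
      using assms(5) fin by (intro prod_zero) auto
    then show ?thesis using abs_gauss_kernel_eq(2)[OF U S T] by (simp only: mult_zero_right sum.neutral_const abs_zero abs_eq_0)
  next
    case False
    then have "(\<Prod>i\<in>S. wave_response (\<Sum>j\<in>T. U i j * h j)) = 0" for h
      using assms(4) fin by (intro prod_zero) auto
    then show ?thesis using abs_gauss_kernel_eq(1)[OF U S T] by (simp only: mult_zero_right sum.neutral_const abs_zero abs_eq_0)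
  qed
qed

text \<open>The Taylor remainder of even order is nonnegative; the second bound is the ninth power
  of the first.\<close>

lemma exp_lower_bounds: "exp (- 9 / 20 :: real) \<ge> 797 / 1250" "exp (- 81 / 20 :: real) \<ge> 87 / 5000"
proof -
  obtain t where t: "exp (- 9 / 20 :: real) = (\<Sum>m<6. ((- 9 / 20) ^ m) / fact m) + (exp t / fact 6) * (- 9 / 20) ^ 6"
    using Maclaurin_exp_le[of "- 9 / 20" 6] by blast
  have "(\<Sum>m<6. ((- 9 / 20 :: real) ^ m) / fact m) \<ge> 797 / 1250"
    by (simp add: eval_nat_numeral fact_numeral)
  moreover have "(exp t / fact 6) * (- 9 / 20) ^ 6 \<ge> 0" by (intro mult_nonneg_nonneg) auto
  ultimately show 1: "exp (- 9 / 20 :: real) \<ge> 797 / 1250" unfolding t by linarith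
  have "exp (- 81 / 20 :: real) = exp (- 9 / 20) ^ 9" by (simp add: exp_of_nat_mult[symmetric])
  also have "\<dots> \<ge> (797 / 1250) ^ 9" by (intro power_mono 1) auto
  also have "(797 / 1250 :: real) ^ 9 \<ge> 87 / 5000" by (simp add: eval_nat_numeral)
  ultimately show "exp (- 81 / 20 :: real) \<ge> 87 / 5000" by linarith
qed

lemma mult_sinh_ge: "x * sinh (a * x) \<ge> a * x\<^sup>2" if "a \<ge> 0" for a x :: real
proof -
  have "\<bar>a * x\<bar> \<le> \<bar>sinh (a * x)\<bar>" using real_le_abs_sinh[of "a * x"] by (simp add: sinh_field_def exp_minus)
  then have "\<bar>x\<bar> * \<bar>a * x\<bar> \<le> \<bar>x\<bar> * \<bar>sinh (a * x)\<bar>" by (intro mult_left_mono) auto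
  moreover have "\<bar>x\<bar> * \<bar>a * x\<bar> = a * x\<^sup>2" using that by (simp add: abs_mult power2_eq_square)
  moreover have "\<bar>x\<bar> * \<bar>sinh (a * x)\<bar> = x * sinh (a * x)"
  proof (cases "x \<ge> 0")
    case False
    then have "a * x \<le> 0" using that by (simp add: mult_nonneg_nonpos)
    then show ?thesis using False by simp
  qed (use that in simp)
  ultimately show ?thesis by simp
qed

text \<open>The kernel is a positive combination of sinh at the rates \<open>9/10\<close>,
  \<open>27/10\<close> and \<open>81/10\<close>. Replacing sinh by its argument leaves exactly
  \<open>(E[y g(y)])^2\<close> as coefficient. Its small margin over 1/2 compounds along the chain
  and is used in \<open>success_gap\<close>.\<close>

lemma gauss_kernel_singleton:
  assumes U: "orthonormal_columns n U" and ij: "i < n" "j < n"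
  shows "U i j * gauss_kernel n U {i} {j} \<ge> 1001 / 2000 * (U i j)\<^sup>2"
proof -
  define u where "u = U i j"
  define E1 E3 where "E1 = exp (- 9 / 20 :: real)" and "E3 = exp (- 81 / 20 :: real)"
  have E: "E1 \<ge> 797 / 1250" "E3 \<ge> 87 / 5000" unfolding E1_def E3_def by (rule exp_lower_bounds)+
  have img: "({i} \<rightarrow>\<^sub>E wave_freqs) = (\<lambda>f. (\<lambda>x\<in>{i}. f)) ` wave_freqs" for i :: nat
    unfolding PiE_over_singleton_iff by blast
  have inj: "inj_on (\<lambda>f. (\<lambda>x\<in>{i}. f)) wave_freqs" for i :: nat
  proof (rule inj_onI)
    fix f g :: real assume "(\<lambda>x\<in>{i}. f) = (\<lambda>x\<in>{i}. g)"
    from fun_cong[OF this, of i] show "f = g" by simp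
  qed
  have "complex_of_real (gauss_kernel n U {i} {j}) = (- \<i>) ^ 2 * complex_of_real (\<Sum>f\<in>{j} \<rightarrow>\<^sub>E wave_freqs.
      (\<Prod>l\<in>{j}. damped_coeff (f l)) * (\<Prod>i\<in>{i}. wave_response (\<Sum>j\<in>{j}. U i j * f j)))"
  proof -
    have "finite {i}" "finite {j}" "{i} \<subseteq> {..<n}" "{j} \<subseteq> {..<n}" "card {i} + card {j} = 2"
      using ij by auto
    then show ?thesis using gauss_kernel_expand[OF U, of "{i}" "{j}"] by (simp only: damped_sum_eq_response)
  qed
  also have "(- \<i>) ^ 2 = complex_of_real (- 1)" by simp
  finally have "gauss_kernel n U {i} {j} = - 1 * (\<Sum>f\<in>{j} \<rightarrow>\<^sub>E wave_freqs.
      (\<Prod>l\<in>{j}. damped_coeff (f l)) * (\<Prod>i\<in>{i}. wave_response (\<Sum>j\<in>{j}. U i j * f j)))"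
    by (simp only: of_real_mult[symmetric] of_real_eq_iff)
  also have "\<dots> = - (\<Sum>f\<in>wave_freqs. damped_coeff f * wave_response (u * f))"
    unfolding img by (subst sum.reindex[OF inj]) (simp add: u_def)
  also have "\<dots> = (577 / 500 * E1)\<^sup>2 * sinh (9 / 10 * u) + 2 * (577 / 500 * E1) * (193 / 1000 * E3) * sinh (27 / 10 * u)
      + (193 / 1000 * E3)\<^sup>2 * sinh (81 / 10 * u)"
    unfolding wave_freqs_def damped_coeff_def wave_coeff_def wave_response_eq E1_def E3_def
    by (simp add: power2_eq_square algebra_simps)
  finally have eq: "u * gauss_kernel n U {i} {j} = (577 / 500 * E1)\<^sup>2 * (u * sinh (9 / 10 * u))
      + 2 * (577 / 500 * E1) * (193 / 1000 * E3) * (u * sinh (27 / 10 * u)) + (193 / 1000 * E3)\<^sup>2 * (u * sinh (81 / 10 * u))"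
    by (simp add: algebra_simps)
  have "(577 / 500 * E1)\<^sup>2 * (u * sinh (9 / 10 * u))
      + 2 * (577 / 500 * E1) * (193 / 1000 * E3) * (u * sinh (27 / 10 * u)) + (193 / 1000 * E3)\<^sup>2 * (u * sinh (81 / 10 * u))
     \<ge> (577 / 500 * E1)\<^sup>2 * (9 / 10 * u\<^sup>2)
      + 2 * (577 / 500 * E1) * (193 / 1000 * E3) * (27 / 10 * u\<^sup>2) + (193 / 1000 * E3)\<^sup>2 * (81 / 10 * u\<^sup>2)"
    using E by (intro add_mono mult_left_mono mult_sinh_ge) auto
  also have "(577 / 500 * E1)\<^sup>2 * (9 / 10 * u\<^sup>2)
      + 2 * (577 / 500 * E1) * (193 / 1000 * E3) * (27 / 10 * u\<^sup>2) + (193 / 1000 * E3)\<^sup>2 * (81 / 10 * u\<^sup>2)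
     = 9 / 10 * (577 / 500 * E1 + 3 * (193 / 1000 * E3))\<^sup>2 * u\<^sup>2"
    by (simp add: power2_eq_square algebra_simps)
  finally have "u * gauss_kernel n U {i} {j} \<ge> 9 / 10 * (577 / 500 * E1 + 3 * (193 / 1000 * E3))\<^sup>2 * u\<^sup>2"
    unfolding eq .
  moreover have "9 / 10 * (577 / 500 * E1 + 3 * (193 / 1000 * E3))\<^sup>2 * u\<^sup>2 \<ge> 1001 / 2000 * u\<^sup>2"
  proof (rule mult_right_mono)
    have "577 / 500 * (797 / 1250) + 3 * (193 / 1000 * (87 / 5000)) \<le> 577 / 500 * E1 + 3 * (193 / 1000 * E3)"
      using E by (intro add_mono mult_left_mono) auto
    then have "(577 / 500 * (797 / 1250) + 3 * (193 / 1000 * (87 / 5000)))\<^sup>2 \<le> (577 / 500 * E1 + 3 * (193 / 1000 * E3))\<^sup>2"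
      by (rule power_mono) simp
    then show "1001 / 2000 \<le> 9 / 10 * (577 / 500 * E1 + 3 * (193 / 1000 * E3))\<^sup>2"
      by (simp add: power2_eq_square)
  qed simp
  ultimately show ?thesis unfolding u_def by linarith
qed

section \<open>The chained distribution\<close>

definition hidden_space :: "nat \<Rightarrow> nat \<Rightarrow> (nat \<Rightarrow> nat \<Rightarrow> real) measure" where
  "hidden_space K n = (\<Pi>\<^sub>M a\<in>{..<K}. gauss_space n)"

text \<open>\<open>K\<close> is \<open>k - 1\<close>. Hidden vector \<open>a\<close> links block
  \<open>a\<close> to block \<open>a + 1\<close>; the first and the last block have one link only,
  and the missing factor is 1.\<close>

definition chain_bias ::
  "nat \<Rightarrow> nat \<Rightarrow> (nat \<Rightarrow> nat \<Rightarrow> real) \<Rightarrow> (nat \<Rightarrow> nat \<Rightarrow> real) \<Rightarrow> nat \<times> nat \<Rightarrow> real" where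
  "chain_bias K n U z s =
     (if fst s = 0 then 1 else wave (\<Sum>u<n. U u (snd s) * z (fst s - 1) u)) *
     (if fst s = K then 1 else wave (z (fst s) (snd s)))"

text \<open>The Fourier coefficient at \<open>S\<close> of the density of the hard distribution
  relative to the uniform one.\<close>

definition chain_weight :: "nat \<Rightarrow> nat \<Rightarrow> (nat \<Rightarrow> nat \<Rightarrow> real) \<Rightarrow> (nat \<times> nat) set \<Rightarrow> real" where
  "chain_weight K n U S = (LINT z|hidden_space K n. (\<Prod>s\<in>S. chain_bias K n U z s))"

definition slice :: "(nat \<times> nat) set \<Rightarrow> nat \<Rightarrow> nat set" where
  "slice S m = {v. (m, v) \<in> S}"

lemma abs_prod_le_1:
  fixes f :: "'b \<Rightarrow> real"
  assumes "\<And>s. s \<in> S \<Longrightarrow> \<bar>f s\<bar> \<le> 1"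
  shows "\<bar>prod f S\<bar> \<le> 1"
  unfolding abs_prod by (rule prod_le_1) (use assms in auto)

lemma prob_space_hidden_space: "prob_space (hidden_space K n)"
  unfolding hidden_space_def by (intro prob_space_PiM prob_space_gauss_space)

lemma abs_chain_bias_le: "\<bar>chain_bias K n U z s\<bar> \<le> 1"
  unfolding chain_bias_def abs_mult using abs_wave_le by (intro mult_le_one) auto

lemma measurable_hidden_component:
  assumes "m < K" "v < n"
  shows "(\<lambda>z. z m v) \<in> borel_measurable (hidden_space K n)"
proof -
  have "(\<lambda>z. z m) \<in> measurable (hidden_space K n) (gauss_space n)"
    unfolding hidden_space_def by (rule measurable_component_singleton) (use assms in simp)
  from measurable_compose[OF this measurable_gauss_component[OF assms(2)]] show ?thesis .
qed

lemma measurable_chain_bias: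
  assumes "s \<in> {..<Suc K} \<times> {..<n}"
  shows "(\<lambda>z. chain_bias K n U z s) \<in> borel_measurable (hidden_space K n)"
proof -
  obtain m v where s: "s = (m, v)" "m \<le> K" "v < n" using assms by auto
  have 1: "(\<lambda>z. wave (z m v)) \<in> borel_measurable (hidden_space K n)" if "m \<noteq> K"
    by (rule measurable_compose[OF measurable_hidden_component wave_measurable]) (use that s in auto)
  have "(\<lambda>z. \<Sum>u<n. U u v * z (m - 1) u) \<in> borel_measurable (hidden_space K n)" if "m \<noteq> 0"
    by (intro borel_measurable_sum borel_measurable_times borel_measurable_const
        measurable_hidden_component) (use that s in auto)
  from measurable_compose[OF this wave_measurable]
  have 2: "(\<lambda>z. wave (\<Sum>u<n. U u v * z (m - 1) u)) \<in> borel_measurable (hidden_space K n)" if "m \<noteq> 0"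
    using that by simp
  show ?thesis unfolding chain_bias_def s using 1 2
    by (cases "m = 0"; cases "m = K") (auto intro: borel_measurable_times)
qed

lemma integrable_chain_prod:
  assumes "S \<subseteq> {..<Suc K} \<times> {..<n}"
  shows "integrable (hidden_space K n) (\<lambda>z. \<Prod>s\<in>S. chain_bias K n U z s)"
proof (rule finite_measure.integrable_const_bound[where B = 1])
  show "finite_measure (hidden_space K n)"
    by (rule prob_space.finite_measure[OF prob_space_hidden_space])
  show "AE z in hidden_space K n. norm (\<Prod>s\<in>S. chain_bias K n U z s) \<le> 1"
    by (simp add: abs_prod_le_1 abs_chain_bias_le)
  show "(\<lambda>z. \<Prod>s\<in>S. chain_bias K n U z s) \<in> borel_measurable (hidden_space K n)"
    using assms by (intro borel_measurable_prod measurable_chain_bias) auto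
qed

lemma prod_slices:
  assumes "S \<subseteq> {..<k} \<times> {..<n}"
  shows "(\<Prod>s\<in>S. f (fst s) (snd s)) = (\<Prod>m<k. \<Prod>v\<in>slice S m. f m v)"
proof -
  have "S = Sigma {..<k} (slice S)" using assms unfolding slice_def by auto
  moreover have "finite (slice S m)" for m
    by (rule finite_subset[of _ "{..<n}"]) (use assms in \<open>auto simp: slice_def\<close>)
  ultimately show ?thesis by (subst prod.Sigma) (auto simp: case_prod_beta)
qed

text \<open>Hidden vector \<open>a\<close> meets only the slices \<open>a\<close> and
  \<open>a + 1\<close>. Regrouping the biases by hidden vector lets independence split the
  integral.\<close>

lemma chain_weight_eq:
  assumes S: "S \<subseteq> {..<Suc K} \<times> {..<n}"
  shows "chain_weight K n U S = (\<Prod>a<K. gauss_kernel n U (slice S a) (slice S (Suc a)))"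
proof -
  define F where "F a y = (\<Prod>v\<in>slice S a. wave (y v)) * (\<Prod>v\<in>slice S (Suc a). wave (\<Sum>u<n. U u v * y u))" for a and y :: "nat \<Rightarrow> real"
  have sub: "slice S m \<subseteq> {..<n}" for m using S by (auto simp: slice_def)
  have "(\<Prod>s\<in>S. chain_bias K n U z s) = (\<Prod>a<K. F a (z a))" for z
  proof -
    have "(\<Prod>s\<in>S. chain_bias K n U z s) =
        (\<Prod>m<Suc K. \<Prod>v\<in>slice S m. if m = 0 then 1 else wave (\<Sum>u<n. U u v * z (m - 1) u)) *
        (\<Prod>m<Suc K. \<Prod>v\<in>slice S m. if m = K then 1 else wave (z m v))"
      unfolding chain_bias_def prod.distrib
      using prod_slices[OF S, of "\<lambda>m v. if m = 0 then 1 else wave (\<Sum>u<n. U u v * z (m - 1) u)"]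
        prod_slices[OF S, of "\<lambda>m v. if m = K then 1 else wave (z m v)"] by simp
    also have "(\<Prod>m<Suc K. \<Prod>v\<in>slice S m. if m = 0 then 1 else wave (\<Sum>u<n. U u v * z (m - 1) u))
        = (\<Prod>a<K. \<Prod>v\<in>slice S (Suc a). wave (\<Sum>u<n. U u v * z a u))"
      by (subst prod.lessThan_Suc_shift) simp
    also have "(\<Prod>m<Suc K. \<Prod>v\<in>slice S m. if m = K then 1 else wave (z m v))
        = (\<Prod>a<K. \<Prod>v\<in>slice S a. wave (z a v))"
      by simp
    finally show ?thesis unfolding F_def prod.distrib by (simp only: mult.commute)
  qed
  then have "chain_weight K n U S = (LINT z|hidden_space K n. (\<Prod>a<K. F a (z a)))"
    unfolding chain_weight_def by simp
  also have "\<dots> = (\<Prod>a<K. integral\<^sup>L (gauss_space n) (F a))"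
  proof -
    interpret product_prob_space "\<lambda>_. gauss_space n" "{..<K}"
      by (rule product_prob_spaceI) (rule prob_space_gauss_space)
    show ?thesis unfolding hidden_space_def
    proof (rule product_integral_prod)
      fix a
      show "integrable (gauss_space n) (F a)"
      proof (rule finite_measure.integrable_const_bound[where B = 1])
        show "finite_measure (gauss_space n)"
          by (rule prob_space.finite_measure[OF prob_space_gauss_space])
        show "AE y in gauss_space n. norm (F a y) \<le> 1"
          unfolding F_def by (auto simp: abs_mult intro!: AE_I2 mult_le_one abs_prod_le_1 abs_wave_le)
        have 1: "(\<lambda>y. wave (y v)) \<in> borel_measurable (gauss_space n)" if "v < n" for v
          by (rule measurable_compose[OF measurable_gauss_component[OF that] wave_measurable])
        have "(\<lambda>y. \<Sum>u<n. U u v * y u) \<in> borel_measurable (gauss_space n)" for v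
          by (intro borel_measurable_sum borel_measurable_times borel_measurable_const measurable_gauss_component) simp
        from measurable_compose[OF this wave_measurable]
        show "F a \<in> borel_measurable (gauss_space n)"
          unfolding F_def using sub
          by (intro borel_measurable_times borel_measurable_prod 1) auto
      qed
    qed simp
  qed
  finally show ?thesis unfolding gauss_kernel_def F_def .
qed

lemma chain_weight_empty [simp]: "chain_weight K n U {} = 1"
  unfolding chain_weight_def using prob_space.prob_space[OF prob_space_hidden_space[of K n]] by simp

text \<open>Given the hidden Gaussians the bits are independent with biases \<^const>\<open>chain_bias\<close>.\<close>

lemma chain_density_nonneg:
  assumes x: "x \<in> sign_inputs ({..<Suc K} \<times> {..<n})"
  shows "(\<Sum>S\<in>Pow ({..<Suc K} \<times> {..<n}). chain_weight K n U S * monomial S x) \<ge> 0"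
proof -
  define I where "I = {..<Suc K} \<times> {..<n}"
  have fin: "finite I" unfolding I_def by simp
  have "(\<Sum>S\<in>Pow I. chain_weight K n U S * monomial S x)
      = (\<Sum>S\<in>Pow I. LINT z|hidden_space K n. (\<Prod>s\<in>S. chain_bias K n U z s) * monomial S x)"
    unfolding chain_weight_def by simp
  also have "\<dots> = (LINT z|hidden_space K n. (\<Sum>S\<in>Pow I. (\<Prod>s\<in>S. chain_bias K n U z s) * monomial S x))"
    by (rule Bochner_Integration.integral_sum[symmetric])
      (auto intro!: integrable_mult_left integrable_chain_prod simp: I_def)
  also have "\<dots> \<ge> 0"
  proof (rule Bochner_Integration.integral_nonneg)
    fix z
    have "(\<Sum>S\<in>Pow I. (\<Prod>s\<in>S. chain_bias K n U z s) * monomial S x)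
        = (\<Prod>s\<in>I. chain_bias K n U z s * x s + 1)"
      unfolding prod_add[OF fin] by (simp add: monomial_def prod.distrib)
    also have "\<dots> \<ge> 0"
    proof (rule prod_nonneg)
      fix s assume s: "s \<in> I"
      have "\<bar>chain_bias K n U z s * x s\<bar> \<le> 1"
        using abs_chain_bias_le[of K n U z s] sign_inputs_cases[OF x, of s] s by (auto simp: I_def abs_mult)
      then show "0 \<le> chain_bias K n U z s * x s + 1" by linarith
    qed
    finally show "0 \<le> (\<Sum>S\<in>Pow I. (\<Prod>s\<in>S. chain_bias K n U z s) * monomial S x)" .
  qed
  finally show ?thesis unfolding I_def .
qed

section \<open>Path expansion of the forrelation and its moments\<close>

primrec path_total :: "nat \<Rightarrow> (nat \<Rightarrow> nat \<Rightarrow> nat \<Rightarrow> real) \<Rightarrow> nat \<Rightarrow> nat \<Rightarrow> real" where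
  "path_total n A 0 j = 1"
| "path_total n A (Suc m) j = (\<Sum>l<n. path_total n A m l * A m l j)"

lemma sum_PiE_insert:
  assumes "x \<notin> S" "finite S" "finite B"
  shows "(\<Sum>g\<in>insert x S \<rightarrow>\<^sub>E B. F g) = (\<Sum>y\<in>B. \<Sum>g\<in>S \<rightarrow>\<^sub>E B. F (g(x := y)))"
proof -
  have "inj_on (\<lambda>(y, g). g(x := y)) (B \<times> (S \<rightarrow>\<^sub>E B))"
    by (rule inj_combinator[OF assms(1)])
  then have "(\<Sum>g\<in>insert x S \<rightarrow>\<^sub>E B. F g) = (\<Sum>(y, g)\<in>B \<times> (S \<rightarrow>\<^sub>E B). F (g(x := y)))"
    unfolding PiE_insert_eq by (subst sum.reindex) (auto simp: case_prod_beta)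
  then show ?thesis by (simp add: sum.cartesian_product)
qed

text \<open>The transfer matrix method. The free function \<open>h\<close> at the endpoint lets the
  induction absorb the last step of the path.\<close>

lemma sum_paths:
  "(\<Sum>\<pi>\<in>{..m} \<rightarrow>\<^sub>E {..<n}. (\<Prod>a<m. A a (\<pi> a) (\<pi> (Suc a))) * h (\<pi> m)) = (\<Sum>j<n. path_total n A m j * h j)"
proof (induction m arbitrary: h)
  case 0
  have "{..0::nat} = insert 0 {}" by auto
  then show ?case by (simp add: sum_PiE_insert)
next
  case (Suc m)
  have "{..Suc m} = insert (Suc m) {..m}" by auto
  then have "(\<Sum>\<pi>\<in>{..Suc m} \<rightarrow>\<^sub>E {..<n}. (\<Prod>a<Suc m. A a (\<pi> a) (\<pi> (Suc a))) * h (\<pi> (Suc m)))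
      = (\<Sum>y<n. \<Sum>\<pi>\<in>{..m} \<rightarrow>\<^sub>E {..<n}. (\<Prod>a<Suc m. A a ((\<pi>(Suc m := y)) a) ((\<pi>(Suc m := y)) (Suc a))) * h y)"
    by (simp only: sum_PiE_insert finite_atMost finite_lessThan fun_upd_same) (subst sum_PiE_insert; simp)
  also have "\<dots> = (\<Sum>y<n. \<Sum>\<pi>\<in>{..m} \<rightarrow>\<^sub>E {..<n}. (\<Prod>a<m. A a (\<pi> a) (\<pi> (Suc a))) * (A m (\<pi> m) y * h y))"
  proof (intro sum.cong refl)
    fix y \<pi>
    have "(\<Prod>a<m. A a ((\<pi>(Suc m := y)) a) ((\<pi>(Suc m := y)) (Suc a))) = (\<Prod>a<m. A a (\<pi> a) (\<pi> (Suc a)))"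
      by (rule prod.cong) auto
    then show "(\<Prod>a<Suc m. A a ((\<pi>(Suc m := y)) a) ((\<pi>(Suc m := y)) (Suc a))) * h y
        = (\<Prod>a<m. A a (\<pi> a) (\<pi> (Suc a))) * (A m (\<pi> m) y * h y)"
      by simp
  qed
  also have "\<dots> = (\<Sum>y<n. \<Sum>j<n. path_total n A m j * (A m j y * h y))"
    by (intro sum.cong refl Suc.IH)
  also have "\<dots> = (\<Sum>y<n. path_total n A (Suc m) y * h y)"
    by (simp add: sum_distrib_right mult.assoc)
  finally show ?case .
qed

text \<open>The entries of the row vector \<open>1^T D U D ... U D\<close> with \<open>m + 1\<close>
  diagonal factors.\<close>

primrec walk :: "nat \<Rightarrow> (nat \<Rightarrow> nat \<Rightarrow> real) \<Rightarrow> (nat \<times> nat \<Rightarrow> real) \<Rightarrow> nat \<Rightarrow> nat \<Rightarrow> real" where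
  "walk n U x 0 j = x (0, j)"
| "walk n U x (Suc m) j = (\<Sum>l<n. walk n U x m l * U l j) * x (Suc m, j)"

definition chain_form :: "nat \<Rightarrow> nat \<Rightarrow> (nat \<Rightarrow> nat \<Rightarrow> real) \<Rightarrow> (nat \<times> nat \<Rightarrow> real) \<Rightarrow> real" where
  "chain_form K n U x = 1 / real n * (\<Sum>j<n. walk n U x K j)"

definition path_set :: "nat \<Rightarrow> (nat \<Rightarrow> nat) \<Rightarrow> (nat \<times> nat) set" where
  "path_set K \<pi> = (\<lambda>a. (a, \<pi> a)) ` {..K}"

definition path_coeff :: "nat \<Rightarrow> (nat \<Rightarrow> nat \<Rightarrow> real) \<Rightarrow> (nat \<Rightarrow> nat) \<Rightarrow> real" where
  "path_coeff K U \<pi> = (\<Prod>a<K. U (\<pi> a) (\<pi> (Suc a)))"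

lemma walk_eq_path_total: "walk n U x m j = path_total n (\<lambda>a l j. x (a, l) * U l j) m j * x (m, j)"
  by (induction m arbitrary: j) (simp_all add: mult_ac)

lemma monomial_path_set: "monomial (path_set K \<pi>) x = (\<Prod>a\<le>K. x (a, \<pi> a))"
  unfolding monomial_def path_set_def by (subst prod.reindex) (auto simp: inj_on_def)

lemma chain_form_paths:
  "chain_form K n U x = (\<Sum>\<pi>\<in>{..K} \<rightarrow>\<^sub>E {..<n}. path_coeff K U \<pi> / real n * monomial (path_set K \<pi>) x)"
proof -
  have "(\<Sum>j<n. walk n U x K j) = (\<Sum>\<pi>\<in>{..K} \<rightarrow>\<^sub>E {..<n}. (\<Prod>a<K. x (a, \<pi> a) * U (\<pi> a) (\<pi> (Suc a))) * x (K, \<pi> K))"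
    unfolding walk_eq_path_total by (rule sum_paths[symmetric])
  also have "\<dots> = (\<Sum>\<pi>\<in>{..K} \<rightarrow>\<^sub>E {..<n}. path_coeff K U \<pi> * monomial (path_set K \<pi>) x)"
    unfolding path_coeff_def monomial_path_set prod.distrib by (simp add: lessThan_Suc_atMost[symmetric] mult_ac)
  finally show ?thesis unfolding chain_form_def by (simp add: sum_distrib_left)
qed

lemma path_set_subset: "\<pi> \<in> {..K} \<rightarrow>\<^sub>E {..<n} \<Longrightarrow> path_set K \<pi> \<subseteq> {..<Suc K} \<times> {..<n}"
  unfolding path_set_def by auto

lemma inj_on_path_set: "inj_on (path_set K) ({..K} \<rightarrow>\<^sub>E {..<n})"
proof (rule inj_onI)
  fix \<pi> \<pi>' assume *: "\<pi> \<in> {..K} \<rightarrow>\<^sub>E {..<n}" "\<pi>' \<in> {..K} \<rightarrow>\<^sub>E {..<n}" "path_set K \<pi> = path_set K \<pi>'"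
  show "\<pi> = \<pi>'"
  proof (rule PiE_ext[OF *(1,2)])
    fix a assume "a \<in> {..K}"
    then have "(a, \<pi> a) \<in> path_set K \<pi>'" using *(3) unfolding path_set_def by auto
    then show "\<pi> a = \<pi>' a" unfolding path_set_def by auto
  qed
qed

lemma slice_path_set: "a \<le> K \<Longrightarrow> slice (path_set K \<pi>) a = {\<pi> a}"
  unfolding slice_def path_set_def by auto

text \<open>Parseval, as distinct paths give distinct monomials. The squared entries multiplied
  along all paths sum to \<open>n\<close>, because every column of \<open>U\<close> has unit
  norm.\<close>

lemma chain_form_second_moment:
  assumes U: "orthonormal_columns n U" and n: "n > 0"
  shows "cube_avg ({..<Suc K} \<times> {..<n}) (\<lambda>x. (chain_form K n U x)\<^sup>2) = 1 / real n"
proof -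
  let ?I = "{..<Suc K} \<times> {..<n}" and ?P = "{..K} \<rightarrow>\<^sub>E {..<n}"
  have fin: "finite ?I" "finite ?P" by (auto intro: finite_PiE)
  have "cube_avg ?I (\<lambda>x. (chain_form K n U x)\<^sup>2)
     = (\<Sum>\<pi>\<in>?P. path_coeff K U \<pi> / real n * cube_avg ?I (\<lambda>x. chain_form K n U x * monomial (path_set K \<pi>) x))"
    unfolding cube_avg_lincomb[symmetric] chain_form_paths[symmetric] power2_eq_square ..
  also have "\<dots> = (\<Sum>\<pi>\<in>?P. (path_coeff K U \<pi>)\<^sup>2 / (real n)\<^sup>2)"
  proof (rule sum.cong[OF refl])
    fix \<pi> assume \<pi>: "\<pi> \<in> ?P"
    have "cube_avg ?I (\<lambda>x. chain_form K n U x * monomial (path_set K \<pi>) x)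
        = (\<Sum>\<pi>'\<in>?P. path_coeff K U \<pi>' / real n * cube_avg ?I (\<lambda>x. monomial (path_set K \<pi>) x * monomial (path_set K \<pi>') x))"
      unfolding cube_avg_lincomb[symmetric] chain_form_paths[symmetric] by (simp only: mult.commute)
    also have "\<dots> = (\<Sum>\<pi>'\<in>?P. if \<pi>' = \<pi> then path_coeff K U \<pi>' / real n else 0)"
    proof (rule sum.cong[OF refl])
      fix \<pi>' assume \<pi>': "\<pi>' \<in> ?P"
      have "path_set K \<pi> = path_set K \<pi>' \<longleftrightarrow> \<pi>' = \<pi>"
        using inj_on_path_set[of K n] \<pi> \<pi>' unfolding inj_on_def by blast
      then show "path_coeff K U \<pi>' / real n * cube_avg ?I (\<lambda>x. monomial (path_set K \<pi>) x * monomial (path_set K \<pi>') x)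
          = (if \<pi>' = \<pi> then path_coeff K U \<pi>' / real n else 0)"
        using cube_avg_monomial_mult[OF fin(1) path_set_subset[OF \<pi>] path_set_subset[OF \<pi>']] by simp
    qed
    also have "\<dots> = path_coeff K U \<pi> / real n" using fin \<pi> by simp
    finally show "path_coeff K U \<pi> / real n * cube_avg ?I (\<lambda>x. chain_form K n U x * monomial (path_set K \<pi>) x)
        = (path_coeff K U \<pi>)\<^sup>2 / (real n)\<^sup>2" by (simp add: power2_eq_square)
  qed
  also have "\<dots> = (\<Sum>\<pi>\<in>?P. (\<Prod>a<K. (U (\<pi> a) (\<pi> (Suc a)))\<^sup>2) * 1) / (real n)\<^sup>2"
    unfolding path_coeff_def prod_power_distrib by (simp add: sum_divide_distrib)
  also have "(\<Sum>\<pi>\<in>?P. (\<Prod>a<K. (U (\<pi> a) (\<pi> (Suc a)))\<^sup>2) * 1) = (\<Sum>j<n. path_total n (\<lambda>a l j. (U l j)\<^sup>2) K j * 1)"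
    by (rule sum_paths)
  also have "\<dots> = real n"
  proof -
    have "path_total n (\<lambda>a l j. (U l j)\<^sup>2) m j = 1" if "j < n" for m j
      using that U by (induction m arbitrary: j) (auto simp: orthonormal_columns_def power2_eq_square)
    then show ?thesis by simp
  qed
  finally show ?thesis using n by (simp add: power2_eq_square)
qed

text \<open>The forrelation tests the density at path sets only, where the coefficient is a product
  of singleton kernels. No kernel has the opposite sign to its entry of \<open>U\<close>, so nothing
  cancels, and unit columns turn each link into a factor \<open>1001/2000\<close>.\<close>

lemma chain_form_mean:
  assumes U: "orthonormal_columns n U" and n: "n > 0"
  shows "cube_avg ({..<Suc K} \<times> {..<n}) (\<lambda>x.
      (\<Sum>S\<in>Pow ({..<Suc K} \<times> {..<n}). chain_weight K n U S * monomial S x) * chain_form K n U x) \<ge> (1001 / 2000) ^ K"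
proof -
  let ?I = "{..<Suc K} \<times> {..<n}" and ?P = "{..K} \<rightarrow>\<^sub>E {..<n}"
  let ?\<rho> = "\<lambda>x. \<Sum>S\<in>Pow ?I. chain_weight K n U S * monomial S x"
  have fin: "finite ?I" "finite ?P" by (auto intro: finite_PiE)
  have "cube_avg ?I (\<lambda>x. ?\<rho> x * chain_form K n U x)
      = (\<Sum>\<pi>\<in>?P. path_coeff K U \<pi> / real n * cube_avg ?I (\<lambda>x. ?\<rho> x * monomial (path_set K \<pi>) x))"
    unfolding cube_avg_lincomb[symmetric] chain_form_paths[symmetric] ..
  also have "\<dots> = (\<Sum>\<pi>\<in>?P. path_coeff K U \<pi> / real n * chain_weight K n U (path_set K \<pi>))"
  proof (intro sum.cong refl arg_cong2[where f = "(*)"])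
    fix \<pi> assume \<pi>: "\<pi> \<in> ?P"
    have "cube_avg ?I (\<lambda>x. ?\<rho> x * monomial (path_set K \<pi>) x)
        = (\<Sum>S\<in>Pow ?I. chain_weight K n U S * cube_avg ?I (\<lambda>x. monomial (path_set K \<pi>) x * monomial S x))"
      unfolding cube_avg_lincomb[symmetric] by (simp only: mult.commute)
    also have "\<dots> = (\<Sum>S\<in>Pow ?I. if S = path_set K \<pi> then chain_weight K n U S else 0)"
      using cube_avg_monomial_mult[OF fin(1) path_set_subset[OF \<pi>]] by (intro sum.cong refl) auto
    also have "\<dots> = chain_weight K n U (path_set K \<pi>)"
      using fin(1) path_set_subset[OF \<pi>] by simp
    finally show "cube_avg ?I (\<lambda>x. ?\<rho> x * monomial (path_set K \<pi>) x) = chain_weight K n U (path_set K \<pi>)" .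
  qed
  also have "\<dots> = 1 / real n * (\<Sum>\<pi>\<in>?P. (\<Prod>a<K. U (\<pi> a) (\<pi> (Suc a)) * gauss_kernel n U {\<pi> a} {\<pi> (Suc a)}) * 1)"
    unfolding sum_distrib_left
  proof (rule sum.cong[OF refl])
    fix \<pi> assume \<pi>: "\<pi> \<in> ?P"
    have "chain_weight K n U (path_set K \<pi>) = (\<Prod>a<K. gauss_kernel n U {\<pi> a} {\<pi> (Suc a)})"
      unfolding chain_weight_eq[OF path_set_subset[OF \<pi>]] by (rule prod.cong) (auto simp: slice_path_set)
    then show "path_coeff K U \<pi> / real n * chain_weight K n U (path_set K \<pi>)
       = 1 / real n * ((\<Prod>a<K. U (\<pi> a) (\<pi> (Suc a)) * gauss_kernel n U {\<pi> a} {\<pi> (Suc a)}) * 1)"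
      unfolding path_coeff_def prod.distrib by simp
  qed
  also have "(\<Sum>\<pi>\<in>?P. (\<Prod>a<K. U (\<pi> a) (\<pi> (Suc a)) * gauss_kernel n U {\<pi> a} {\<pi> (Suc a)}) * 1)
      = (\<Sum>j<n. path_total n (\<lambda>a l j. U l j * gauss_kernel n U {l} {j}) K j * 1)"
    by (rule sum_paths)
  also have "1 / real n * (\<Sum>j<n. path_total n (\<lambda>a l j. U l j * gauss_kernel n U {l} {j}) K j * 1) \<ge> (1001 / 2000) ^ K"
  proof -
    have "path_total n (\<lambda>a l j. U l j * gauss_kernel n U {l} {j}) m j \<ge> (1001 / 2000) ^ m" if "j < n" for m j
      using that
    proof (induction m arbitrary: j)
      case (Suc m)
      have "(1001 / 2000) ^ Suc m = (1001 / 2000) ^ m * (1001 / 2000) * (\<Sum>l<n. (U l j)\<^sup>2)"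
        using U Suc.prems by (auto simp: orthonormal_columns_def power2_eq_square)
      also have "\<dots> = (\<Sum>l<n. (1001 / 2000) ^ m * (1001 / 2000 * (U l j)\<^sup>2))"
        by (simp add: sum_distrib_left mult.assoc)
      also have "\<dots> \<le> (\<Sum>l<n. path_total n (\<lambda>a l j. U l j * gauss_kernel n U {l} {j}) m l * (U l j * gauss_kernel n U {l} {j}))"
      proof (rule sum_mono)
        fix l assume "l \<in> {..<n}"
        then have l: "l < n" by simp
        have "0 \<le> (1001 / 2000 :: real) ^ m" by simp
        also have "\<dots> \<le> path_total n (\<lambda>a l j. U l j * gauss_kernel n U {l} {j}) m l" by (rule Suc.IH[OF l])
        finally show "(1001 / 2000) ^ m * (1001 / 2000 * (U l j)\<^sup>2)
            \<le> path_total n (\<lambda>a l j. U l j * gauss_kernel n U {l} {j}) m l * (U l j * gauss_kernel n U {l} {j})"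
          by (intro mult_mono Suc.IH[OF l] gauss_kernel_singleton[OF U l Suc.prems]) auto
      qed
      finally show ?case by simp
    qed simp
    then have "(\<Sum>j<n. (1001 / 2000) ^ K) \<le> (\<Sum>j<n. path_total n (\<lambda>a l j. U l j * gauss_kernel n U {l} {j}) K j * 1)"
      by (intro sum_mono) auto
    then show ?thesis using n by (simp add: field_simps)
  qed
  finally show ?thesis .
qed

text \<open>Multiplication by \<open>U\<close> and by sign matrices preserves the length of the row
  vector, which starts at \<open>sqrt n\<close>; Cauchy-Schwarz then bounds the sum of its
  entries.\<close>

lemma chain_form_le_1:
  assumes R: "orthonormal_columns n (\<lambda>i j. U j i)" and n: "n > 0"
    and x: "x \<in> sign_inputs ({..<Suc K} \<times> {..<n})"
  shows "chain_form K n U x \<le> 1"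
proof -
  have norm: "(\<Sum>j<n. (walk n U x m j)\<^sup>2) = real n" if "m \<le> K" for m
    using that
  proof (induction m)
    case 0
    have "(x (0, j))\<^sup>2 = 1" if "j < n" for j
      using sign_inputs_square[OF x, of "(0, j)"] that by (simp add: power2_eq_square)
    then show ?case by simp
  next
    case (Suc m)
    have "(\<Sum>j<n. (walk n U x (Suc m) j)\<^sup>2) = (\<Sum>j<n. (\<Sum>l<n. walk n U x m l * U l j)\<^sup>2)"
    proof (rule sum.cong[OF refl])
      fix j assume "j \<in> {..<n}"
      then have "(x (Suc m, j))\<^sup>2 = 1"
        using sign_inputs_square[OF x, of "(Suc m, j)"] Suc.prems by (simp add: power2_eq_square)
      then show "(walk n U x (Suc m) j)\<^sup>2 = (\<Sum>l<n. walk n U x m l * U l j)\<^sup>2" by (simp add: power_mult_distrib)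
    qed
    also have "\<dots> = (\<Sum>l<n. (walk n U x m l)\<^sup>2)"
      using sum_combination_square[OF R, of "{}" "{..<n}" "\<lambda>_. 0" "walk n U x m"] by simp
    finally show ?case using Suc by simp
  qed
  have "(\<Sum>j<n. walk n U x K j)\<^sup>2 \<le> (\<Sum>j<n. (1::real)\<^sup>2) * (\<Sum>j<n. (walk n U x K j)\<^sup>2)"
    using Cauchy_Schwarz_ineq_sum[of "\<lambda>_. 1" "walk n U x K" "{..<n}"] by simp
  also have "\<dots> = (real n)\<^sup>2" using norm[of K] by (simp add: power2_eq_square)
  finally have "(\<Sum>j<n. walk n U x K j) \<le> real n" by (rule power2_le_imp_le) simp
  then show ?thesis unfolding chain_form_def using n by simp
qed

section \<open>Haar-distributed orthogonal matrices\<close>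

text \<open>The limit, as \<open>q\<close> grows, of the two-point inequality for 1 and
  \<open>x / (2 q)\<close>.\<close>

lemma cosh_le_exp_half_square: "cosh x \<le> exp (x\<^sup>2 / 2)" for x :: real
proof (rule LIMSEQ_le_const2)
  define f where "f q = ((1 + x / real (2 * q)) ^ (2 * q) + (1 + - x / real (2 * q)) ^ (2 * q)) / 2" for q :: nat
  have lim: "(\<lambda>q. (1 + y / real (2 * q)) ^ (2 * q)) \<longlonglongrightarrow> exp y" for y :: real
    using LIMSEQ_subseq_LIMSEQ[OF tendsto_exp_limit_sequentially[of y], of "\<lambda>q. 2 * q"]
    by (simp add: strict_mono_def o_def)
  have "f \<longlonglongrightarrow> (exp x + exp (- x)) / 2"
    unfolding f_def by (intro tendsto_intros lim) simp
  then show "f \<longlonglongrightarrow> cosh x" unfolding cosh_field_def .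
  have "f q \<le> exp (x\<^sup>2 / 2)" if q: "q \<ge> 1" for q
  proof -
    define y where "y = x / real (2 * q)"
    have "f q = ((1 + y) ^ (2 * q) + (1 - y) ^ (2 * q)) / 2" unfolding f_def y_def by simp
    also have "\<dots> \<le> (1\<^sup>2 + (2 * real q - 1) * y\<^sup>2) ^ q"
      by (rule two_point_inequality) (use q in simp)
    also have "\<dots> \<le> exp ((2 * real q - 1) * y\<^sup>2) ^ q"
      using q by (intro power_mono) auto
    also have "\<dots> = exp (real q * ((2 * real q - 1) * y\<^sup>2))" by (simp add: exp_of_nat_mult)
    also have "\<dots> \<le> exp (x\<^sup>2 / 2)"
    proof -
      have "real q * ((2 * real q - 1) * y\<^sup>2) \<le> real q * ((2 * real q) * y\<^sup>2)"
        by (intro mult_left_mono mult_right_mono) auto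
      also have "\<dots> = x\<^sup>2 / 2" unfolding y_def using q by (simp add: power2_eq_square)
      finally show ?thesis by simp
    qed
    finally show ?thesis .
  qed
  then show "\<exists>N. \<forall>q\<ge>N. f q \<le> exp (x\<^sup>2 / 2)" by blast
qed

lemma cube_avg_exp:
  assumes "finite I"
  shows "cube_avg I (\<lambda>x. exp (\<Sum>v\<in>I. c v * x v)) = (\<Prod>v\<in>I. cosh (c v))"
proof -
  have "(\<Sum>x\<in>sign_inputs I. exp (\<Sum>v\<in>I. c v * x v)) = (\<Sum>x\<in>I \<rightarrow>\<^sub>E {-1, 1}. \<Prod>v\<in>I. exp (c v * x v))"
    unfolding sign_inputs_def by (simp add: exp_sum assms)
  also have "\<dots> = (\<Prod>v\<in>I. \<Sum>y\<in>{-1, 1}. exp (c v * y))"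
    by (rule prod_sum_PiE[symmetric]) (use assms in auto)
  also have "\<dots> = (\<Prod>v\<in>I. 2 * cosh (c v))"
    by (rule prod.cong) (auto simp: cosh_field_def)
  also have "\<dots> = 2 ^ card I * (\<Prod>v\<in>I. cosh (c v))" by (simp add: prod.distrib)
  finally show ?thesis unfolding cube_avg_def by simp
qed

section \<open>The orthogonal group\<close>

abbreviation entries :: "real mat \<Rightarrow> nat \<Rightarrow> nat \<Rightarrow> real" where
  "entries U i j \<equiv> U $$ (i, j)"

lemma orthogonal_group_columns:
  assumes "U \<in> orthogonal_group n"
  shows "orthonormal_columns n (entries U)"
  unfolding orthonormal_columns_def
proof (intro allI impI)
  fix i j assume ij: "i < n" "j < n"
  have U: "U \<in> carrier_mat n n" "transpose_mat U * U = 1\<^sub>m n"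
    using assms unfolding orthogonal_group_def by auto
  have "(transpose_mat U * U) $$ (i, j) = (\<Sum>v<n. U $$ (v, i) * U $$ (v, j))"
    using U(1) ij by (simp add: scalar_prod_def lessThan_atLeast0)
  then show "(\<Sum>v<n. U $$ (v, i) * U $$ (v, j)) = (if i = j then 1 else 0)"
    unfolding U(2) using ij by simp
qed

lemma orthogonal_group_transpose:
  assumes "U \<in> orthogonal_group n"
  shows "transpose_mat U \<in> orthogonal_group n"
proof -
  have U: "U \<in> carrier_mat n n" "transpose_mat U * U = 1\<^sub>m n"
    using assms unfolding orthogonal_group_def by auto
  then have "U * transpose_mat U = 1\<^sub>m n"
    using mat_mult_left_right_inverse[of "transpose_mat U" n U] by simp
  then show ?thesis using U unfolding orthogonal_group_def by simp
qed

lemma orthogonal_group_rows: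
  assumes "U \<in> orthogonal_group n"
  shows "orthonormal_columns n (\<lambda>i j. entries U j i)"
proof -
  have "U \<in> carrier_mat n n" using assms unfolding orthogonal_group_def by auto
  then show ?thesis
    using orthogonal_group_columns[OF orthogonal_group_transpose[OF assms]]
    unfolding orthonormal_columns_def by simp
qed

lemma orthogonal_group_mult:
  assumes "Q \<in> orthogonal_group n" "U \<in> orthogonal_group n"
  shows "Q * U \<in> orthogonal_group n"
proof -
  have c: "U \<in> carrier_mat n n" "transpose_mat U * U = 1\<^sub>m n" "Q \<in> carrier_mat n n" "transpose_mat Q * Q = 1\<^sub>m n"
    using assms unfolding orthogonal_group_def by auto
  have "transpose_mat (Q * U) * (Q * U) = transpose_mat U * transpose_mat Q * (Q * U)"
    using c by (simp add: transpose_mult)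
  also have "\<dots> = transpose_mat U * (transpose_mat Q * (Q * U))"
    using c by (intro assoc_mult_mat[of _ n n _ n _ n]) auto
  also have "transpose_mat Q * (Q * U) = transpose_mat Q * Q * U"
    using c by (intro assoc_mult_mat[of _ n n _ n _ n, symmetric]) auto
  also have "transpose_mat U * (transpose_mat Q * Q * U) = 1\<^sub>m n" using c by simp
  finally show ?thesis using c unfolding orthogonal_group_def by simp
qed

lemma abs_orthogonal_entry_le:
  assumes "U \<in> orthogonal_group n" "i < n" "j < n"
  shows "\<bar>U $$ (i, j)\<bar> \<le> 1"
proof -
  have "(U $$ (i, j))\<^sup>2 \<le> (\<Sum>v<n. (U $$ (v, j))\<^sup>2)"
    by (rule member_le_sum[of i "{..<n}" "\<lambda>v. (U $$ (v, j))\<^sup>2"]) (use assms in auto)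
  also have "\<dots> = 1"
    using orthogonal_group_columns[OF assms(1)] assms unfolding orthonormal_columns_def
    by (simp add: power2_eq_square)
  finally show ?thesis by (simp add: abs_square_le_1)
qed

definition householder :: "nat \<Rightarrow> (nat \<Rightarrow> real) \<Rightarrow> real mat" where
  "householder n v = mat n n (\<lambda>(i, j). (if i = j then 1 else 0) - 2 / (\<Sum>l<n. (v l)\<^sup>2) * (v i * v j))"

lemma householder_orthogonal:
  assumes v: "(\<Sum>l<n. (v l)\<^sup>2) \<noteq> 0"
  shows "householder n v \<in> orthogonal_group n"
proof -
  define N where "N = (\<Sum>l<n. (v l)\<^sup>2)"
  have N: "N \<noteq> 0" using v unfolding N_def .
  have "transpose_mat (householder n v) * householder n v = 1\<^sub>m n"
  proof (rule eq_matI)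
    fix i j assume "i < dim_row (1\<^sub>m n :: real mat)" "j < dim_col (1\<^sub>m n :: real mat)"
    then have ij: "i < n" "j < n" by auto
    have "(transpose_mat (householder n v) * householder n v) $$ (i, j)
       = (\<Sum>l<n. ((if l = i then 1 else 0) - 2 / N * (v l * v i)) * ((if l = j then 1 else 0) - 2 / N * (v l * v j)))"
      using ij unfolding householder_def N_def by (simp add: scalar_prod_def lessThan_atLeast0)
    also have "\<dots> = (\<Sum>l<n. (if l = i then (if i = j then 1 else 0) else 0)
        - (if l = i then 2 / N * (v i * v j) else 0) - (if l = j then 2 / N * (v j * v i) else 0)
        + 4 / N\<^sup>2 * (v i * v j) * (v l)\<^sup>2)"
      by (intro sum.cong refl) (auto simp: algebra_simps power2_eq_square)
    also have "\<dots> = (if i = j then 1 else 0) - 2 / N * (v i * v j) - 2 / N * (v j * v i) + 4 / N\<^sup>2 * (v i * v j) * N"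
      unfolding sum.distrib sum_subtractf sum_distrib_left[symmetric] N_def[symmetric] using ij by simp
    also have "\<dots> = (if i = j then 1 else 0)"
      using N by (simp add: field_simps power2_eq_square)
    finally show "(transpose_mat (householder n v) * householder n v) $$ (i, j) = 1\<^sub>m n $$ (i, j)"
      using ij by simp
  qed (auto simp: householder_def)
  then show ?thesis unfolding orthogonal_group_def householder_def by simp
qed

text \<open>The reflection in the hyperplane orthogonal to \<open>a - a'\<close> takes
  \<open>a\<close> to \<open>a'\<close>; if the two agree, the identity does.\<close>

lemma orthogonal_transfer:
  assumes norm: "(\<Sum>i<n. (a i)\<^sup>2) = (\<Sum>i<n. (a' i)\<^sup>2)"
  obtains Q where "Q \<in> orthogonal_group n" "\<And>l. l < n \<Longrightarrow> (\<Sum>i<n. a i * Q $$ (i, l)) = a' l"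
proof (cases "(\<Sum>l<n. (a l - a' l)\<^sup>2) = 0")
  case True
  then have eq: "a l = a' l" if "l < n" for l
    using that sum_nonneg_eq_0_iff[of "{..<n}" "\<lambda>l. (a l - a' l)\<^sup>2"] by auto
  have "1\<^sub>m n \<in> orthogonal_group n" unfolding orthogonal_group_def by simp
  moreover have "(\<Sum>i<n. a i * (1\<^sub>m n :: real mat) $$ (i, l)) = a' l" if "l < n" for l
  proof -
    have "(\<Sum>i<n. a i * (1\<^sub>m n :: real mat) $$ (i, l)) = (\<Sum>i<n. if i = l then a i else 0)"
      by (rule sum.cong) (use that in auto)
    then show ?thesis using that eq by simp
  qed
  ultimately show ?thesis using that by blast
next
  case False
  define v where "v l = a l - a' l" for l
  define N where "N = (\<Sum>l<n. (v l)\<^sup>2)"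
  have N: "N \<noteq> 0" using False unfolding N_def v_def .
  have dot: "2 * (\<Sum>i<n. a i * v i) = N"
  proof -
    have "N = (\<Sum>l<n. (a l)\<^sup>2 - 2 * a l * a' l + (a' l)\<^sup>2)"
      unfolding N_def v_def by (simp add: power2_eq_square algebra_simps)
    also have "\<dots> = (\<Sum>l<n. (a l)\<^sup>2) - (\<Sum>l<n. 2 * a l * a' l) + (\<Sum>l<n. (a' l)\<^sup>2)"
      by (simp add: sum.distrib sum_subtractf)
    also have "\<dots> = 2 * (\<Sum>l<n. (a l)\<^sup>2) - (\<Sum>l<n. 2 * a l * a' l)" using norm by simp
    also have "\<dots> = 2 * (\<Sum>i<n. a i * v i)"
      unfolding v_def by (simp add: sum_distrib_left sum_subtractf[symmetric] power2_eq_square algebra_simps)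
    finally show ?thesis by simp
  qed
  have "(\<Sum>i<n. a i * householder n v $$ (i, l)) = a' l" if l: "l < n" for l
  proof -
    have "(\<Sum>i<n. a i * householder n v $$ (i, l)) = (\<Sum>i<n. (if i = l then a l else 0) - 2 / N * v l * (a i * v i))"
      unfolding householder_def N_def by (intro sum.cong refl) (use l in \<open>auto simp: algebra_simps\<close>)
    also have "\<dots> = a l - 2 / N * v l * (\<Sum>i<n. a i * v i)"
      using l by (simp add: sum_subtractf sum_distrib_left)
    also have "\<dots> = a l - v l * (2 * (\<Sum>i<n. a i * v i)) / N" by simp
    also have "\<dots> = a' l" unfolding dot using N by (simp add: v_def)
    finally show ?thesis .
  qed
  with householder_orthogonal[of v n] N show ?thesis using that unfolding N_def by blast
qed

section \<open>Exponential moments of bilinear forms under Haar measure\<close>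

lemma measurable_orthogonal_entry:
  assumes M: "haar_orthogonal n M" and ij: "i < n" "j < n"
  shows "(\<lambda>U. U $$ (i, j)) \<in> borel_measurable M"
proof -
  let ?P = "\<Pi>\<^sub>M p \<in> {..<n} \<times> {..<n}. (borel :: real measure)"
  let ?f = "\<lambda>U::real mat. \<lambda>p \<in> {..<n} \<times> {..<n}. U $$ p"
  have "?f \<in> measurable (orthogonal_borel n) ?P"
    unfolding orthogonal_borel_def by (rule measurable_vimage_algebra1) (auto simp: space_PiM)
  then have "?f \<in> measurable M ?P"
    using M measurable_cong_sets[of M "orthogonal_borel n" ?P ?P] unfolding haar_orthogonal_def by auto
  moreover have "(\<lambda>y. y (i, j)) \<in> measurable ?P borel"
    by (rule measurable_component_singleton) (use ij in auto)
  ultimately have "(\<lambda>U. ?f U (i, j)) \<in> borel_measurable M"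
    by (rule measurable_compose)
  then show ?thesis using ij by simp
qed

lemma mult_mat_entry:
  assumes "Q \<in> carrier_mat n n" "U \<in> carrier_mat n n" "i < n" "j < n"
  shows "(Q * U) $$ (i, j) = (\<Sum>l<n. Q $$ (i, l) * U $$ (l, j))"
  using assms by (simp add: scalar_prod_def lessThan_atLeast0)

lemma measurable_orthogonal_mult:
  assumes M: "haar_orthogonal n M" and Q: "Q \<in> orthogonal_group n"
  shows "(\<lambda>U. Q * U) \<in> measurable M M"
proof -
  let ?P = "\<Pi>\<^sub>M p \<in> {..<n} \<times> {..<n}. (borel :: real measure)"
  have sp: "space M = orthogonal_group n" and sets: "sets M = sets (orthogonal_borel n)"
    using M unfolding haar_orthogonal_def by auto
  have "(\<lambda>U. Q * U) \<in> measurable M (orthogonal_borel n)"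
    unfolding orthogonal_borel_def
  proof (rule measurable_vimage_algebra2)
    show "(\<lambda>U. Q * U) \<in> space M \<rightarrow> orthogonal_group n"
      using orthogonal_group_mult[OF Q] sp by auto
    show "(\<lambda>U. \<lambda>p\<in>{..<n} \<times> {..<n}. (Q * U) $$ p) \<in> measurable M ?P"
    proof (rule measurable_restrict)
      fix p assume "p \<in> {..<n} \<times> {..<n}"
      then obtain i j where p: "p = (i, j)" "i < n" "j < n" by auto
      have "(\<lambda>U. \<Sum>l<n. Q $$ (i, l) * U $$ (l, j)) \<in> borel_measurable M"
        using p by (intro borel_measurable_sum borel_measurable_times borel_measurable_const
            measurable_orthogonal_entry[OF M]) auto
      moreover have "(Q * U) $$ p = (\<Sum>l<n. Q $$ (i, l) * U $$ (l, j))" if "U \<in> space M" for U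
        using that Q p mult_mat_entry[of Q n U i j] unfolding sp orthogonal_group_def by auto
      ultimately show "(\<lambda>U. (Q * U) $$ p) \<in> borel_measurable M"
        by (simp cong: measurable_cong)
    qed
  qed
  then show ?thesis
    using measurable_cong_sets[of M M M "orthogonal_borel n"] sets by auto
qed

lemma integrable_orthogonal:
  assumes M: "haar_orthogonal n M" and f: "f \<in> borel_measurable M"
    and B: "\<And>U. U \<in> orthogonal_group n \<Longrightarrow> \<bar>f U\<bar> \<le> (B::real)"
  shows "integrable M f"
proof (rule finite_measure.integrable_const_bound[where B = B])
  show "finite_measure M" using M unfolding haar_orthogonal_def by (auto intro: prob_space.finite_measure)
  show "AE U in M. norm (f U) \<le> B"
    using M B unfolding haar_orthogonal_def by (auto intro!: AE_I2)
qed (rule f)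

lemma bilinear_measurable_bounded:
  assumes M: "haar_orthogonal n M"
  shows "(\<lambda>U. \<Sum>i<n. \<Sum>j<n. a i * U $$ (i, j) * b j) \<in> borel_measurable M"
    and "U \<in> orthogonal_group n \<Longrightarrow> (\<Sum>i<n. \<Sum>j<n. a i * U $$ (i, j) * b j) \<le> (\<Sum>i<n. \<Sum>j<n. \<bar>a i\<bar> * \<bar>b j\<bar>)"
proof -
  show "(\<lambda>U. \<Sum>i<n. \<Sum>j<n. a i * U $$ (i, j) * b j) \<in> borel_measurable M"
    by (intro borel_measurable_sum borel_measurable_times borel_measurable_const
        measurable_orthogonal_entry[OF M]) auto
  assume U: "U \<in> orthogonal_group n"
  show "(\<Sum>i<n. \<Sum>j<n. a i * U $$ (i, j) * b j) \<le> (\<Sum>i<n. \<Sum>j<n. \<bar>a i\<bar> * \<bar>b j\<bar>)"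
  proof (intro sum_mono)
    fix i j assume "i \<in> {..<n}" "j \<in> {..<n}"
    then have "\<bar>U $$ (i, j)\<bar> \<le> 1" using abs_orthogonal_entry_le[OF U] by auto
    then have "\<bar>a i\<bar> * \<bar>U $$ (i, j)\<bar> * \<bar>b j\<bar> \<le> \<bar>a i\<bar> * 1 * \<bar>b j\<bar>"
      by (intro mult_right_mono mult_left_mono) auto
    then show "a i * U $$ (i, j) * b j \<le> \<bar>a i\<bar> * \<bar>b j\<bar>"
      using abs_ge_self[of "a i * U $$ (i, j) * b j"] by (simp add: abs_mult)
  qed
qed

lemma integrable_exp_bilinear:
  assumes M: "haar_orthogonal n M"
  shows "integrable M (\<lambda>U. exp (\<Sum>i<n. \<Sum>j<n. a i * U $$ (i, j) * b j))"
  by (rule integrable_orthogonal[OF M, where B = "exp (\<Sum>i<n. \<Sum>j<n. \<bar>a i\<bar> * \<bar>b j\<bar>)"])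
    (use bilinear_measurable_bounded[OF M, where a = a and b = b] in auto)

lemma haar_exp_bilinear_invariant:
  assumes M: "haar_orthogonal n M" and norm: "(\<Sum>i<n. (a i)\<^sup>2) = (\<Sum>i<n. (a' i)\<^sup>2)"
  shows "(LINT U|M. exp (\<Sum>i<n. \<Sum>j<n. a i * U $$ (i, j) * b j)) = (LINT U|M. exp (\<Sum>i<n. \<Sum>j<n. a' i * U $$ (i, j) * b j))"
proof -
  obtain Q where Q: "Q \<in> orthogonal_group n" "\<And>l. l < n \<Longrightarrow> (\<Sum>i<n. a i * Q $$ (i, l)) = a' l"
    using orthogonal_transfer[OF norm] by blast
  have inv: "distr M M (\<lambda>U. Q * U) = M" and sp: "space M = orthogonal_group n"
    using M Q(1) unfolding haar_orthogonal_def by auto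
  have meas: "(\<lambda>U. exp (\<Sum>i<n. \<Sum>j<n. a i * U $$ (i, j) * b j)) \<in> borel_measurable M"
    using bilinear_measurable_bounded(1)[OF M, where a = a and b = b] by measurable
  have "(LINT U|M. exp (\<Sum>i<n. \<Sum>j<n. a i * U $$ (i, j) * b j))
      = (LINT U|distr M M (\<lambda>U. Q * U). exp (\<Sum>i<n. \<Sum>j<n. a i * U $$ (i, j) * b j))"
    unfolding inv ..
  also have "\<dots> = (LINT U|M. exp (\<Sum>i<n. \<Sum>j<n. a i * (Q * U) $$ (i, j) * b j))"
    by (rule integral_distr[OF measurable_orthogonal_mult[OF M Q(1)] meas])
  also have "\<dots> = (LINT U|M. exp (\<Sum>i<n. \<Sum>j<n. a' i * U $$ (i, j) * b j))"
  proof (rule Bochner_Integration.integral_cong[OF refl])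
    fix U assume "U \<in> space M"
    then have c: "U \<in> carrier_mat n n" "Q \<in> carrier_mat n n" using Q(1) sp unfolding orthogonal_group_def by auto
    have "(\<Sum>i<n. \<Sum>j<n. a i * (Q * U) $$ (i, j) * b j) = (\<Sum>i<n. \<Sum>j<n. \<Sum>l<n. a i * Q $$ (i, l) * (U $$ (l, j) * b j))"
      using mult_mat_entry[OF c(2,1)] by (simp add: sum_distrib_left sum_distrib_right mult_ac)
    also have "\<dots> = (\<Sum>i<n. \<Sum>l<n. \<Sum>j<n. a i * Q $$ (i, l) * (U $$ (l, j) * b j))"
      by (intro sum.cong refl sum.swap)
    also have "\<dots> = (\<Sum>l<n. \<Sum>i<n. \<Sum>j<n. a i * Q $$ (i, l) * (U $$ (l, j) * b j))"
      by (rule sum.swap)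
    also have "\<dots> = (\<Sum>l<n. (\<Sum>i<n. a i * Q $$ (i, l)) * (\<Sum>j<n. U $$ (l, j) * b j))"
      by (simp add: sum_product)
    also have "\<dots> = (\<Sum>l<n. \<Sum>j<n. a' l * U $$ (l, j) * b j)"
      using Q(2) by (simp add: sum_distrib_left mult.assoc)
    finally show "exp (\<Sum>i<n. \<Sum>j<n. a i * (Q * U) $$ (i, j) * b j) = exp (\<Sum>i<n. \<Sum>j<n. a' i * U $$ (i, j) * b j)" by simp
  qed
  finally show ?thesis .
qed

text \<open>By left invariance \<open>a\<close> may be replaced by any vector of the same length, hence by an average
  over the sign vectors of that length.\<close>

lemma haar_exp_bilinear_le:
  assumes M: "haar_orthogonal n M" and n: "n > 0"
  shows "(LINT U|M. exp (\<Sum>i<n. \<Sum>j<n. a i * U $$ (i, j) * b j))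
           \<le> exp ((\<Sum>i<n. (a i)\<^sup>2) * (\<Sum>j<n. (b j)\<^sup>2) / (2 * real n))"
proof -
  \<comment> \<open>The scale at which a sign vector has the length of \<open>a\<close>.\<close>
  define s where "s = sqrt ((\<Sum>i<n. (a i)\<^sup>2) / real n)"
  have s2: "s\<^sup>2 = (\<Sum>i<n. (a i)\<^sup>2) / real n" unfolding s_def by (simp add: sum_nonneg)
  interpret prob_space M using M unfolding haar_orthogonal_def by auto
  have sp: "space M = orthogonal_group n" using M unfolding haar_orthogonal_def by auto
  have "(LINT U|M. exp (\<Sum>i<n. \<Sum>j<n. a i * U $$ (i, j) * b j))
      = cube_avg {..<n} (\<lambda>e. LINT U|M. exp (\<Sum>i<n. \<Sum>j<n. a i * U $$ (i, j) * b j))"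
    by simp
  also have "\<dots> = cube_avg {..<n} (\<lambda>e. LINT U|M. exp (\<Sum>i<n. \<Sum>j<n. (s * e i) * U $$ (i, j) * b j))"
  proof (rule cube_avg_cong)
    fix e assume e: "e \<in> sign_inputs {..<n}"
    have "(\<Sum>i<n. (s * e i)\<^sup>2) = (\<Sum>i<n. s\<^sup>2)"
      using sign_inputs_square[OF e] by (intro sum.cong refl) (simp add: power2_eq_square algebra_simps)
    also have "\<dots> = (\<Sum>i<n. (a i)\<^sup>2)" unfolding s2 using n by simp
    finally show "(LINT U|M. exp (\<Sum>i<n. \<Sum>j<n. a i * U $$ (i, j) * b j)) = (LINT U|M. exp (\<Sum>i<n. \<Sum>j<n. (s * e i) * U $$ (i, j) * b j))"
      by (intro haar_exp_bilinear_invariant[OF M]) simp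
  qed
  also have "\<dots> = (LINT U|M. cube_avg {..<n} (\<lambda>e. exp (\<Sum>i<n. \<Sum>j<n. (s * e i) * U $$ (i, j) * b j)))"
    unfolding cube_avg_def
    by (subst integral_divide_zero, subst Bochner_Integration.integral_sum) (auto intro: integrable_exp_bilinear[OF M])
  also have "\<dots> \<le> (LINT U|M. exp ((\<Sum>i<n. (a i)\<^sup>2) * (\<Sum>j<n. (b j)\<^sup>2) / (2 * real n)))"
  proof (rule integral_mono)
    show "integrable M (\<lambda>U. cube_avg {..<n} (\<lambda>e. exp (\<Sum>i<n. \<Sum>j<n. (s * e i) * U $$ (i, j) * b j)))"
      unfolding cube_avg_def
      by (intro integrable_divide_zero Bochner_Integration.integrable_sum) (auto intro: integrable_exp_bilinear[OF M])
    fix U assume "U \<in> space M"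
    then have U: "U \<in> orthogonal_group n" using sp by simp
    define c where "c i = (\<Sum>j<n. b j * U $$ (i, j))" for i
    have c2: "(\<Sum>i<n. (c i)\<^sup>2) = (\<Sum>j<n. (b j)\<^sup>2)"
      using sum_combination_square[OF orthogonal_group_columns[OF U], of "{}" "{..<n}" "\<lambda>_. 0" b]
      unfolding c_def by simp
    have "(\<Sum>i<n. \<Sum>j<n. (s * e i) * U $$ (i, j) * b j) = (\<Sum>i<n. (s * c i) * e i)" for e
      unfolding c_def by (simp add: sum_distrib_left sum_distrib_right mult_ac)
    then have "cube_avg {..<n} (\<lambda>e. exp (\<Sum>i<n. \<Sum>j<n. (s * e i) * U $$ (i, j) * b j)) = (\<Prod>i<n. cosh (s * c i))"
      by (simp only: cube_avg_exp finite_lessThan)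
    also have "\<dots> \<le> (\<Prod>i<n. exp ((s * c i)\<^sup>2 / 2))"
      by (intro prod_mono conjI cosh_le_exp_half_square) simp
    also have "\<dots> = exp (s\<^sup>2 * (\<Sum>i<n. (c i)\<^sup>2) / 2)"
      by (simp add: exp_sum[symmetric] power_mult_distrib sum_distrib_left sum_divide_distrib)
    finally show "cube_avg {..<n} (\<lambda>e. exp (\<Sum>i<n. \<Sum>j<n. (s * e i) * U $$ (i, j) * b j))
        \<le> exp ((\<Sum>i<n. (a i)\<^sup>2) * (\<Sum>j<n. (b j)\<^sup>2) / (2 * real n))"
      unfolding c2 s2 by (simp add: mult.commute)
  qed simp
  also have "\<dots> = exp ((\<Sum>i<n. (a i)\<^sup>2) * (\<Sum>j<n. (b j)\<^sup>2) / (2 * real n))"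
    by (simp add: prob_space)
  finally show ?thesis .
qed

lemma bilinear_restrict:
  fixes U :: "nat \<Rightarrow> nat \<Rightarrow> real"
  assumes "S \<subseteq> {..<n}" "T \<subseteq> {..<n}"
  shows "(\<Sum>i<n. \<Sum>j<n. (if i \<in> S then a i else 0) * U i j * (if j \<in> T then b j else 0))
       = (\<Sum>i\<in>S. \<Sum>j\<in>T. a i * U i j * b j)"
proof (rule sum.mono_neutral_cong_right)
  show "(\<Sum>j<n. (if i \<in> S then a i else 0) * U i j * (if j \<in> T then b j else 0)) = (\<Sum>j\<in>T. a i * U i j * b j)"
    if "i \<in> S" for i
    by (rule sum.mono_neutral_cong_right) (use assms that in auto)
qed (use assms in auto)

lemma sum_square_restrict:
  fixes a :: "nat \<Rightarrow> real"
  assumes "S \<subseteq> {..<n}"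
  shows "(\<Sum>i<n. (if i \<in> S then a i else 0)\<^sup>2) = (\<Sum>i\<in>S. (a i)\<^sup>2)"
  by (rule sum.mono_neutral_cong_right) (use assms in auto)

lemma haar_exp_restricted:
  assumes M: "haar_orthogonal n M" and n: "n > 0" and S: "S \<subseteq> {..<n}" and T: "T \<subseteq> {..<n}"
  shows "integrable M (\<lambda>U. exp (\<Sum>i\<in>S. \<Sum>j\<in>T. a i * U $$ (i, j) * b j))"
    and "(LINT U|M. exp (\<Sum>i\<in>S. \<Sum>j\<in>T. a i * U $$ (i, j) * b j))
           \<le> exp ((\<Sum>i\<in>S. (a i)\<^sup>2) * (\<Sum>j\<in>T. (b j)\<^sup>2) / (2 * real n))"
  using integrable_exp_bilinear[OF M, of "\<lambda>i. if i \<in> S then a i else 0" "\<lambda>j. if j \<in> T then b j else 0"]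
    haar_exp_bilinear_le[OF M n, of "\<lambda>i. if i \<in> S then a i else 0" "\<lambda>j. if j \<in> T then b j else 0"]
  unfolding bilinear_restrict[OF S T] sum_square_restrict[OF S] sum_square_restrict[OF T] .

lemma sum_scaled_signs:
  assumes "e \<in> sign_inputs S"
  shows "(\<Sum>i\<in>S. (\<tau> * e i)\<^sup>2) = \<tau>\<^sup>2 * real (card S)"
proof -
  have "(\<Sum>i\<in>S. (\<tau> * e i)\<^sup>2) = (\<Sum>i\<in>S. \<tau>\<^sup>2)"
    using sign_inputs_square[OF assms] by (intro sum.cong refl) (simp add: power2_eq_square algebra_simps)
  then show ?thesis by simp
qed

text \<open>A product of cosh is an average of exponentials over signs, so the joint behaviour of
  many rows is covered by the bound for a single bilinear form.\<close>

lemma haar_prod_cosh_rows: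
  assumes M: "haar_orthogonal n M" and n: "n > 0" and S: "S \<subseteq> {..<n}" and T: "T \<subseteq> {..<n}"
  shows "integrable M (\<lambda>U. \<Prod>i\<in>S. cosh (\<tau> * (\<Sum>j\<in>T. U $$ (i, j) * h j)))"
    and "(LINT U|M. (\<Prod>i\<in>S. cosh (\<tau> * (\<Sum>j\<in>T. U $$ (i, j) * h j))))
           \<le> exp (\<tau>\<^sup>2 * real (card S) * (\<Sum>j\<in>T. (h j)\<^sup>2) / (2 * real n))"
proof -
  have fin: "finite S" using S finite_subset by auto
  have eq: "(\<Prod>i\<in>S. cosh (\<tau> * (\<Sum>j\<in>T. U $$ (i, j) * h j)))
      = cube_avg S (\<lambda>e. exp (\<Sum>i\<in>S. \<Sum>j\<in>T. (\<tau> * e i) * U $$ (i, j) * h j))" for U :: "real mat"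
  proof -
    have "(\<Sum>i\<in>S. (\<tau> * (\<Sum>j\<in>T. U $$ (i, j) * h j)) * e i) = (\<Sum>i\<in>S. \<Sum>j\<in>T. (\<tau> * e i) * U $$ (i, j) * h j)" for e
      by (simp add: sum_distrib_left sum_distrib_right mult_ac)
    then show ?thesis unfolding cube_avg_exp[OF fin, symmetric] by simp
  qed
  show "integrable M (\<lambda>U. \<Prod>i\<in>S. cosh (\<tau> * (\<Sum>j\<in>T. U $$ (i, j) * h j)))"
    unfolding eq cube_avg_def
    by (intro integrable_divide_zero Bochner_Integration.integrable_sum haar_exp_restricted(1)[OF M n S T])
  have "(LINT U|M. (\<Prod>i\<in>S. cosh (\<tau> * (\<Sum>j\<in>T. U $$ (i, j) * h j))))
      = cube_avg S (\<lambda>e. LINT U|M. exp (\<Sum>i\<in>S. \<Sum>j\<in>T. (\<tau> * e i) * U $$ (i, j) * h j))"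
    unfolding eq cube_avg_def
    by (subst integral_divide_zero, subst Bochner_Integration.integral_sum) (auto intro: haar_exp_restricted(1)[OF M n S T])
  also have "\<dots> \<le> cube_avg S (\<lambda>e. exp (\<tau>\<^sup>2 * real (card S) * (\<Sum>j\<in>T. (h j)\<^sup>2) / (2 * real n)))"
  proof (rule cube_avg_mono)
    fix e assume e: "e \<in> sign_inputs S"
    show "(LINT U|M. exp (\<Sum>i\<in>S. \<Sum>j\<in>T. (\<tau> * e i) * U $$ (i, j) * h j))
        \<le> exp (\<tau>\<^sup>2 * real (card S) * (\<Sum>j\<in>T. (h j)\<^sup>2) / (2 * real n))"
      using haar_exp_restricted(2)[OF M n S T, where a = "\<lambda>i. \<tau> * e i" and b = h]
      unfolding sum_scaled_signs[OF e] .
  qed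
  also have "\<dots> = exp (\<tau>\<^sup>2 * real (card S) * (\<Sum>j\<in>T. (h j)\<^sup>2) / (2 * real n))"
    using fin by simp
  finally show "(LINT U|M. (\<Prod>i\<in>S. cosh (\<tau> * (\<Sum>j\<in>T. U $$ (i, j) * h j))))
           \<le> exp (\<tau>\<^sup>2 * real (card S) * (\<Sum>j\<in>T. (h j)\<^sup>2) / (2 * real n))" .
qed

text \<open>The bound for bilinear forms treats both vectors alike, so left invariance of the
  measure controls the columns as well.\<close>

lemma haar_prod_cosh_columns:
  assumes M: "haar_orthogonal n M" and n: "n > 0" and S: "S \<subseteq> {..<n}" and T: "T \<subseteq> {..<n}"
  shows "integrable M (\<lambda>U. \<Prod>i\<in>S. cosh (\<tau> * (\<Sum>j\<in>T. U $$ (j, i) * h j)))"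
    and "(LINT U|M. (\<Prod>i\<in>S. cosh (\<tau> * (\<Sum>j\<in>T. U $$ (j, i) * h j))))
           \<le> exp (\<tau>\<^sup>2 * real (card S) * (\<Sum>j\<in>T. (h j)\<^sup>2) / (2 * real n))"
proof -
  have fin: "finite S" using S finite_subset by auto
  have eq: "(\<Prod>i\<in>S. cosh (\<tau> * (\<Sum>j\<in>T. U $$ (j, i) * h j)))
      = cube_avg S (\<lambda>e. exp (\<Sum>j\<in>T. \<Sum>i\<in>S. h j * U $$ (j, i) * (\<tau> * e i)))" for U :: "real mat"
  proof -
    have "(\<Sum>i\<in>S. (\<tau> * (\<Sum>j\<in>T. U $$ (j, i) * h j)) * e i) = (\<Sum>j\<in>T. \<Sum>i\<in>S. h j * U $$ (j, i) * (\<tau> * e i))" for e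
      by (rule trans[OF _ sum.swap]) (simp add: sum_distrib_left sum_distrib_right mult_ac)
    then show ?thesis unfolding cube_avg_exp[OF fin, symmetric] by simp
  qed
  show "integrable M (\<lambda>U. \<Prod>i\<in>S. cosh (\<tau> * (\<Sum>j\<in>T. U $$ (j, i) * h j)))"
    unfolding eq cube_avg_def
    by (intro integrable_divide_zero Bochner_Integration.integrable_sum haar_exp_restricted(1)[OF M n T S])
  have "(LINT U|M. (\<Prod>i\<in>S. cosh (\<tau> * (\<Sum>j\<in>T. U $$ (j, i) * h j))))
      = cube_avg S (\<lambda>e. LINT U|M. exp (\<Sum>j\<in>T. \<Sum>i\<in>S. h j * U $$ (j, i) * (\<tau> * e i)))"
    unfolding eq cube_avg_def
    by (subst integral_divide_zero, subst Bochner_Integration.integral_sum) (auto intro: haar_exp_restricted(1)[OF M n T S])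
  also have "\<dots> \<le> cube_avg S (\<lambda>e. exp (\<tau>\<^sup>2 * real (card S) * (\<Sum>j\<in>T. (h j)\<^sup>2) / (2 * real n)))"
  proof (rule cube_avg_mono)
    fix e assume e: "e \<in> sign_inputs S"
    show "(LINT U|M. exp (\<Sum>j\<in>T. \<Sum>i\<in>S. h j * U $$ (j, i) * (\<tau> * e i)))
        \<le> exp (\<tau>\<^sup>2 * real (card S) * (\<Sum>j\<in>T. (h j)\<^sup>2) / (2 * real n))"
      using haar_exp_restricted(2)[OF M n T S, where a = h and b = "\<lambda>i. \<tau> * e i"]
      unfolding sum_scaled_signs[OF e] by (simp only: mult_ac)
  qed
  also have "\<dots> = exp (\<tau>\<^sup>2 * real (card S) * (\<Sum>j\<in>T. (h j)\<^sup>2) / (2 * real n))"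
    using fin by simp
  finally show "(LINT U|M. (\<Prod>i\<in>S. cosh (\<tau> * (\<Sum>j\<in>T. U $$ (j, i) * h j))))
           \<le> exp (\<tau>\<^sup>2 * real (card S) * (\<Sum>j\<in>T. (h j)\<^sup>2) / (2 * real n))" .
qed

section \<open>Flatness of all blocks at once\<close>

definition block_scale :: "nat \<Rightarrow> nat \<Rightarrow> real" where
  "block_scale n s = sqrt (real n * ln (real n) / real s)"

definition cosh_profile ::
  "nat \<Rightarrow> (nat \<Rightarrow> nat \<Rightarrow> real) \<Rightarrow> nat set \<Rightarrow> nat set \<Rightarrow> (nat \<Rightarrow> real) \<Rightarrow> real" where
  "cosh_profile n V S T h = (\<Prod>i\<in>S. cosh (block_scale n (card S) * (\<Sum>j\<in>T. V i j * h j)))"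

text \<open>The exponent is \<open>9 = 5 + 4\<close>: the mean of a profile is at most
  \<open>n ^ (5 s)\<close> for \<open>s = card S\<close>, and \<open>n ^ (4 s)\<close> is the room
  for a union over all \<open>S\<close>, \<open>T\<close> and \<open>h\<close>.\<close>

definition flat_matrix :: "nat \<Rightarrow> (nat \<Rightarrow> nat \<Rightarrow> real) \<Rightarrow> bool" where
  "flat_matrix n V \<longleftrightarrow> (\<forall>S T h. S \<subseteq> {..<n} \<longrightarrow> S \<noteq> {} \<longrightarrow> T \<subseteq> {..<n} \<longrightarrow> card T \<le> card S \<longrightarrow>
     h \<in> T \<rightarrow>\<^sub>E wave_freqs \<longrightarrow> cosh_profile n V S T h \<le> real n ^ (9 * card S))"

lemma sum_pow_card:
  fixes c :: real
  assumes "finite A"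
  shows "(\<Sum>S\<in>Pow A. c ^ card S) = (1 + c) ^ card A"
  using prod_add[OF assms, of "\<lambda>_. c" "\<lambda>_. 1"] by (simp add: add.commute)

lemma sum_wave_freqs_square_le:
  assumes "finite T" "h \<in> T \<rightarrow>\<^sub>E wave_freqs"
  shows "(\<Sum>j\<in>T. (h j)\<^sup>2) \<le> 9 * real (card T)"
proof -
  have "(h j)\<^sup>2 \<le> 9" if "j \<in> T" for j
    using PiE_mem[OF assms(2) that] unfolding wave_freqs_def by auto
  then have "(\<Sum>j\<in>T. (h j)\<^sup>2) \<le> (\<Sum>j\<in>T. 9)" by (rule sum_mono)
  then show ?thesis by simp
qed

text \<open>\<open>block_scale\<close> is chosen such that the subgaussian bound becomes a power of
  \<open>n\<close> with exponent proportional to \<open>card S\<close>. Frequencies are at most 3 in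
  absolute value, which gives \<open>9/2\<close> per element, rounded up to 5.\<close>

lemma block_scale_mean_le:
  assumes n: "n > 0" and S: "finite S" "S \<noteq> {}" and T: "finite T" "card T \<le> card S" and h: "h \<in> T \<rightarrow>\<^sub>E wave_freqs"
  shows "exp ((block_scale n (card S))\<^sup>2 * real (card S) * (\<Sum>j\<in>T. (h j)\<^sup>2) / (2 * real n)) \<le> real n ^ (5 * card S)"
proof -
  have s: "real (card S) > 0" using S by (simp add: card_gt_0_iff)
  have ln: "ln (real n) \<ge> 0" using n by simp
  have b: "(block_scale n (card S))\<^sup>2 = real n * ln (real n) / real (card S)"
    unfolding block_scale_def using n ln by simp
  have "(block_scale n (card S))\<^sup>2 * real (card S) * (\<Sum>j\<in>T. (h j)\<^sup>2) / (2 * real n) = ln (real n) * (\<Sum>j\<in>T. (h j)\<^sup>2) / 2"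
    unfolding b using s n by simp
  also have "\<dots> \<le> ln (real n) * (10 * real (card S)) / 2"
    using sum_wave_freqs_square_le[OF T(1) h] T(2) ln
    by (intro divide_right_mono mult_left_mono) auto
  also have "\<dots> = real (5 * card S) * ln (real n)" by simp
  finally have "exp ((block_scale n (card S))\<^sup>2 * real (card S) * (\<Sum>j\<in>T. (h j)\<^sup>2) / (2 * real n)) \<le> exp (real (5 * card S) * ln (real n))"
    by simp
  also have "\<dots> = real n ^ (5 * card S)"
    using n by (simp only: exp_of_nat_mult) simp
  finally show ?thesis .
qed

text \<open>With \<open>c = n^(-2)\<close> the slack pays a factor \<open>c\<close> for each element
  of \<open>S\<close> and of \<open>T\<close>; the four frequencies per element of \<open>T\<close>
  turn the latter into \<open>4 c\<close>. The sums over subsets become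
  \<open>(1 + c)^n - 1 = O(1/n)\<close> and \<open>(1 + 4 c)^n = O(1)\<close>.\<close>

lemma sum_profiles_le:
  assumes n: "n > 0"
  shows "(\<Sum>S\<in>Pow {..<n} - {{}}. \<Sum>T | T \<subseteq> {..<n} \<and> card T \<le> card S. \<Sum>h\<in>T \<rightarrow>\<^sub>E wave_freqs.
      2 * real n ^ (5 * card S) / real n ^ (9 * card S)) \<le> 4 * exp 4 / real n"
proof -
  define c where "c = 1 / (real n)\<^sup>2"
  have c: "c > 0" "c \<le> 1" unfolding c_def using n by (auto simp: power_le_one_iff)
  have nc: "real n * c = 1 / real n" unfolding c_def using n by (simp add: power2_eq_square)
  have cardF: "card wave_freqs = 4" unfolding wave_freqs_def by simp
  have term_le: "(\<Sum>h\<in>T \<rightarrow>\<^sub>E wave_freqs. 2 * real n ^ (5 * card S) / real n ^ (9 * card S)) \<le> 2 * c ^ card S * (4 * c) ^ card T"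
    if "T \<subseteq> {..<n}" "card T \<le> card S" for S T
  proof -
    have fin: "finite T" using that finite_subset by auto
    have "real n ^ (9 * card S) = real n ^ (5 * card S) * real n ^ (4 * card S)"
      by (simp add: power_add[symmetric])
    then have "2 * real n ^ (5 * card S) / real n ^ (9 * card S) = 2 * (1 / real n ^ (4 * card S))"
      using n by simp
    also have "1 / real n ^ (4 * card S) = c ^ card S * c ^ card S"
      unfolding c_def by (simp add: power_divide power_mult[symmetric] power_add[symmetric])
    also have "\<dots> \<le> c ^ card S * c ^ card T"
      using c that by (intro mult_left_mono power_decreasing) auto
    finally have "2 * real n ^ (5 * card S) / real n ^ (9 * card S) \<le> 2 * (c ^ card S * c ^ card T)" by simp
    then have "(\<Sum>h\<in>T \<rightarrow>\<^sub>E wave_freqs. 2 * real n ^ (5 * card S) / real n ^ (9 * card S))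
        \<le> (\<Sum>h\<in>T \<rightarrow>\<^sub>E wave_freqs. 2 * (c ^ card S * c ^ card T))"
      by (rule sum_mono)
    also have "\<dots> = 2 * c ^ card S * (4 * c) ^ card T"
      using fin by (simp add: card_PiE cardF power_mult_distrib)
    finally show ?thesis .
  qed
  have "(\<Sum>S\<in>Pow {..<n} - {{}}. \<Sum>T | T \<subseteq> {..<n} \<and> card T \<le> card S. \<Sum>h\<in>T \<rightarrow>\<^sub>E wave_freqs.
      2 * real n ^ (5 * card S) / real n ^ (9 * card S))
     \<le> (\<Sum>S\<in>Pow {..<n} - {{}}. \<Sum>T\<in>Pow {..<n}. 2 * c ^ card S * (4 * c) ^ card T)"
  proof (rule sum_mono)
    fix S
    have "(\<Sum>T | T \<subseteq> {..<n} \<and> card T \<le> card S. \<Sum>h\<in>T \<rightarrow>\<^sub>E wave_freqs. 2 * real n ^ (5 * card S) / real n ^ (9 * card S))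
        \<le> (\<Sum>T | T \<subseteq> {..<n} \<and> card T \<le> card S. 2 * c ^ card S * (4 * c) ^ card T)"
      by (rule sum_mono) (use term_le in auto)
    also have "\<dots> \<le> (\<Sum>T\<in>Pow {..<n}. 2 * c ^ card S * (4 * c) ^ card T)"
      using c by (intro sum_mono2) auto
    finally show "(\<Sum>T | T \<subseteq> {..<n} \<and> card T \<le> card S. \<Sum>h\<in>T \<rightarrow>\<^sub>E wave_freqs. 2 * real n ^ (5 * card S) / real n ^ (9 * card S))
       \<le> (\<Sum>T\<in>Pow {..<n}. 2 * c ^ card S * (4 * c) ^ card T)" .
  qed
  also have "\<dots> = 2 * (\<Sum>S\<in>Pow {..<n} - {{}}. c ^ card S) * (\<Sum>T\<in>Pow {..<n}. (4 * c) ^ card T)"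
    by (simp add: sum_distrib_left[symmetric] sum_distrib_right[symmetric])
  also have "(\<Sum>T\<in>Pow {..<n}. (4 * c) ^ card T) = (1 + 4 * c) ^ n"
    using sum_pow_card[of "{..<n}" "4 * c"] by (simp only: finite_lessThan card_lessThan simp_thms)
  also have "(\<Sum>S\<in>Pow {..<n} - {{}}. c ^ card S) = (1 + c) ^ n - 1"
    by (subst sum_diff1) (auto simp: sum_pow_card)
  also have "2 * ((1 + c) ^ n - 1) * (1 + 4 * c) ^ n \<le> 2 * (2 / real n) * exp 4"
  proof (intro mult_mono)
    have "(1 + c) ^ n \<le> exp c ^ n" using c by (intro power_mono) auto
    also have "\<dots> = exp (1 / real n)" by (simp add: exp_of_nat_mult[symmetric] nc)
    also have "\<dots> \<le> 1 + 1 / real n + (1 / real n)\<^sup>2" by (rule exp_bound) (use n in auto)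
    also have "\<dots> \<le> 1 + 1 / real n + 1 / real n"
      using n by (simp add: power2_eq_square field_simps)
    finally show "(1 + c) ^ n - 1 \<le> 2 / real n" by simp
    have "(1 + 4 * c) ^ n \<le> exp (4 * c) ^ n" using c by (intro power_mono) auto
    also have "\<dots> = exp (4 * (real n * c))" by (simp add: exp_of_nat_mult[symmetric] mult_ac)
    also have "\<dots> \<le> exp 4" unfolding nc using n by (simp add: divide_le_eq)
    finally show "(1 + 4 * c) ^ n \<le> exp 4" .
  qed (use c in \<open>auto intro: one_le_power\<close>)
  finally show ?thesis by simp
qed

text \<open>Markov's inequality, applied once to the sum of all normalized profiles. The good event
  is defined through this measurable sum, and flatness is read off from it.\<close>

theorem haar_flat:
  assumes M: "haar_orthogonal n M" and n: "n > 0"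
  obtains G where "G \<in> sets M" "measure M G \<ge> 1 - 4 * exp 4 / real n"
    and "\<And>U. U \<in> G \<Longrightarrow> flat_matrix n (entries U) \<and> flat_matrix n (\<lambda>i j. entries U j i)"
proof -
  interpret prob_space M using M unfolding haar_orthogonal_def by auto
  define N where "N S = real n ^ (9 * card S)" for S :: "nat set"
  define TT where "TT S = {T. T \<subseteq> {..<n} \<and> card T \<le> card S}" for S :: "nat set"
  define X where "X S T h U = (cosh_profile n (entries U) S T h + cosh_profile n (\<lambda>i j. entries U j i) S T h) / N S" for S T h U
  define \<Psi> where "\<Psi> U = (\<Sum>S\<in>Pow {..<n} - {{}}. \<Sum>T\<in>TT S. \<Sum>h\<in>T \<rightarrow>\<^sub>E wave_freqs. X S T h U)" for U
  have Npos: "N S > 0" for S unfolding N_def using n by simp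
  have prof: "cosh_profile n V S T h \<ge> 0" for V S T h unfolding cosh_profile_def by (intro prod_nonneg) simp
  have Xpos: "X S T h U \<ge> 0" for S T h U unfolding X_def using prof Npos by (simp add: less_imp_le)
  have finT: "finite (TT S)" for S unfolding TT_def by simp
  have finh: "finite (T \<rightarrow>\<^sub>E wave_freqs)" if "T \<in> TT S" for S T
    using that finite_subset unfolding TT_def by (intro finite_PiE) auto
  have intX: "integrable M (X S T h)" if "S \<in> Pow {..<n} - {{}}" "T \<in> TT S" for S T h
    unfolding X_def cosh_profile_def
    using that haar_prod_cosh_rows(1)[OF M n] haar_prod_cosh_columns(1)[OF M n]
    by (intro integrable_divide_zero Bochner_Integration.integrable_add) (auto simp: TT_def)
  have int\<Psi>: "integrable M \<Psi>"
    unfolding \<Psi>_def by (intro Bochner_Integration.integrable_sum intX)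
  have "integral\<^sup>L M \<Psi> = (\<Sum>S\<in>Pow {..<n} - {{}}. LINT U|M. (\<Sum>T\<in>TT S. \<Sum>h\<in>T \<rightarrow>\<^sub>E wave_freqs. X S T h U))"
    unfolding \<Psi>_def by (rule Bochner_Integration.integral_sum) (intro Bochner_Integration.integrable_sum intX)
  also have "\<dots> = (\<Sum>S\<in>Pow {..<n} - {{}}. \<Sum>T\<in>TT S. LINT U|M. (\<Sum>h\<in>T \<rightarrow>\<^sub>E wave_freqs. X S T h U))"
    by (rule sum.cong[OF refl], rule Bochner_Integration.integral_sum) (intro Bochner_Integration.integrable_sum intX)
  also have "\<dots> = (\<Sum>S\<in>Pow {..<n} - {{}}. \<Sum>T\<in>TT S. \<Sum>h\<in>T \<rightarrow>\<^sub>E wave_freqs. integral\<^sup>L M (X S T h))"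
    by (rule sum.cong[OF refl], rule sum.cong[OF refl], rule Bochner_Integration.integral_sum) (rule intX)
  also have "\<dots> \<le> (\<Sum>S\<in>Pow {..<n} - {{}}. \<Sum>T\<in>TT S. \<Sum>h\<in>T \<rightarrow>\<^sub>E wave_freqs. 2 * real n ^ (5 * card S) / N S)"
  proof (intro sum_mono)
    fix S T h assume *: "S \<in> Pow {..<n} - {{}}" "T \<in> TT S" "h \<in> T \<rightarrow>\<^sub>E wave_freqs"
    then have S: "S \<subseteq> {..<n}" "S \<noteq> {}" and T: "T \<subseteq> {..<n}" "card T \<le> card S" unfolding TT_def by auto
    have fin: "finite S" "finite T" using S T finite_subset by auto
    note le = block_scale_mean_le[OF n fin(1) S(2) fin(2) T(2) *(3)]
    have "integral\<^sup>L M (X S T h) = ((LINT U|M. cosh_profile n (entries U) S T h) + (LINT U|M. cosh_profile n (\<lambda>i j. entries U j i) S T h)) / N S"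
      unfolding X_def cosh_profile_def
      using haar_prod_cosh_rows(1)[OF M n S(1) T(1)] haar_prod_cosh_columns(1)[OF M n S(1) T(1)] by simp
    also have "\<dots> \<le> (real n ^ (5 * card S) + real n ^ (5 * card S)) / N S"
      unfolding cosh_profile_def using Npos[of S]
      by (intro divide_right_mono add_mono order_trans[OF haar_prod_cosh_rows(2)[OF M n S(1) T(1)] le]
          order_trans[OF haar_prod_cosh_columns(2)[OF M n S(1) T(1)] le]) simp
    finally show "integral\<^sup>L M (X S T h) \<le> 2 * real n ^ (5 * card S) / N S" by simp
  qed
  also have "\<dots> \<le> 4 * exp 4 / real n"
    unfolding N_def TT_def by (rule sum_profiles_le[OF n])
  finally have mean: "integral\<^sup>L M \<Psi> \<le> 4 * exp 4 / real n" .
  define Bad where "Bad = {U \<in> space M. \<Psi> U \<ge> 1}"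
  have meas\<Psi>: "\<Psi> \<in> borel_measurable M" using int\<Psi> by auto
  have Bad: "Bad \<in> sets M" unfolding Bad_def using meas\<Psi> by measurable
  have "\<Psi> U \<ge> 0" for U unfolding \<Psi>_def by (intro sum_nonneg Xpos)
  then have "measure M Bad \<le> integral\<^sup>L M \<Psi> / 1"
    unfolding Bad_def by (intro integral_Markov_inequality_measure[where A = "{}"] int\<Psi>) auto
  then have "measure M (space M - Bad) \<ge> 1 - 4 * exp 4 / real n"
    using mean prob_compl[OF Bad] by simp
  moreover have "flat_matrix n (entries U) \<and> flat_matrix n (\<lambda>i j. entries U j i)" if "U \<in> space M - Bad" for U
  proof -
    have lt: "\<Psi> U < 1" using that unfolding Bad_def by auto
    have "cosh_profile n (entries U) S T h \<le> N S \<and> cosh_profile n (\<lambda>i j. entries U j i) S T h \<le> N S"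
      if S: "S \<subseteq> {..<n}" "S \<noteq> {}" and T: "T \<subseteq> {..<n}" "card T \<le> card S" and h: "h \<in> T \<rightarrow>\<^sub>E wave_freqs" for S T h
    proof -
      have T': "T \<in> TT S" using T unfolding TT_def by simp
      have "X S T h U \<le> (\<Sum>h\<in>T \<rightarrow>\<^sub>E wave_freqs. X S T h U)"
        using h finh[OF T'] Xpos by (intro member_le_sum) auto
      also have "\<dots> \<le> (\<Sum>T\<in>TT S. \<Sum>h\<in>T \<rightarrow>\<^sub>E wave_freqs. X S T h U)"
        using T' finT Xpos by (intro member_le_sum[of T "TT S" "\<lambda>T. \<Sum>h\<in>T \<rightarrow>\<^sub>E wave_freqs. X S T h U"]) (auto intro: sum_nonneg)
      also have "\<dots> \<le> \<Psi> U"
        unfolding \<Psi>_def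
      proof (rule member_le_sum[of S _ "\<lambda>S. \<Sum>T\<in>TT S. \<Sum>h\<in>T \<rightarrow>\<^sub>E wave_freqs. X S T h U"])
        show "S \<in> Pow {..<n} - {{}}" using S by simp
        show "0 \<le> (\<Sum>T\<in>TT S'. \<Sum>h\<in>T \<rightarrow>\<^sub>E wave_freqs. X S' T h U)" for S'
          by (intro sum_nonneg Xpos)
      qed simp
      finally have "X S T h U < 1" using lt by simp
      then show ?thesis
        unfolding X_def using Npos[of S] prof[of "entries U" S T h] prof[of "\<lambda>i j. entries U j i" S T h]
        by (simp add: divide_less_eq)
    qed
    then show ?thesis unfolding flat_matrix_def N_def by blast
  qed
  ultimately show ?thesis using that[of "space M - Bad"] Bad by blast
qed

section \<open>Decay of the Fourier weights\<close>

text \<open>\<open>3 * exp 20\<close> comes from \<open>flat_prod_sinh\<close>; the remaining 4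
  covers the two factors 2 of \<open>abs_response_sum_le\<close>, charged to the elements of the
  larger set.\<close>

definition flat_const :: real where
  "flat_const = 12 * exp 20"

lemma sinh_le_mult_exp: "sinh y \<le> y * exp y" if "y \<ge> 0" for y :: real
proof -
  have "1 + (- 2 * y) \<le> exp (- 2 * y)" by (rule exp_ge_add_one_self)
  then have "exp y * (1 - exp (- 2 * y)) \<le> exp y * (2 * y)" by (intro mult_left_mono) auto
  moreover have "exp y * exp (- 2 * y) = exp (- y)" by (simp add: exp_add[symmetric])
  ultimately show ?thesis by (simp add: sinh_field_def right_diff_distrib mult_ac)
qed

text \<open>A bound \<open>n ^ (9 s)\<close> on a product of \<open>s\<close> factors \<open>cosh (\<tau> c)\<close> bounds the average of the \<open>\<bar>c\<bar>\<close> by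
  \<open>O (ln n / \<tau>) = O (sqrt (s ln n / n))\<close>.\<close>

lemma flat_prod_sinh:
  assumes V: "flat_matrix n V" and n: "n \<ge> 2" and S: "S \<subseteq> {..<n}" "S \<noteq> {}"
    and T: "T \<subseteq> {..<n}" "card T \<le> card S" and h: "h \<in> T \<rightarrow>\<^sub>E wave_freqs"
    and small: "9 * real (card S) * ln (real n) \<le> real n"
  shows "(\<Prod>i\<in>S. sinh (3 * \<bar>\<Sum>j\<in>T. V i j * h j\<bar>))
           \<le> (3 * exp 20 * sqrt (real (card S) * ln (real n) / real n)) ^ card S"
proof -
  define s where "s = card S"
  define c where "c i = \<bar>\<Sum>j\<in>T. V i j * h j\<bar>" for i
  define L where "L = ln (real n)"
  define \<tau> where "\<tau> = block_scale n s"
  \<comment> \<open>Equals \<open>sqrt (n / (s ln n))\<close>, the inverse of the size wanted for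
    the \<open>c i\<close>. The assumption \<open>small\<close> says that it is at least 3.\<close>
  define \<eta> where "\<eta> = \<tau> / L"
  have fin: "finite S" using S finite_subset by auto
  have s: "s > 0" unfolding s_def using S fin by (simp add: card_gt_0_iff)
  have L2: "ln 2 \<le> L" unfolding L_def using n by simp
  have L: "L > 0" using L2 ln_gt_zero[of 2] by linarith
  have \<tau>2: "\<tau>\<^sup>2 = real n * L / real s" unfolding \<tau>_def block_scale_def L_def[symmetric] using L by simp
  have \<tau>0: "\<tau> > 0" unfolding \<tau>_def block_scale_def L_def[symmetric] using L s n by simp
  have \<eta>0: "\<eta> > 0" unfolding \<eta>_def using \<tau>0 L by simp
  have \<eta>2: "\<eta>\<^sup>2 = real n / (real s * L)"
    unfolding \<eta>_def power_divide \<tau>2 using L by (simp add: power2_eq_square)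
  have "3\<^sup>2 * (real s * L) \<le> real n" using small unfolding s_def L_def by simp
  moreover have sL: "real s * L > 0" using L s by simp
  ultimately have "3\<^sup>2 \<le> \<eta>\<^sup>2" unfolding \<eta>2 by (simp only: pos_le_divide_eq[OF sL])
  then have \<eta>3: "3 \<le> \<eta>" by (rule power2_le_imp_le) (use \<eta>0 in simp)
  have inv: "1 / \<eta> = sqrt (real s * L / real n)"
  proof (rule real_sqrt_unique[symmetric])
    show "(1 / \<eta>)\<^sup>2 = real s * L / real n" unfolding power_divide \<eta>2 by simp
  qed (use \<eta>0 in simp)
  have "(\<Prod>i\<in>S. exp (\<tau> * c i)) \<le> (\<Prod>i\<in>S. 2 * cosh (\<tau> * (\<Sum>j\<in>T. V i j * h j)))"
  proof (intro prod_mono conjI)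
    fix i
    have "exp \<bar>y\<bar> \<le> 2 * cosh y" for y :: real
      unfolding cosh_field_def by (cases "y \<ge> 0") auto
    then have "exp \<bar>\<tau> * (\<Sum>j\<in>T. V i j * h j)\<bar> \<le> 2 * cosh (\<tau> * (\<Sum>j\<in>T. V i j * h j))" .
    then show "exp (\<tau> * c i) \<le> 2 * cosh (\<tau> * (\<Sum>j\<in>T. V i j * h j))"
      unfolding c_def using \<tau>0 by (simp add: abs_mult)
  qed simp
  also have "\<dots> = 2 ^ s * cosh_profile n V S T h"
    unfolding cosh_profile_def s_def \<tau>_def by (simp add: prod.distrib)
  also have "\<dots> \<le> 2 ^ s * real n ^ (9 * s)"
    using V S T h unfolding flat_matrix_def s_def by (intro mult_left_mono) auto
  also have "2 ^ s * real n ^ (9 * s) = exp (real s * ln 2) * exp (real (9 * s) * L)"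
    unfolding L_def exp_of_nat_mult using n by simp
  also have "\<dots> = exp (real s * ln 2 + 9 * real s * L)"
    by (simp add: exp_add)
  also have "\<dots> \<le> exp (10 * real s * L)"
    using mult_left_mono[OF L2, of "real s"] by (simp add: mult.commute)
  finally have "exp (\<Sum>i\<in>S. \<tau> * c i) \<le> exp (10 * real s * L)"
    by (simp add: exp_sum[OF fin])
  then have sum_le: "(\<Sum>i\<in>S. \<tau> * c i) \<le> 10 * real s * L" by simp
  \<comment> \<open>Trading the factor \<open>c i\<close> for
    \<open>exp (\<eta> * c i) / \<eta>\<close> turns the product into the exponential of the sum,
    which \<open>sum_le\<close> controls.\<close>
  have "(\<Prod>i\<in>S. sinh (3 * c i)) \<le> (\<Prod>i\<in>S. 3 / \<eta> * exp (2 * \<eta> * c i))"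
  proof (intro prod_mono conjI)
    fix i
    have c0: "c i \<ge> 0" unfolding c_def by simp
    then show "0 \<le> sinh (3 * c i)" by simp
    have "\<eta> * c i \<le> exp (\<eta> * c i)" using exp_ge_add_one_self[of "\<eta> * c i"] by linarith
    then have 1: "c i \<le> exp (\<eta> * c i) / \<eta>" using \<eta>0 by (simp add: field_simps)
    have 2: "exp (3 * c i) \<le> exp (\<eta> * c i)" using \<eta>3 c0 by (simp add: mult_right_mono)
    have "sinh (3 * c i) \<le> 3 * c i * exp (3 * c i)" using c0 by (intro sinh_le_mult_exp) simp
    also have "\<dots> \<le> 3 * (exp (\<eta> * c i) / \<eta>) * exp (\<eta> * c i)"
      using 1 2 c0 \<eta>0 by (intro mult_mono) auto
    also have "\<dots> = 3 / \<eta> * exp (2 * \<eta> * c i)"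
      by (simp add: exp_add[symmetric])
    finally show "sinh (3 * c i) \<le> 3 / \<eta> * exp (2 * \<eta> * c i)" .
  qed
  also have "\<dots> = (3 / \<eta>) ^ s * exp (2 / L * (\<Sum>i\<in>S. \<tau> * c i))"
    unfolding prod.distrib by (simp add: exp_sum[OF fin, symmetric] s_def \<eta>_def sum_distrib_left mult_ac)
  also have "\<dots> \<le> (3 / \<eta>) ^ s * exp (2 / L * (10 * real s * L))"
  proof (rule mult_left_mono)
    have "2 / L * (\<Sum>i\<in>S. \<tau> * c i) \<le> 2 / L * (10 * real s * L)"
      using L by (intro mult_left_mono sum_le) simp
    then show "exp (2 / L * (\<Sum>i\<in>S. \<tau> * c i)) \<le> exp (2 / L * (10 * real s * L))" by simp
  qed (use \<eta>0 in simp)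
  also have "2 / L * (10 * real s * L) = real s * 20" using L by simp
  also have "exp (real s * 20) = exp 20 ^ s" by (rule exp_of_nat_mult)
  also have "(3 / \<eta>) ^ s * exp 20 ^ s = (3 * exp 20 * (1 / \<eta>)) ^ s"
    by (simp add: power_mult_distrib[symmetric] mult_ac)
  finally show ?thesis unfolding inv c_def s_def L_def .
qed

text \<open>The larger set keeps the product of responses; this takes flatness of \<open>U\<close>
  if it is \<open>S\<close> and of the transpose if it is \<open>T\<close>. The kernel vanishes if
  exactly one set is empty, and the bound is 1 if both are.\<close>

lemma abs_gauss_kernel_le:
  assumes U: "orthonormal_columns n U" and flat: "flat_matrix n U" "flat_matrix n (\<lambda>i j. U j i)"
    and n: "n \<ge> 2" and S: "S \<subseteq> {..<n}" and T: "T \<subseteq> {..<n}"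
    and small: "9 * real (max (card S) (card T)) * ln (real n) \<le> real n"
  shows "\<bar>gauss_kernel n U S T\<bar>
      \<le> (flat_const * sqrt (real (max (card S) (card T)) * ln (real n) / real n)) ^ max (card S) (card T)"
proof -
  have fin: "finite S" "finite T" using S T finite_subset by auto
  have ln: "ln (real n) \<ge> 0" using n by simp
  have conv: "2 ^ (a + b) * (3 * exp 20 * r) ^ a \<le> (flat_const * r) ^ a" if "b \<le> a" "r \<ge> 0" for a b :: nat and r
  proof -
    have "2 ^ (a + b) \<le> (2::real) ^ (a + a)" using that by (intro power_increasing) auto
    also have "\<dots> = 4 ^ a" by (simp add: power_add power_mult_distrib[symmetric])
    finally have "2 ^ (a + b) * (3 * exp 20 * r) ^ a \<le> 4 ^ a * (3 * exp 20 * r) ^ a"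
      using that by (intro mult_right_mono) auto
    also have "\<dots> = (flat_const * r) ^ a"
      unfolding flat_const_def power_mult_distrib[symmetric] by (rule arg_cong[where f = "\<lambda>y. y ^ a"]) simp
    finally show ?thesis .
  qed
  consider "S = {}" "T = {}" | "S = {} \<or> T = {}" "S \<noteq> {} \<or> T \<noteq> {}" | "S \<noteq> {}" "T \<noteq> {}" by blast
  then show ?thesis
  proof cases
    case 1
    then show ?thesis
      using prob_space.prob_space[OF prob_space_gauss_space[of n]] by (simp add: gauss_kernel_def)
  next
    case 2
    then show ?thesis using gauss_kernel_empty[OF U S T] ln
      by (simp add: flat_const_def)
  next
    case 3
    show ?thesis
    proof (cases "card T \<le> card S")
      case True
      then have m: "max (card S) (card T) = card S" by simp
      have "\<bar>gauss_kernel n U S T\<bar> \<le> 2 ^ (card S + card T) * (3 * exp 20 * sqrt (real (card S) * ln (real n) / real n)) ^ card S"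
        unfolding abs_gauss_kernel_eq(1)[OF U S T]
        by (rule abs_response_sum_le[OF fin], rule flat_prod_sinh[OF flat(1) n S 3(1) T True])
          (use small m in auto)
      also have "\<dots> \<le> (flat_const * sqrt (real (card S) * ln (real n) / real n)) ^ card S"
        by (rule conv[OF True]) (use ln in simp)
      finally show ?thesis unfolding m .
    next
      case False
      then have m: "max (card S) (card T) = card T" and le: "card S \<le> card T" by auto
      have "\<bar>gauss_kernel n U S T\<bar> \<le> 2 ^ (card T + card S) * (3 * exp 20 * sqrt (real (card T) * ln (real n) / real n)) ^ card T"
        unfolding abs_gauss_kernel_eq(2)[OF U S T]
        by (rule abs_response_sum_le[OF fin(2,1)], rule flat_prod_sinh[OF flat(2) n T 3(2) S le])
          (use small m in auto)
      also have "\<dots> \<le> (flat_const * sqrt (real (card T) * ln (real n) / real n)) ^ card T"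
        by (rule conv[OF le]) (use ln in simp)
      finally show ?thesis unfolding m .
    qed
  qed
qed

text \<open>Charge each index below \<open>m\<close> to the edge on its right and each index above
  \<open>m\<close> to the edge on its left; no edge is used twice.\<close>

lemma sum_minus_le_sum_max:
  fixes s :: "nat \<Rightarrow> nat"
  assumes "m \<le> K"
  shows "(\<Sum>a\<le>K. s a) \<le> s m + (\<Sum>a<K. max (s a) (s (Suc a)))"
  using assms
proof (induction K arbitrary: m)
  case (Suc K)
  show ?case
  proof (cases "m = Suc K")
    case True
    then show ?thesis using Suc.IH[of K] by simp
  next
    case False
    then show ?thesis using Suc.IH[of m] Suc.prems by simp
  qed
qed simp

text \<open>Average the previous inequality over all \<open>m\<close>. This is the origin of the
  exponent \<open>1 - 1/k\<close>, and slices of equal size attain it.\<close>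

lemma sum_max_adjacent_ge:
  fixes s :: "nat \<Rightarrow> nat"
  shows "K * (\<Sum>a\<le>K. s a) \<le> Suc K * (\<Sum>a<K. max (s a) (s (Suc a)))"
proof -
  have "(\<Sum>m\<le>K. \<Sum>a\<le>K. s a) \<le> (\<Sum>m\<le>K. s m + (\<Sum>a<K. max (s a) (s (Suc a))))"
    by (intro sum_mono sum_minus_le_sum_max) simp
  then show ?thesis by (simp add: sum.distrib)
qed

lemma card_slices:
  assumes "S \<subseteq> {..<Suc K} \<times> {..<n}"
  shows "card S = (\<Sum>a\<le>K. card (slice S a))"
proof -
  have "S = Sigma {..K} (slice S)" using assms unfolding slice_def by auto
  moreover have "finite (slice S m)" for m
    by (rule finite_subset[of _ "{..<n}"]) (use assms in \<open>auto simp: slice_def\<close>)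
  ultimately show ?thesis by (metis card_SigmaI finite_atMost)
qed

text \<open>A link with exactly one empty end has kernel 0, so a set of nonzero weight is empty or
  meets all \<open>K + 1\<close> blocks.\<close>

lemma chain_weight_zero:
  assumes U: "orthonormal_columns n U" and S: "S \<subseteq> {..<Suc K} \<times> {..<n}" "S \<noteq> {}" "card S < Suc K"
  shows "chain_weight K n U S = 0"
proof (rule ccontr)
  assume nz: "chain_weight K n U S \<noteq> 0"
  have sub: "slice S a \<subseteq> {..<n}" for a using S(1) by (auto simp: slice_def)
  have adj: "slice S a = {} \<longleftrightarrow> slice S (Suc a) = {}" if "a < K" for a
  proof -
    have "gauss_kernel n U (slice S a) (slice S (Suc a)) \<noteq> 0"
      using nz that unfolding chain_weight_eq[OF S(1)] by (auto simp: prod_zero_iff)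
    then show ?thesis using gauss_kernel_empty[OF U sub sub] by metis
  qed
  have all: "slice S a = {} \<longleftrightarrow> slice S 0 = {}" if "a \<le> K" for a
    using that by (induction a) (auto simp: adj)
  obtain m v where "(m, v) \<in> S" using S(2) by auto
  then have "m \<le> K" "slice S m \<noteq> {}" using S(1) by (auto simp: slice_def)
  then have ne: "slice S a \<noteq> {}" if "a \<le> K" for a using all that by metis
  have "(\<Sum>a\<le>K. 1) \<le> (\<Sum>a\<le>K. card (slice S a))"
  proof (rule sum_mono)
    fix a assume "a \<in> {..K}"
    then have "slice S a \<noteq> {}" "finite (slice S a)" using ne finite_subset[OF sub] by auto
    then show "1 \<le> card (slice S a)" by (simp add: Suc_le_eq card_gt_0_iff)
  qed
  then show False using S(3) card_slices[OF S(1)] by simp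
qed

text \<open>In the base of each kernel bound the sizes are enlarged to \<open>card S\<close>. The
  common base is at most 1, so the total exponent may be lowered to the value given by
  \<open>sum_max_adjacent_ge\<close>.\<close>

lemma abs_chain_weight_le:
  assumes U: "orthonormal_columns n U" and flat: "flat_matrix n U" "flat_matrix n (\<lambda>i j. U j i)"
    and n: "n \<ge> 2" and S: "S \<subseteq> {..<Suc K} \<times> {..<n}" "S \<noteq> {}"
    and small: "9 * real (card S) * ln (real n) \<le> real n"
    and \<theta>: "flat_const * sqrt (real (card S) * ln (real n) / real n) \<le> 1"
  shows "\<bar>chain_weight K n U S\<bar>
      \<le> (flat_const * sqrt (real (card S) * ln (real n) / real n)) powr (real (card S) * real K / real (Suc K))"
proof -
  define th where "th = flat_const * sqrt (real (card S) * ln (real n) / real n)"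
  define s where "s a = card (slice S a)" for a
  define m where "m a = max (s a) (s (Suc a))" for a
  have sub: "slice S a \<subseteq> {..<n}" for a using S(1) by (auto simp: slice_def)
  have fin: "finite S" using S(1) finite_subset by blast
  have ln: "ln (real n) > 0" using n by simp
  have c0: "real (card S) > 0" using S(2) fin by (simp add: card_gt_0_iff)
  have th0: "th > 0" unfolding th_def flat_const_def using ln c0 n by simp
  have s_le: "s a \<le> card S" if "a \<le> K" for a
    unfolding card_slices[OF S(1)] s_def using that by (intro member_le_sum) auto
  have "\<bar>chain_weight K n U S\<bar> = (\<Prod>a<K. \<bar>gauss_kernel n U (slice S a) (slice S (Suc a))\<bar>)"
    unfolding chain_weight_eq[OF S(1)] abs_prod ..
  also have "\<dots> \<le> (\<Prod>a<K. th ^ m a)"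
  proof (intro prod_mono conjI)
    fix a assume "a \<in> {..<K}"
    then have ms: "m a \<le> card S" unfolding m_def using s_le[of a] s_le[of "Suc a"] by simp
    have "9 * real (m a) * ln (real n) \<le> 9 * real (card S) * ln (real n)"
      using ms ln by (intro mult_right_mono mult_left_mono) auto
    then have "9 * real (m a) * ln (real n) \<le> real n" using small by linarith
    then have "\<bar>gauss_kernel n U (slice S a) (slice S (Suc a))\<bar> \<le> (flat_const * sqrt (real (m a) * ln (real n) / real n)) ^ m a"
      unfolding m_def s_def by (rule abs_gauss_kernel_le[OF U flat n sub sub])
    also have "\<dots> \<le> th ^ m a"
      unfolding th_def flat_const_def using ms ln
      by (intro power_mono mult_left_mono real_sqrt_le_mono divide_right_mono mult_right_mono) auto
    finally show "\<bar>gauss_kernel n U (slice S a) (slice S (Suc a))\<bar> \<le> th ^ m a" .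
  qed simp
  also have "\<dots> = th ^ (\<Sum>a<K. m a)" by (simp add: power_sum)
  also have "\<dots> = th powr real (\<Sum>a<K. m a)" using th0 by (simp only: powr_realpow)
  also have "\<dots> \<le> th powr (real (card S) * real K / real (Suc K))"
  proof (rule powr_mono')
    have "K * card S \<le> Suc K * (\<Sum>a<K. m a)"
      unfolding card_slices[OF S(1)] m_def s_def by (rule sum_max_adjacent_ge)
    then have "real K * real (card S) \<le> real (Suc K) * real (\<Sum>a<K. m a)"
      by (metis of_nat_le_iff of_nat_mult)
    then show "real (card S) * real K / real (Suc K) \<le> real (\<Sum>a<K. m a)"
      by (subst pos_divide_le_eq) (auto simp: mult_ac)
  qed (use th0 \<theta> in \<open>auto simp: th_def\<close>)
  finally show ?thesis unfolding th_def .
qed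

lemma fact_ge_power: "(real l / exp 1) ^ l \<le> fact l"
proof (induction l)
  case (Suc l)
  show ?case
  proof (cases "l = 0")
    case False
    have "(1 + 1 / real l) ^ l \<le> exp (1 / real l) ^ l" using False by (intro power_mono) auto
    also have "\<dots> = exp 1" using False by (simp add: exp_of_nat_mult[symmetric])
    finally have "real l ^ l * (1 + 1 / real l) ^ l \<le> real l ^ l * exp 1" by (intro mult_left_mono) auto
    moreover have "real l * (1 + 1 / real l) = real l + 1" using False by (simp add: distrib_left)
    ultimately have *: "(real l + 1) ^ l \<le> real l ^ l * exp 1"
      by (simp only: power_mult_distrib[symmetric])
    have "real (Suc l) ^ Suc l = real (Suc l) * (real l + 1) ^ l" by (simp add: add.commute)
    then have "(real (Suc l) / exp 1) ^ Suc l = real (Suc l) / exp 1 ^ Suc l * (real l + 1) ^ l"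
      by (simp only: power_divide times_divide_eq_left)
    also have "\<dots> \<le> real (Suc l) / exp 1 ^ Suc l * (real l ^ l * exp 1)"
      using * by (intro mult_left_mono) auto
    also have "\<dots> = real (Suc l) * (real l / exp 1) ^ l" by (simp add: power_divide)
    also have "\<dots> \<le> real (Suc l) * fact l" using Suc by (intro mult_left_mono) auto
    finally show ?thesis by simp
  qed simp
qed simp

section \<open>Majority votes and query complexity\<close>

primrec graft :: "'v dtree \<Rightarrow> 'v dtree \<Rightarrow> 'v dtree \<Rightarrow> 'v dtree" where
  "graft (Leaf b) A B = (if b then A else B)"
| "graft (Query v s t) A B = Query v (graft s A B) (graft t A B)"

lemma dtree_run_graft: "dtree_run (graft t A B) x = (if dtree_run t x then dtree_run A x else dtree_run B x)"
  by (induction t) auto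

lemma dtree_depth_graft: "dtree_depth (graft t A B) \<le> dtree_depth t + max (dtree_depth A) (dtree_depth B)"
  by (induction t) auto

lemma dtree_vars_graft: "dtree_vars (graft t A B) \<subseteq> dtree_vars t \<union> dtree_vars A \<union> dtree_vars B"
  by (induction t) auto

text \<open>\<open>s\<close> is the running difference of votes; a tie at the end yields the answer
  False.\<close>

primrec majority :: "'v dtree list \<Rightarrow> int \<Rightarrow> 'v dtree" where
  "majority [] s = Leaf (s > 0)"
| "majority (t # ts) s = graft t (majority ts (s + 1)) (majority ts (s - 1))"

lemma dtree_run_majority:
  "dtree_run (majority ts s) x \<longleftrightarrow> s + (\<Sum>t\<leftarrow>ts. if dtree_run t x then 1 else -1) > 0"
  by (induction ts arbitrary: s) (auto simp: dtree_run_graft algebra_simps)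

lemma dtree_depth_majority:
  assumes "\<And>t. t \<in> set ts \<Longrightarrow> dtree_depth t \<le> d"
  shows "dtree_depth (majority ts s) \<le> length ts * d"
  using assms
proof (induction ts arbitrary: s)
  case (Cons t ts)
  have "dtree_depth (majority ts s') \<le> length ts * d" for s' using Cons by simp
  then have "max (dtree_depth (majority ts (s + 1))) (dtree_depth (majority ts (s - 1))) \<le> length ts * d" by simp
  moreover have "dtree_depth t \<le> d" using Cons by simp
  ultimately show ?case
    using order_trans[OF dtree_depth_graft[of t "majority ts (s + 1)" "majority ts (s - 1)"] add_mono]
    by simp
qed simp

lemma dtree_vars_majority:
  assumes "\<And>t. t \<in> set ts \<Longrightarrow> dtree_vars t \<subseteq> I"
  shows "dtree_vars (majority ts s) \<subseteq> I"
  using assms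
proof (induction ts arbitrary: s)
  case (Cons t ts)
  have "dtree_vars (majority ts s') \<subseteq> I" for s' using Cons by simp
  moreover have "dtree_vars t \<subseteq> I" using Cons by simp
  ultimately show ?case
    using order_trans[OF dtree_vars_graft[of t "majority ts (s + 1)" "majority ts (s - 1)"]]
    by (simp del: Un_subset_iff add: Un_least)
qed simp

section \<open>Amplification by independent votes\<close>

primrec iid_pmf :: "nat \<Rightarrow> 'a pmf \<Rightarrow> 'a list pmf" where
  "iid_pmf 0 p = return_pmf []"
| "iid_pmf (Suc m) p = bind_pmf p (\<lambda>t. map_pmf ((#) t) (iid_pmf m p))"

lemma set_iid_pmf: "ts \<in> set_pmf (iid_pmf m p) \<Longrightarrow> length ts = m \<and> set ts \<subseteq> set_pmf p"
  by (induction m arbitrary: ts) (simp, auto, blast)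

text \<open>A vote that is right with probability \<open>Q\<close> has exponential moment
  \<open>cosh \<gamma> - (2 Q - 1) sinh \<gamma>\<close>, and \<open>2 Q - 1\<close> is at least
  \<open>2 \<gamma>\<close>. On this range \<open>cosh \<gamma>\<close> is at most
  \<open>1 + \<gamma>^2\<close>, while \<open>sinh \<gamma>\<close> is at least
  \<open>\<gamma>\<close>.\<close>

lemma chernoff_step: "cosh \<gamma> - 2 * \<gamma> * sinh \<gamma> \<le> exp (- (\<gamma>\<^sup>2))" if "0 \<le> \<gamma>" "\<gamma> \<le> 1 / 2" for \<gamma> :: real
proof -
  have g2: "\<gamma>\<^sup>2 \<le> 1 / 4" using power_mono[OF that(2,1), of 2] by (simp add: power2_eq_square)
  have "cosh \<gamma> \<le> exp (\<gamma>\<^sup>2 / 2)" by (rule cosh_le_exp_half_square)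
  also have "\<dots> \<le> 1 + \<gamma>\<^sup>2 / 2 + (\<gamma>\<^sup>2 / 2)\<^sup>2" by (rule exp_bound) (use g2 in auto)
  also have "(\<gamma>\<^sup>2 / 2)\<^sup>2 \<le> \<gamma>\<^sup>2 / 2"
    unfolding power2_eq_square[of "\<gamma>\<^sup>2 / 2"] using g2 by (intro mult_left_le) auto
  finally have 1: "cosh \<gamma> \<le> 1 + \<gamma>\<^sup>2" by simp
  have "\<gamma> \<le> sinh \<gamma>" using real_le_x_sinh[of \<gamma>] that by (simp add: sinh_field_def exp_minus)
  then have "2 * \<gamma> * \<gamma> \<le> 2 * \<gamma> * sinh \<gamma>" using that by (intro mult_left_mono) auto
  then have "cosh \<gamma> - 2 * \<gamma> * sinh \<gamma> \<le> 1 + (- (\<gamma>\<^sup>2))" using 1 by (simp add: power2_eq_square)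
  also have "\<dots> \<le> exp (- (\<gamma>\<^sup>2))" by (rule exp_ge_add_one_self)
  finally show ?thesis .
qed

text \<open>Chernoff's bound by induction on the votes, for every starting score because the first
  vote shifts it. Ties count as failures.\<close>

lemma iid_vote_tail:
  fixes p :: "'a pmf" and Good :: "'a set"
  assumes g: "0 \<le> \<gamma>" "\<gamma> \<le> 1 / 2" and q: "measure_pmf.prob p Good \<ge> 1 / 2 + \<gamma>"
  shows "measure_pmf.prob (iid_pmf m p) {ts. s + (\<Sum>t\<leftarrow>ts. if t \<in> Good then 1 else -1 :: int) \<le> 0}
           \<le> exp (- \<gamma> * real_of_int s) * exp (- (\<gamma>\<^sup>2)) ^ m"
proof (induction m arbitrary: s)
  case 0
  show ?case
  proof (cases "s \<le> 0")
    case True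
    then have "- \<gamma> * real_of_int s \<ge> 0" using g by (simp add: mult_nonneg_nonpos)
    then show ?thesis using measure_pmf.prob_le_1[of "return_pmf []"] by (simp add: measure_return True)
  qed (simp add: measure_return)
next
  case (Suc m)
  define Q where "Q = measure_pmf.prob p Good"
  define \<beta> where "\<beta> = exp (- (\<gamma>\<^sup>2))"
  define W where "W s = measure_pmf.prob (iid_pmf m p) {ts. s + (\<Sum>t\<leftarrow>ts. if t \<in> Good then 1 else -1 :: int) \<le> 0}" for s
  have "measure_pmf.prob (iid_pmf (Suc m) p) {ts. s + (\<Sum>t\<leftarrow>ts. if t \<in> Good then 1 else -1 :: int) \<le> 0}
      = (\<integral>t. measure_pmf.prob (map_pmf ((#) t) (iid_pmf m p)) {ts. s + (\<Sum>t\<leftarrow>ts. if t \<in> Good then 1 else -1 :: int) \<le> 0} \<partial>measure_pmf p)"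
    by (simp add: measure_pmf_bind measure_pmf.measure_bind[where N = "count_space UNIV"] measure_pmf_in_subprob_algebra)
  also have "\<dots> = (\<integral>t. W (s - 1) + (W (s + 1) - W (s - 1)) * indicator Good t \<partial>measure_pmf p)"
  proof (rule Bochner_Integration.integral_cong[OF refl])
    fix t
    have "measure_pmf.prob (map_pmf ((#) t) (iid_pmf m p)) {ts. s + (\<Sum>t\<leftarrow>ts. if t \<in> Good then 1 else -1 :: int) \<le> 0}
        = W (s + (if t \<in> Good then 1 else -1))"
      unfolding W_def by (auto simp: vimage_def add.assoc intro!: arg_cong[where f = "measure_pmf.prob (iid_pmf m p)"])
    then show "measure_pmf.prob (map_pmf ((#) t) (iid_pmf m p)) {ts. s + (\<Sum>t\<leftarrow>ts. if t \<in> Good then 1 else -1 :: int) \<le> 0}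
        = W (s - 1) + (W (s + 1) - W (s - 1)) * indicator Good t"
      by (simp add: indicator_def)
  qed
  also have "\<dots> = W (s - 1) + (W (s + 1) - W (s - 1)) * Q"
    unfolding Q_def by (subst Bochner_Integration.integral_add) (auto simp: measure_pmf.emeasure_eq_measure)
  also have "\<dots> = Q * W (s + 1) + (1 - Q) * W (s - 1)" by (simp add: algebra_simps)
  also have "\<dots> \<le> Q * (exp (- \<gamma> * real_of_int (s + 1)) * \<beta> ^ m) + (1 - Q) * (exp (- \<gamma> * real_of_int (s - 1)) * \<beta> ^ m)"
    unfolding W_def \<beta>_def by (intro add_mono mult_left_mono Suc.IH) (auto simp: Q_def)
  also have "\<dots> = exp (- \<gamma> * real_of_int s) * \<beta> ^ m * (Q * exp (- \<gamma>) + (1 - Q) * exp \<gamma>)"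
  proof -
    have "exp (- \<gamma> * real_of_int (s + 1)) = exp (- \<gamma> * real_of_int s) * exp (- \<gamma>)"
      "exp (- \<gamma> * real_of_int (s - 1)) = exp (- \<gamma> * real_of_int s) * exp \<gamma>"
      by (simp_all add: exp_add[symmetric] algebra_simps)
    then show ?thesis by (simp only:) (simp add: algebra_simps)
  qed
  also have "Q * exp (- \<gamma>) + (1 - Q) * exp \<gamma> = cosh \<gamma> - (2 * Q - 1) * sinh \<gamma>"
    by (simp add: cosh_field_def sinh_field_def field_simps)
  also have "exp (- \<gamma> * real_of_int s) * \<beta> ^ m * (cosh \<gamma> - (2 * Q - 1) * sinh \<gamma>) \<le> exp (- \<gamma> * real_of_int s) * \<beta> ^ m * \<beta>"
  proof (rule mult_left_mono)
    have "2 * \<gamma> * sinh \<gamma> \<le> (2 * Q - 1) * sinh \<gamma>"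
      using q g unfolding Q_def by (intro mult_right_mono) auto
    then show "cosh \<gamma> - (2 * Q - 1) * sinh \<gamma> \<le> \<beta>"
      using chernoff_step[OF g] unfolding \<beta>_def by linarith
  qed (simp add: \<beta>_def)
  finally show ?case unfolding \<beta>_def by (simp add: mult_ac)
qed

lemma randomized_amplification:
  assumes p: "randomized_algorithm I d p" "computes_with_error I p f (1 / 2 - \<gamma>)"
    and g: "0 \<le> \<gamma>" "\<gamma> \<le> 1 / 2" and m: "exp (- (\<gamma>\<^sup>2)) ^ m \<le> \<epsilon>"
  obtains p' where "randomized_algorithm I (m * d) p'" "computes_with_error I p' f \<epsilon>"
proof -
  define p' where "p' = map_pmf (\<lambda>ts. majority ts 0) (iid_pmf m p)"
  have "randomized_algorithm I (m * d) p'"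
    unfolding randomized_algorithm_def
  proof
    fix t assume "t \<in> set_pmf p'"
    then obtain ts where ts: "t = majority ts 0" "ts \<in> set_pmf (iid_pmf m p)" unfolding p'_def by auto
    have l: "length ts = m" "set ts \<subseteq> set_pmf p" using set_iid_pmf[OF ts(2)] by auto
    have "dtree_vars t \<subseteq> I"
      unfolding ts(1) by (rule dtree_vars_majority) (use l p(1) in \<open>auto simp: randomized_algorithm_def\<close>)
    moreover have "dtree_depth t \<le> length ts * d"
      unfolding ts(1) by (rule dtree_depth_majority) (use l p(1) in \<open>auto simp: randomized_algorithm_def\<close>)
    ultimately show "dtree_vars t \<subseteq> I \<and> dtree_depth t \<le> m * d" unfolding l by simp
  qed
  moreover have "computes_with_error I p' f \<epsilon>"
    unfolding computes_with_error_def
  proof (intro ballI allI impI)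
    fix x b assume x: "x \<in> sign_inputs I" and b: "f x = Some b"
    define Good where "Good = {t. dtree_run t x = b}"
    define Fail where "Fail = {ts. 0 + (\<Sum>t\<leftarrow>ts. if t \<in> Good then 1 else -1 :: int) \<le> 0}"
    have "measure_pmf.prob p Good \<ge> 1 / 2 + \<gamma>"
      using p(2) x b unfolding computes_with_error_def Good_def by fastforce
    then have "measure_pmf.prob (iid_pmf m p) Fail \<le> exp (- (\<gamma>\<^sup>2)) ^ m"
      using iid_vote_tail[OF g, of p Good m 0] unfolding Fail_def by simp
    then have "1 - \<epsilon> \<le> measure_pmf.prob (iid_pmf m p) (- Fail)"
      using m measure_pmf.prob_compl[of Fail "iid_pmf m p"] by (simp add: Compl_eq_Diff_UNIV)
    also have "\<dots> \<le> measure_pmf.prob (iid_pmf m p) ((\<lambda>ts. majority ts 0) -` {t. dtree_run t x = b})"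
    proof (rule measure_pmf.finite_measure_mono)
      show "- Fail \<subseteq> (\<lambda>ts. majority ts 0) -` {t. dtree_run t x = b}"
      proof
        fix ts assume "ts \<in> - Fail"
        then have pos: "(\<Sum>t\<leftarrow>ts. if t \<in> Good then 1 else -1 :: int) > 0" unfolding Fail_def by simp
        have "(\<Sum>t\<leftarrow>ts. if t \<in> Good then 1 else -1 :: int) = (if b then 1 else -1) * (\<Sum>t\<leftarrow>ts. if dtree_run t x then 1 else -1)"
          unfolding Good_def by (induction ts) auto
        then show "ts \<in> (\<lambda>ts. majority ts 0) -` {t. dtree_run t x = b}"
          using pos by (cases b) (auto simp: dtree_run_majority)
      qed
    qed simp
    also have "\<dots> = measure_pmf.prob p' {t. dtree_run t x = b}"
      unfolding p'_def by simp
    finally show "1 - \<epsilon> \<le> measure_pmf.prob p' {t. dtree_run t x = b}" .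
  qed
  ultimately show ?thesis using that by blast
qed

section \<open>Query complexity as an attained minimum\<close>

lemma dtree_run_cong_vars:
  assumes "\<And>v. v \<in> dtree_vars t \<Longrightarrow> x v = y v"
  shows "dtree_run t x = dtree_run t y"
  using assms by (induction t) auto

lemma exists_dtree_computing:
  assumes "finite I"
  shows "\<exists>t. dtree_vars t \<subseteq> I \<and> (\<forall>x\<in>sign_inputs I. dtree_run t x = F x)"
  using assms
proof (induction I arbitrary: F rule: finite_induct)
  case empty
  have "sign_inputs {} = {\<lambda>_. undefined :: real}" unfolding sign_inputs_def by (auto simp: PiE_def extensional_def)
  then have "\<forall>x\<in>sign_inputs {}. dtree_run (Leaf (F (\<lambda>_. undefined))) x = F x"
    by (metis dtree_run.simps(1) singletonD)
  then show ?case by (intro exI[of _ "Leaf (F (\<lambda>_. undefined))"]) simp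
next
  case (insert v I)
  obtain s t where s: "dtree_vars s \<subseteq> I" "\<And>y. y \<in> sign_inputs I \<Longrightarrow> dtree_run s y = F (y(v := 1))"
    and t: "dtree_vars t \<subseteq> I" "\<And>y. y \<in> sign_inputs I \<Longrightarrow> dtree_run t y = F (y(v := -1))"
    using insert.IH[of "\<lambda>y. F (y(v := 1))"] insert.IH[of "\<lambda>y. F (y(v := -1))"] by auto
  have "dtree_run (Query v s t) x = F x" if x: "x \<in> sign_inputs (insert v I)" for x
  proof -
    define y where "y = x(v := undefined)"
    have y: "y \<in> sign_inputs I"
      using x insert.hyps unfolding y_def sign_inputs_def by (auto simp: PiE_iff extensional_def)
    have agree: "dtree_run r x = dtree_run r y" if "dtree_vars r \<subseteq> I" for r
      by (rule dtree_run_cong_vars) (use that insert.hyps in \<open>auto simp: y_def\<close>)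
    have "y(v := x v) = x" unfolding y_def by simp
    then show ?thesis
      using sign_inputs_cases[OF x, of v] s(2)[OF y] t(2)[OF y] agree[OF s(1)] agree[OF t(1)] by auto
  qed
  then show ?case using s(1) t(1) by (intro exI[of _ "Query v s t"]) auto
qed

text \<open>\<open>LEAST\<close> returns the cost of an actual algorithm only if one exists; a tree
  that computes \<open>f\<close> exactly provides it for every nonnegative error.\<close>

lemma randomized_query_complexity_ge:
  assumes I: "finite I" and \<epsilon>: "\<epsilon> \<ge> 0"
    and lower: "\<And>d p. randomized_algorithm I d p \<Longrightarrow> computes_with_error I p f \<epsilon> \<Longrightarrow> X \<le> real d"
  shows "X \<le> real (randomized_query_complexity I \<epsilon> f)"
proof -
  obtain t where t: "dtree_vars t \<subseteq> I" "\<And>x. x \<in> sign_inputs I \<Longrightarrow> dtree_run t x = (f x = Some True)"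
    using exists_dtree_computing[OF I, of "\<lambda>x. f x = Some True"] by auto
  have "randomized_algorithm I (dtree_depth t) (return_pmf t)"
    unfolding randomized_algorithm_def using t(1) by simp
  moreover have "computes_with_error I (return_pmf t) f \<epsilon>"
    unfolding computes_with_error_def using t(2) \<epsilon> by (auto simp: measure_return)
  ultimately have "\<exists>d p. randomized_algorithm I d p \<and> computes_with_error I p f \<epsilon>" by blast
  then have "\<exists>p. randomized_algorithm I (randomized_query_complexity I \<epsilon> f) p \<and> computes_with_error I p f \<epsilon>"
    unfolding randomized_query_complexity_def by (rule LeastI_ex)
  then show ?thesis using lower by blast
qed

lemma measure_pmf_dtree_expectation:
  "measure_pmf.prob p {t. dtree_run t x} = (\<integral>t. of_bool (dtree_run t x) \<partial>measure_pmf p)"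
proof -
  have "(\<lambda>t. of_bool (dtree_run t x) :: real) = indicator {t. dtree_run t x}"
    by (auto simp: indicator_def)
  then show ?thesis by (simp add: measure_pmf.emeasure_eq_measure)
qed

text \<open>The advantage is linear in the distribution on trees.\<close>

lemma randomized_advantage_le:
  assumes I: "finite I" and p: "randomized_algorithm I d p"
    and adv: "\<And>t. dtree_vars t \<subseteq> I \<Longrightarrow> dtree_depth t \<le> d \<Longrightarrow>
      \<bar>cube_avg I (\<lambda>x. \<rho> x * of_bool (dtree_run t x)) - cube_avg I (\<lambda>x. of_bool (dtree_run t x))\<bar> \<le> B"
  shows "cube_avg I (\<lambda>x. \<rho> x * measure_pmf.prob p {t. dtree_run t x})
       - cube_avg I (\<lambda>x. measure_pmf.prob p {t. dtree_run t x}) \<le> B"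
proof -
  have int: "integrable (measure_pmf p) (\<lambda>t. of_bool (dtree_run t x) :: real)" for x
    by (rule measure_pmf.integrable_const_bound[where B = 1]) auto
  have "cube_avg I (\<lambda>x. \<rho> x * measure_pmf.prob p {t. dtree_run t x})
       - cube_avg I (\<lambda>x. measure_pmf.prob p {t. dtree_run t x})
     = (\<integral>t. cube_avg I (\<lambda>x. \<rho> x * of_bool (dtree_run t x)) - cube_avg I (\<lambda>x. of_bool (dtree_run t x)) \<partial>measure_pmf p)"
    unfolding measure_pmf_dtree_expectation cube_avg_def
    by (simp add: int Bochner_Integration.integral_sum Bochner_Integration.integral_diff)
  also have "\<dots> \<le> (\<integral>t. B \<partial>measure_pmf p)"
  proof (rule integral_mono_AE)
    show "integrable (measure_pmf p) (\<lambda>t. cube_avg I (\<lambda>x. \<rho> x * of_bool (dtree_run t x)) - cube_avg I (\<lambda>x. of_bool (dtree_run t x)))"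
      unfolding cube_avg_def by (simp add: int)
    show "AE t in measure_pmf p. cube_avg I (\<lambda>x. \<rho> x * of_bool (dtree_run t x)) - cube_avg I (\<lambda>x. of_bool (dtree_run t x)) \<le> B"
      using p adv unfolding AE_measure_pmf_iff randomized_algorithm_def by (meson abs_le_D1)
  qed simp
  finally show ?thesis by simp
qed

section \<open>The lower bound for flat matrices\<close>

lemma alternating_prod_carrier:
  assumes "U \<in> carrier_mat n n"
  shows "alternating_prod n U x m \<in> carrier_mat n n"
  by (induction m) (use assms in \<open>auto intro!: mult_carrier_mat simp: mat_diag_def\<close>)

lemma alternating_prod_column_sum:
  assumes U: "U \<in> carrier_mat n n" and j: "j < n"
  shows "(\<Sum>i<n. alternating_prod n U x m $$ (i, j)) = walk n (entries U) x m j"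
  using j
proof (induction m arbitrary: j)
  case 0
  have "(\<Sum>i<n. alternating_prod n U x 0 $$ (i, j)) = (\<Sum>i<n. if i = j then x (0, j) else 0)"
    by (rule sum.cong) (use 0 in \<open>auto simp: mat_diag_def\<close>)
  then show ?case using 0 by simp
next
  case (Suc m)
  let ?A = "alternating_prod n U x m" and ?D = "mat_diag n (\<lambda>j. x (Suc m, j))"
  have c: "?A \<in> carrier_mat n n" "?A * U \<in> carrier_mat n n" "?D \<in> carrier_mat n n"
    using alternating_prod_carrier[OF U] mult_carrier_mat[OF alternating_prod_carrier[OF U] U] by auto
  have "alternating_prod n U x (Suc m) $$ (i, j) = (\<Sum>l<n. ?A $$ (i, l) * U $$ (l, j)) * x (Suc m, j)" if "i < n" for i
  proof -
    have "(?A * U * ?D) $$ (i, j) = (\<Sum>l<n. (?A * U) $$ (i, l) * ?D $$ (l, j))"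
      by (rule mult_mat_entry[OF c(2,3) that Suc.prems])
    also have "\<dots> = (\<Sum>l<n. if l = j then (?A * U) $$ (i, j) * x (Suc m, j) else 0)"
      by (rule sum.cong) (use Suc.prems in \<open>auto simp: mat_diag_def\<close>)
    also have "\<dots> = (?A * U) $$ (i, j) * x (Suc m, j)" using Suc.prems by simp
    also have "(?A * U) $$ (i, j) = (\<Sum>l<n. ?A $$ (i, l) * U $$ (l, j))"
      by (rule mult_mat_entry[OF c(1) U that Suc.prems])
    finally show ?thesis by simp
  qed
  then have "(\<Sum>i<n. alternating_prod n U x (Suc m) $$ (i, j)) = (\<Sum>i<n. \<Sum>l<n. ?A $$ (i, l) * U $$ (l, j)) * x (Suc m, j)"
    by (simp add: sum_distrib_right)
  also have "(\<Sum>i<n. \<Sum>l<n. ?A $$ (i, l) * U $$ (l, j)) = (\<Sum>l<n. (\<Sum>i<n. ?A $$ (i, l)) * U $$ (l, j))"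
    by (subst sum.swap) (simp add: sum_distrib_right)
  also have "\<dots> = (\<Sum>l<n. walk n (entries U) x m l * U $$ (l, j))"
    using Suc.IH by simp
  finally show ?case by simp
qed

lemma forrelation_eq_chain_form:
  assumes U: "U \<in> carrier_mat n n"
  shows "forrelation n (Suc K) U x = chain_form K n (entries U) x"
proof -
  let ?A = "alternating_prod n U x K"
  have A: "?A \<in> carrier_mat n n" by (rule alternating_prod_carrier[OF U])
  have "Matrix.scalar_prod (ones_vec n) (?A *\<^sub>v ones_vec n) = (\<Sum>i<n. \<Sum>j<n. ?A $$ (i, j))"
    using A unfolding ones_vec_def by (simp add: scalar_prod_def lessThan_atLeast0)
  also have "\<dots> = (\<Sum>j<n. \<Sum>i<n. ?A $$ (i, j))" by (rule sum.swap)
  also have "\<dots> = (\<Sum>j<n. walk n (entries U) x K j)"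
    using alternating_prod_column_sum[OF U] by simp
  finally show ?thesis unfolding forrelation_def chain_form_def by simp
qed

section \<open>Constants and the series over the levels\<close>

definition query_bound :: "nat \<Rightarrow> nat \<Rightarrow> real" where
  "query_bound n k = real n powr (1 - 1 / real k) / ln (real n) powr (2 - 1 / real k)"

text \<open>\<open>368640 = 90 * 64^2\<close>: the 90 collects the constants of the level weights,
  and \<open>64^2\<close> under the square root makes the term of level \<open>l\<close> at most
  \<open>(1/64)^l\<close>.\<close>

definition query_const :: real where
  "query_const = 1 / (368640 * flat_const\<^sup>2)"

lemma flat_const_ge_1: "flat_const \<ge> 1"
proof -
  have "(1::real) \<le> exp 20" by simp
  then show ?thesis unfolding flat_const_def by linarith
qed

lemma query_const_pos: "query_const > 0"
  unfolding query_const_def using flat_const_ge_1 by simp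

lemma ln_ge_1: "ln (real n) \<ge> 1" if "n \<ge> 3"
proof -
  have "exp 1 \<le> (3::real)" using exp_le by simp
  then have "exp 1 \<le> real n" using that by linarith
  then show ?thesis using ln_le_cancel_iff[of "exp 1" "real n"] that by simp
qed

lemma query_bound_pos: "n \<ge> 3 \<Longrightarrow> query_bound n k > 0"
  unfolding query_bound_def using ln_ge_1[of n] by simp

lemma query_bound_le:
  assumes n: "n \<ge> 3" and k: "k \<ge> 1"
  shows "query_bound n k \<le> real n / ln (real n)"
proof -
  have L: "ln (real n) \<ge> 1" by (rule ln_ge_1[OF n])
  have k1: "1 / real k \<le> 1" "1 / real k \<ge> 0" using k by auto
  have "real n powr (1 - 1 / real k) \<le> real n powr 1"
    using n k1 by (intro powr_mono) auto
  moreover have "ln (real n) powr 1 \<le> ln (real n) powr (2 - 1 / real k)"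
    using L k1 by (intro powr_mono) auto
  ultimately show ?thesis unfolding query_bound_def using n L
    by (intro frac_le) auto
qed

lemma small_depth_bounds:
  assumes n: "n \<ge> 3" and k: "k \<ge> 1" and d: "real d \<le> query_const * query_bound n k" and l: "l \<le> d"
  shows "368640 * flat_const\<^sup>2 * (real l * ln (real n)) \<le> real n"
proof -
  have L: "ln (real n) \<ge> 1" by (rule ln_ge_1[OF n])
  have C: "flat_const\<^sup>2 > 0" using flat_const_ge_1 by simp
  have "real l \<le> query_const * (real n / ln (real n))"
    using l d query_bound_le[OF n k] query_const_pos
    by (smt (verit, best) mult_left_mono of_nat_le_iff)
  then have "real l * ln (real n) \<le> query_const * real n"
    using L by (simp add: field_simps)
  then have "368640 * flat_const\<^sup>2 * (real l * ln (real n)) \<le> 368640 * flat_const\<^sup>2 * (query_const * real n)"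
    using C by (intro mult_left_mono) auto
  also have "\<dots> = real n" unfolding query_const_def using C by simp
  finally show ?thesis .
qed

text \<open>Under the root and per element, \<open>fact_ge_power\<close> turns the level weight into
  \<open>d ln n / l\<close> and the kernel bound gives \<open>(l ln n / n)^(1 - 1/k)\<close>, both
  up to constants. The power of \<open>l\<close> is at most \<open>l\<close> and cancels, which
  leaves \<open>d / query_bound n k\<close>.\<close>

lemma advantage_term_le:
  assumes n: "n \<ge> 3" and k: "k = Suc K" and l: "1 \<le> l" "l \<le> d"
    and d: "real d \<le> query_const * query_bound n k"
    and M: "0 \<le> M" "M \<le> 30 * ln (real n) * real d"
  shows "(flat_const * sqrt (real l * ln (real n) / real n)) powr (real l * real K / real k) * sqrt (M ^ l / fact l) \<le> (1 / 64) ^ l"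
proof -
  define L where "L = ln (real n)"
  define e where "e = 1 - 1 / real k"
  have L: "L \<ge> 1" unfolding L_def by (rule ln_ge_1[OF n])
  have e: "e = real K / real k" "0 \<le> e" "e \<le> 1" unfolding e_def k by (auto simp: field_simps)
  have C: "flat_const\<^sup>2 \<ge> 1" using flat_const_ge_1 by simp
  define A where "A = flat_const\<^sup>2 * (real l * L / real n)"
  have A0: "A > 0" unfolding A_def using C l L n by (intro mult_pos_pos divide_pos_pos) auto
  define th where "th = flat_const * sqrt (real l * L / real n)"
  have th0: "th > 0" unfolding th_def using flat_const_ge_1 l L n by simp
  have th2: "th\<^sup>2 = A" unfolding th_def A_def power_mult_distrib using l L n by simp
  have p1: "th powr (real l * real K / real k) = sqrt (A powr e) ^ l"
  proof -
    have thA: "th = A powr (1 / 2)" using th0 th2 by (metis powr_half_sqrt real_sqrt_unique less_imp_le A0)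
    have "sqrt (A powr e) ^ l = ((A powr e) powr (1 / 2)) powr real l"
      using A0 by (simp add: powr_half_sqrt powr_realpow[symmetric])
    also have "\<dots> = A powr (1 / 2 * (real l * e))" by (simp add: powr_powr mult_ac)
    also have "\<dots> = th powr (real l * e)" unfolding thA by (simp add: powr_powr)
    finally show ?thesis unfolding e(1) by simp
  qed
  have "M ^ l / fact l \<le> M ^ l / (real l / exp 1) ^ l"
    using M l by (intro divide_left_mono fact_ge_power) auto
  also have "\<dots> = (M * exp 1 / real l) ^ l" by (simp add: power_divide power_mult_distrib)
  also have "\<dots> \<le> (90 * L * real d / real l) ^ l"
  proof (intro power_mono divide_right_mono)
    have "M * exp 1 \<le> (30 * L * real d) * 3"
      using M exp_le L unfolding L_def by (intro mult_mono) auto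
    then show "M * exp 1 \<le> 90 * L * real d" by simp
  qed (use M l in auto)
  finally have "sqrt (M ^ l / fact l) \<le> sqrt ((90 * L * real d / real l) ^ l)" by simp
  then have p2: "sqrt (M ^ l / fact l) \<le> sqrt (90 * L * real d / real l) ^ l" by (simp add: real_sqrt_power)
  \<comment> \<open>The product of both contributions per element, before the root; all constants
    meet here.\<close>
  have Y: "A powr e * (90 * L * real d / real l) \<le> (1 / 64)\<^sup>2"
  proof -
    have "A powr e = flat_const\<^sup>2 powr e * (real l powr e * L powr e / real n powr e)"
      unfolding A_def using C L by (simp add: powr_mult powr_divide)
    also have "\<dots> \<le> flat_const\<^sup>2 powr 1 * (real l powr 1 * L powr e / real n powr e)"
      using C L l e by (intro mult_mono divide_right_mono mult_right_mono powr_mono) auto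
    also have "\<dots> = flat_const\<^sup>2 * (real l * L powr e / real n powr e)" using C l by simp
    finally have "A powr e * (90 * L * real d / real l)
        \<le> flat_const\<^sup>2 * (real l * L powr e / real n powr e) * (90 * L * real d / real l)"
      using L by (intro mult_right_mono) auto
    also have "\<dots> = 90 * flat_const\<^sup>2 * (L powr e * L / real n powr e) * real d"
      using l by simp
    also have "L powr e * L / real n powr e = 1 / query_bound n k"
    proof -
      have "L powr e * L = L powr (2 - 1 / real k)"
      proof -
        have "L powr e * L = L powr e * L powr 1" using L by simp
        also have "\<dots> = L powr (e + 1)" by (rule powr_add[symmetric])
        finally show ?thesis by (simp add: e_def)
      qed
      then show ?thesis unfolding query_bound_def L_def e_def by simp
    qed
    also have "90 * flat_const\<^sup>2 * (1 / query_bound n k) * real d \<le> 90 * flat_const\<^sup>2 * (1 / query_bound n k) * (query_const * query_bound n k)"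
      using d query_bound_pos[OF n, of k] by (intro mult_left_mono) auto
    also have "\<dots> = 90 * flat_const\<^sup>2 * query_const" using query_bound_pos[OF n, of k] by simp
    also have "\<dots> = 1 / 4096" unfolding query_const_def using flat_const_ge_1 by simp
    finally show ?thesis by (simp add: power2_eq_square)
  qed
  have "th powr (real l * real K / real k) * sqrt (M ^ l / fact l) \<le> sqrt (A powr e) ^ l * sqrt (90 * L * real d / real l) ^ l"
    unfolding p1 using p2 by (intro mult_left_mono) auto
  also have "\<dots> = sqrt (A powr e * (90 * L * real d / real l)) ^ l"
    by (simp only: power_mult_distrib[symmetric] real_sqrt_mult)
  also have "\<dots> \<le> sqrt ((1 / 64)\<^sup>2) ^ l"
    using Y L by (intro power_mono real_sqrt_le_mono) auto
  finally show ?thesis unfolding th_def L_def by simp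
qed

lemma sum_geometric_tail_le:
  "(\<Sum>l = 1..d. if l < k then 0 else (1 / 64 :: real) ^ l) \<le> 2 * (1 / 64) ^ k" if "k \<ge> 1"
proof -
  have "(\<Sum>l = 1..d. if l < k then 0 else (1 / 64 :: real) ^ l) = (\<Sum>l = k..d. (1 / 64) ^ l)"
    by (rule sum.mono_neutral_cong_right) (use that in auto)
  also have "\<dots> \<le> 2 * (1 / 64) ^ k"
  proof -
    have "(1 / 64 :: real) ^ d \<ge> 0" "(1 / 64 :: real) ^ k \<ge> 0" by simp_all
    then show ?thesis unfolding sum_gp by (auto simp: field_simps simp del: zero_le_power zero_le_power_eq_numeral)
  qed
  finally show ?thesis .
qed

text \<open>In units of \<open>u = 2^(-k)\<close> the mean is \<open>2 g\<close> with
  \<open>g = (1001/1000)^K\<close>. If \<open>n\<close> is at least \<open>16 * 8^k\<close>,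
  Chebyshev's term is at most 1/4 and \<open>g >= 1\<close> is enough. Otherwise that term may reach
  1/2, but then \<open>k > m >= 1001\<close>, and Bernoulli's inequality gives
  \<open>g >= 2\<close>.\<close>

lemma success_gap:
  assumes k: "k = Suc K" "K \<ge> 1" and m: "m \<ge> 1001" and n: "real n \<ge> 16 * 8 ^ m" "8 ^ (k + 1) \<le> real n"
  shows "2 * (1 / 64) ^ k < (1 - 1 / 2 ^ (k + 1)) * ((1001 / 2000) ^ K - 1 / 2 ^ k) - 1 / 2 ^ (k + 1) - 4 ^ (k + 1) / real n"
proof -
  define u where "u = (1 / 2 :: real) ^ k"
  define g where "g = (1001 / 1000 :: real) ^ K"
  have npos: "real n > 0" using n(2) by (smt (verit) zero_less_power)
  have u0: "u > 0" unfolding u_def by simp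
  have u4: "u \<le> 1 / 4"
  proof -
    have "u \<le> (1 / 2) ^ 2" unfolding u_def using k by (intro power_decreasing) auto
    then show ?thesis by (simp add: power2_eq_square)
  qed
  have g1: "g \<ge> 1" unfolding g_def by simp
  have e1: "1 / 2 ^ k = u" "1 / 2 ^ (k + 1) = u / 2" unfolding u_def by (simp_all add: power_divide)
  have e2: "(1001 / 2000) ^ K = 2 * u * g"
  proof -
    have "(1001 / 2000 :: real) ^ K = (1 / 2 * (1001 / 1000)) ^ K" by simp
    also have "\<dots> = (1 / 2) ^ K * g" unfolding g_def by (rule power_mult_distrib)
    finally show ?thesis unfolding u_def k(1) by simp
  qed
  have e3: "4 ^ (k + 1) / real n = u * (4 * 8 ^ k / real n)"
  proof -
    have "u * 8 ^ k = 4 ^ k" unfolding u_def by (simp add: power_mult_distrib[symmetric])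
    then show ?thesis by simp
  qed
  have e4: "2 * (1 / 64) ^ k \<le> u / 512"
  proof -
    have "(1 / 64 :: real) ^ k = u * (1 / 32) ^ k" unfolding u_def by (simp add: power_mult_distrib[symmetric])
    also have "\<dots> \<le> u * (1 / 32) ^ 2" using u0 k by (intro mult_left_mono power_decreasing) auto
    finally show ?thesis by (simp add: power2_eq_square)
  qed
  have main: "1 / 512 < (1 - u / 2) * (2 * g - 1) - 1 / 2 - 4 * 8 ^ k / real n"
  proof (cases "16 * 8 ^ k \<le> real n")
    case True
    then have "4 * 8 ^ k / real n \<le> 1 / 4" using npos by (simp add: divide_le_eq)
    moreover have "(7 / 8) * 1 \<le> (1 - u / 2) * (2 * g - 1)"
      using u4 g1 by (intro mult_mono) auto
    ultimately show ?thesis by linarith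
  next
    case False
    then have "(8::real) ^ m < 8 ^ k" using n(1) by linarith
    then have "m < k" by simp
    then have "1001 < k" using m by simp
    then have K: "1000 \<le> K" using k by simp
    have "1 + real K * (1 / 1000) \<le> (1 + 1 / 1000) ^ K" by (rule Bernoulli_inequality) simp
    then have "2 \<le> g" unfolding g_def using K by simp
    then have "(7 / 8) * 3 \<le> (1 - u / 2) * (2 * g - 1)"
      using u4 by (intro mult_mono) auto
    moreover have "4 * 8 ^ k / real n \<le> 1 / 2" using n(2) npos by (simp add: divide_le_eq)
    ultimately show ?thesis by linarith
  qed
  have "2 * (1 / 64) ^ k \<le> u * (1 / 512)" using e4 by simp
  also have "\<dots> < u * ((1 - u / 2) * (2 * g - 1) - 1 / 2 - 4 * 8 ^ k / real n)"
    using main u0 by (rule mult_strict_left_mono)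
  also have "\<dots> = (1 - u / 2) * (2 * u * g - u) - u / 2 - u * (4 * 8 ^ k / real n)"
    by (simp add: algebra_simps)
  finally show ?thesis unfolding e1 e2 e3 .
qed

lemma orthogonal_flat_advantage:
  assumes n: "n \<ge> 3" and k: "k = Suc K" "k \<le> n"
    and U: "U \<in> orthogonal_group n" and flat: "flat_matrix n (entries U)" "flat_matrix n (\<lambda>i j. entries U j i)"
    and d: "real d \<le> query_const * query_bound n k"
    and t: "dtree_vars t \<subseteq> {..<k} \<times> {..<n}" "dtree_depth t \<le> d"
  shows "\<bar>cube_avg ({..<k} \<times> {..<n}) (\<lambda>x. (\<Sum>S\<in>Pow ({..<k} \<times> {..<n}). chain_weight K n (entries U) S * monomial S x) * of_bool (dtree_run t x))
      - cube_avg ({..<k} \<times> {..<n}) (\<lambda>x. of_bool (dtree_run t x))\<bar> \<le> 2 * (1 / 64) ^ k"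
proof -
  let ?I = "{..<k} \<times> {..<n}"
  define L where "L = ln (real n)"
  \<comment> \<open>As \<open>k <= n\<close>, the number of variables is at most
    \<open>n^2 <= exp q\<close>, so the adaptive choice costs only the factor
    \<open>exp 1\<close>.\<close>
  define q where "q = nat \<lceil>2 * L\<rceil>"
  define B where "B l = (if l < k then 0 else (flat_const * sqrt (real l * ln (real n) / real n)) powr (real l * real K / real k))" for l
  have L: "L \<ge> 1" unfolding L_def by (rule ln_ge_1[OF n])
  have q: "q > 0" "2 * L \<le> real q" "real q \<le> 2 * L + 1"
    unfolding q_def using L by (auto simp: ceiling_correct intro: less_imp_le)
  have cols: "orthonormal_columns n (entries U)" by (rule orthogonal_group_columns[OF U])
  have card_le: "real (card ?I) \<le> exp 1 ^ q"
  proof -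
    have "real (card ?I) \<le> real n * real n" using k(2) by (simp add: mult_right_mono)
    also have "real n = exp L" unfolding L_def using n by simp
    also have "exp L * exp L = exp (2 * L)" by (simp only: mult_2 exp_add)
    also have "\<dots> \<le> exp (real q)" using q by simp
    also have "\<dots> = exp 1 ^ q" by (simp add: exp_of_nat_mult[symmetric])
    finally show ?thesis .
  qed
  have small: "9 * real l * ln (real n) \<le> real n" "flat_const * sqrt (real l * ln (real n) / real n) \<le> 1" if "l \<le> d" for l
  proof -
    have b: "368640 * flat_const\<^sup>2 * (real l * ln (real n)) \<le> real n"
      by (rule small_depth_bounds[OF n _ d that]) (use k in simp)
    have C: "flat_const\<^sup>2 \<ge> 1" using flat_const_ge_1 by simp
    have lL: "0 \<le> real l * ln (real n)" using L unfolding L_def by simp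
    have "9 * (real l * ln (real n)) \<le> 368640 * flat_const\<^sup>2 * (real l * ln (real n))"
      using C lL by (intro mult_right_mono) auto
    then show "9 * real l * ln (real n) \<le> real n" using b unfolding mult.assoc by linarith
    have "flat_const\<^sup>2 * (real l * ln (real n)) \<le> 368640 * flat_const\<^sup>2 * (real l * ln (real n))"
      using lL by (intro mult_right_mono) auto
    then have "flat_const\<^sup>2 * (real l * ln (real n) / real n) \<le> 1"
      using b n by (simp add: divide_le_eq)
    then have "sqrt (flat_const\<^sup>2 * (real l * ln (real n) / real n)) \<le> 1" by simp
    then show "flat_const * sqrt (real l * ln (real n) / real n) \<le> 1"
      using flat_const_ge_1 by (simp only: real_sqrt_mult real_sqrt_abs abs_of_nonneg)
  qed
  have "\<bar>cube_avg ?I (\<lambda>x. (\<Sum>S\<in>Pow ?I. chain_weight K n (entries U) S * monomial S x) * of_bool (dtree_run t x))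
      - cube_avg ?I (\<lambda>x. of_bool (dtree_run t x))\<bar>
    \<le> (\<Sum>l = 1..d. B l * sqrt (((2 * real q - 1) * exp 1 * (real d + 1)) ^ l / fact l))"
  proof (rule dtree_advantage)
    fix S assume S: "S \<subseteq> ?I" "card S \<in> {1..d}"
    then have ne: "S \<noteq> {}" by auto
    show "\<bar>chain_weight K n (entries U) S\<bar> \<le> B (card S)"
    proof (cases "card S < k")
      case True
      then show ?thesis using chain_weight_zero[OF cols _ ne] S(1) unfolding B_def k(1) by simp
    next
      case False
      have "card S \<le> d" using S(2) by simp
      then have "\<bar>chain_weight K n (entries U) S\<bar> \<le>
          (flat_const * sqrt (real (card S) * ln (real n) / real n)) powr (real (card S) * real K / real (Suc K))"
        using small[of "card S"] S(1) ne n unfolding k(1) by (intro abs_chain_weight_le[OF cols flat]) auto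
      then show ?thesis using False unfolding B_def k(1) by simp
    qed
  qed (use t q card_le in \<open>auto simp: B_def\<close>)
  also have "\<dots> \<le> (\<Sum>l = 1..d. if l < k then 0 else (1 / 64) ^ l)"
  proof (rule sum_mono)
    fix l assume l: "l \<in> {1..d}"
    show "B l * sqrt (((2 * real q - 1) * exp 1 * (real d + 1)) ^ l / fact l) \<le> (if l < k then 0 else (1 / 64) ^ l)"
    proof (cases "l < k")
      case False
      have "(flat_const * sqrt (real l * ln (real n) / real n)) powr (real l * real K / real k)
         * sqrt (((2 * real q - 1) * exp 1 * (real d + 1)) ^ l / fact l) \<le> (1 / 64) ^ l"
      proof (rule advantage_term_le[OF n k(1) _ _ d])
        show "0 \<le> (2 * real q - 1) * exp 1 * (real d + 1)" using q L by (intro mult_nonneg_nonneg) auto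
        have "(2 * real q - 1) * exp 1 * (real d + 1) \<le> (5 * L) * 3 * (2 * real d)"
          using q L l exp_le by (intro mult_mono) auto
        then show "(2 * real q - 1) * exp 1 * (real d + 1) \<le> 30 * ln (real n) * real d"
          unfolding L_def by simp
      qed (use l in auto)
      then show ?thesis using False unfolding B_def by simp
    qed (simp add: B_def)
  qed
  also have "\<dots> \<le> 2 * (1 / 64) ^ k"
    by (rule sum_geometric_tail_le) (use k in simp)
  finally show ?thesis .
qed

text \<open>The acceptance probability is bounded pointwise through the forrelation: from below by a
  linear function, integrated against the hard density, and from above by a quadratic one, averaged
  over uniform inputs. The first moment under one distribution and the second under the other then
  decide.\<close>

lemma algorithm_lower_bound:
  assumes m: "m \<ge> 1001" and n: "real n \<ge> 16 * 8 ^ m" and k: "k = Suc K" "K \<ge> 1" "8 ^ (k + 1) \<le> real n"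
    and U: "U \<in> orthogonal_group n" and flat: "flat_matrix n (entries U)" "flat_matrix n (\<lambda>i j. entries U j i)"
    and alg: "randomized_algorithm ({..<k} \<times> {..<n}) d p"
      "computes_with_error ({..<k} \<times> {..<n}) p (forrelation_fun n k U) (1 / 2 ^ (k + 1))"
  shows "query_const * query_bound n k \<le> real d"
proof (rule ccontr)
  assume "\<not> query_const * query_bound n k \<le> real d"
  then have d: "real d \<le> query_const * query_bound n k" by simp
  let ?I = "{..<k} \<times> {..<n}"
  define \<rho> where "\<rho> x = (\<Sum>S\<in>Pow ?I. chain_weight K n (entries U) S * monomial S x)" for x
  define \<phi> where "\<phi> = forrelation n k U"
  define a where "a x = measure_pmf.prob p {t. dtree_run t x}" for x
  define u where "u = (1 :: real) / 2 ^ (k + 1)"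
  have fin: "finite ?I" by simp
  have kn: "k < n"
  proof -
    have "k < 2 ^ k" by simp
    then have "real k < 2 ^ k" by (metis of_nat_less_numeral_power_cancel_iff)
    also have "(2::real) ^ k \<le> 8 ^ k" by (intro power_mono) auto
    also have "(8::real) ^ k \<le> 8 ^ (k + 1)" by simp
    also have "\<dots> \<le> real n" by (rule k(3))
    finally show ?thesis by simp
  qed
  have n3: "n \<ge> 3" using kn k by simp
  have n0: "n > 0" using n3 by simp
  have carrier: "U \<in> carrier_mat n n" using U unfolding orthogonal_group_def by simp
  have cols: "orthonormal_columns n (entries U)" by (rule orthogonal_group_columns[OF U])
  have \<phi>: "\<phi> = chain_form K n (entries U)" unfolding \<phi>_def k(1) using forrelation_eq_chain_form[OF carrier] by auto
  have "1 \<le> (2 :: real) ^ (k + 1)" by (rule one_le_power) simp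
  then have u: "0 < u" "u \<le> 1" "1 / 2 ^ k = 2 * u" unfolding u_def by (simp_all add: divide_le_eq_1)
  have a01: "0 \<le> a x" "a x \<le> 1" for x unfolding a_def by auto
  have a_one: "1 - u \<le> a x" if "x \<in> sign_inputs ?I" "\<phi> x \<ge> 2 * u" for x
  proof -
    have "forrelation_fun n k U x = Some True" using that(2) u(3) unfolding forrelation_fun_def \<phi>_def by simp
    then have "1 - 1 / 2 ^ (k + 1) \<le> measure_pmf.prob p {t. dtree_run t x = True}"
      using alg(2) that(1) unfolding computes_with_error_def by blast
    then show ?thesis unfolding a_def u_def by simp
  qed
  have a_zero: "a x \<le> u" if "x \<in> sign_inputs ?I" "\<bar>\<phi> x\<bar> \<le> u" for x
  proof -
    have "forrelation_fun n k U x = Some False"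
      using that(2) u unfolding forrelation_fun_def \<phi>_def[symmetric] u_def[symmetric] by auto
    then have "1 - 1 / 2 ^ (k + 1) \<le> measure_pmf.prob p {t. dtree_run t x = False}"
      using alg(2) that(1) unfolding computes_with_error_def by blast
    also have "{t. dtree_run t x = False} = - {t. dtree_run t x}" by auto
    also have "measure_pmf.prob p (- {t. dtree_run t x}) = 1 - a x"
      unfolding a_def using measure_pmf.prob_compl[of "{t. dtree_run t x}" p] by (simp add: Compl_eq_Diff_UNIV)
    finally show ?thesis unfolding u_def by simp
  qed
  have \<rho>_avg: "cube_avg ?I \<rho> = 1"
  proof -
    have "cube_avg ?I \<rho> = (\<Sum>S\<in>Pow ?I. if S = {} then chain_weight K n (entries U) S else 0)"
      unfolding \<rho>_def cube_avg_sum cube_avg_cmult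
      by (intro sum.cong refl) (auto simp: cube_avg_monomial[OF fin])
    then show ?thesis using fin by simp
  qed
  have lower: "(1 - u) * ((1001 / 2000) ^ K - 2 * u) \<le> cube_avg ?I (\<lambda>x. \<rho> x * a x)"
  proof -
    have "(1001 / 2000) ^ K \<le> cube_avg ?I (\<lambda>x. \<rho> x * \<phi> x)"
      using chain_form_mean[OF cols n0, of K] unfolding \<rho>_def \<phi> k(1) .
    then have "(1 - u) * ((1001 / 2000) ^ K - 2 * u) \<le> (1 - u) * (cube_avg ?I (\<lambda>x. \<rho> x * \<phi> x) - 2 * u * cube_avg ?I \<rho>)"
      unfolding \<rho>_avg using u by (intro mult_left_mono) auto
    also have "\<dots> = cube_avg ?I (\<lambda>x. (1 - u) * (\<rho> x * \<phi> x - 2 * u * \<rho> x))"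
      by (simp only: cube_avg_cmult cube_avg_diff)
    also have "\<dots> \<le> cube_avg ?I (\<lambda>x. \<rho> x * a x)"
    proof (rule cube_avg_mono)
      fix x assume x: "x \<in> sign_inputs ?I"
      have \<rho>0: "\<rho> x \<ge> 0" unfolding \<rho>_def using x unfolding k(1) by (rule chain_density_nonneg)
      have \<phi>1: "\<phi> x \<le> 1"
        unfolding \<phi> using x unfolding k(1) by (rule chain_form_le_1[OF orthogonal_group_rows[OF U] n0])
      \<comment> \<open>Above the threshold \<open>2 * u\<close> the input is accepted with
        probability at least \<open>1 - u\<close>, and \<open>\<phi> x\<close> is at most 1; below
        it the left side is not positive.\<close>
      have "(1 - u) * (\<phi> x - 2 * u) \<le> a x"
      proof (cases "\<phi> x \<ge> 2 * u")
        case True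
        have "(1 - u) * (\<phi> x - 2 * u) \<le> (1 - u) * 1" using u \<phi>1 by (intro mult_left_mono) auto
        then show ?thesis using a_one[OF x True] by simp
      next
        case False
        then have "(1 - u) * (\<phi> x - 2 * u) \<le> 0" using u by (intro mult_nonneg_nonpos) auto
        then show ?thesis using a01(1)[of x] by linarith
      qed
      then have "\<rho> x * ((1 - u) * (\<phi> x - 2 * u)) \<le> \<rho> x * a x" using \<rho>0 by (rule mult_left_mono)
      then show "(1 - u) * (\<rho> x * \<phi> x - 2 * u * \<rho> x) \<le> \<rho> x * a x" by (simp add: algebra_simps)
    qed
    finally show ?thesis .
  qed
  have upper: "cube_avg ?I a \<le> u + 4 ^ (k + 1) / real n"
  proof -
    have "cube_avg ?I a \<le> cube_avg ?I (\<lambda>x. u + 4 ^ (k + 1) * (\<phi> x)\<^sup>2)"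
    proof (rule cube_avg_mono)
      fix x assume x: "x \<in> sign_inputs ?I"
      \<comment> \<open>Chebyshev's argument: outside the rejection range the quadratic term alone
        is at least 1.\<close>
      show "a x \<le> u + 4 ^ (k + 1) * (\<phi> x)\<^sup>2"
      proof (cases "\<bar>\<phi> x\<bar> \<le> u")
        case True
        have "0 \<le> 4 ^ (k + 1) * (\<phi> x)\<^sup>2" by simp
        then show ?thesis using a_zero[OF x True] by linarith
      next
        case False
        then have "u\<^sup>2 \<le> \<bar>\<phi> x\<bar>\<^sup>2" using u by (intro power_mono) auto
        then have "4 ^ (k + 1) * u\<^sup>2 \<le> 4 ^ (k + 1) * (\<phi> x)\<^sup>2" by simp
        moreover have "4 ^ (k + 1) * u\<^sup>2 = 1"
        proof -
          have "((2 :: real) ^ (k + 1))\<^sup>2 = (2\<^sup>2) ^ (k + 1)"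
            by (simp only: power_mult[symmetric] mult.commute)
          then show ?thesis unfolding u_def power_divide by simp
        qed
        ultimately show ?thesis using a01(2)[of x] u by linarith
      qed
    qed
    also have "\<dots> = u + 4 ^ (k + 1) * cube_avg ?I (\<lambda>x. (\<phi> x)\<^sup>2)"
      by (simp only: cube_avg_add cube_avg_cmult cube_avg_const[OF fin])
    also have "cube_avg ?I (\<lambda>x. (\<phi> x)\<^sup>2) = 1 / real n"
      unfolding \<phi> k(1) by (rule chain_form_second_moment[OF cols n0])
    finally show ?thesis by simp
  qed
  have "cube_avg ?I (\<lambda>x. \<rho> x * a x) - cube_avg ?I a \<le> 2 * (1 / 64) ^ k"
    unfolding a_def
    by (rule randomized_advantage_le[OF fin alg(1)], unfold \<rho>_def)
      (rule orthogonal_flat_advantage[OF n3 k(1) less_imp_le[OF kn] U flat d])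
  moreover have "2 * (1 / 64) ^ k < (1 - u) * ((1001 / 2000) ^ K - 2 * u) - u - 4 ^ (k + 1) / real n"
    using success_gap[OF k(1,2) m n k(3)] unfolding u(3) u_def[symmetric] .
  ultimately show False using lower upper by linarith
qed

text \<open>For \<open>k = 1\<close> there is no hidden vector, and the bound to be shown is at most
  1. It suffices that zero queries fail, which holds because the function takes both values.\<close>

lemma algorithm_lower_bound_single_block:
  assumes n: "n \<ge> 16" and U: "U \<in> orthogonal_group n"
    and alg: "randomized_algorithm ({..<1} \<times> {..<n}) d p"
      "computes_with_error ({..<1} \<times> {..<n}) p (forrelation_fun n 1 U) (1 / 4)"
  shows "1 \<le> real d"
proof (rule ccontr)
  assume "\<not> 1 \<le> real d"
  then have d: "d = 0" by simp
  let ?I = "{..<Suc 0} \<times> {..<n}"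
  have carrier: "U \<in> carrier_mat n n" using U unfolding orthogonal_group_def by simp
  have n0: "n > 0" using n by simp
  have form: "forrelation n 1 U x = chain_form 0 n (entries U) x" for x
    using forrelation_eq_chain_form[OF carrier, of 0 x] by simp
  define y where "y = (\<lambda>v\<in>?I. 1 :: real)"
  have y: "y \<in> sign_inputs ?I" unfolding sign_inputs_def y_def by auto
  have "chain_form 0 n (entries U) y = 1" unfolding chain_form_def y_def using n0 by simp
  then have fy: "forrelation_fun n 1 U y = Some True" unfolding forrelation_fun_def form by simp
  \<comment> \<open>Some input lies at or below the mean \<open>1 / n\<close> of the squared
    forrelation; for \<open>n >= 16\<close> it is in the rejection range.\<close>
  obtain x where x: "x \<in> sign_inputs ?I" "(chain_form 0 n (entries U) x)\<^sup>2 \<le> 1 / real n"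
  proof (rule ccontr)
    assume "\<not> thesis"
    then have gt: "\<not> (chain_form 0 n (entries U) x)\<^sup>2 \<le> 1 / real n" if "x \<in> sign_inputs ?I" for x
      using that \<open>\<And>x. x \<in> sign_inputs ?I \<Longrightarrow> (chain_form 0 n (entries U) x)\<^sup>2 \<le> 1 / real n \<Longrightarrow> thesis\<close> by blast
    have "(\<Sum>x\<in>sign_inputs ?I. 1 / real n) < (\<Sum>x\<in>sign_inputs ?I. (chain_form 0 n (entries U) x)\<^sup>2)"
      using y gt by (intro sum_strict_mono) (auto simp: not_le)
    then have "cube_avg ?I (\<lambda>x. 1 / real n) < cube_avg ?I (\<lambda>x. (chain_form 0 n (entries U) x)\<^sup>2)"
      unfolding cube_avg_def by (intro divide_strict_right_mono) auto
    then show False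
      using chain_form_second_moment[OF orthogonal_group_columns[OF U] n0, of 0] by simp
  qed
  have "(chain_form 0 n (entries U) x)\<^sup>2 \<le> (1 / 4)\<^sup>2"
    using x(2) n by (rule_tac order_trans[of _ "1 / real n"]) (auto simp: power2_eq_square field_simps)
  then have "\<bar>chain_form 0 n (entries U) x\<bar> \<le> \<bar>1 / 4\<bar>" unfolding abs_le_square_iff .
  then have "\<bar>chain_form 0 n (entries U) x\<bar> \<le> 1 / 4" by simp
  then have fx: "forrelation_fun n 1 U x = Some False" unfolding forrelation_fun_def form by auto
  have eq: "dtree_run t y = dtree_run t x" if "t \<in> set_pmf p" for t
  proof -
    have "dtree_depth t = 0" using alg(1) that d unfolding randomized_algorithm_def by auto
    then show ?thesis by (cases t) auto
  qed
  have "3 / 4 \<le> measure_pmf.prob p {t. dtree_run t y = True}" "3 / 4 \<le> measure_pmf.prob p {t. dtree_run t x = False}"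
  proof -
    have "computes_with_error ?I p (forrelation_fun n 1 U) (1 / 4)" using alg(2) by (simp only: One_nat_def)
    then have *: "1 - 1 / 4 \<le> measure_pmf.prob p {t. dtree_run t z = b}"
      if "z \<in> sign_inputs ?I" "forrelation_fun n 1 U z = Some b" for z b
      unfolding computes_with_error_def using that by blast
    show "3 / 4 \<le> measure_pmf.prob p {t. dtree_run t y = True}" using *[OF y fy] by simp
    show "3 / 4 \<le> measure_pmf.prob p {t. dtree_run t x = False}" using *[OF x(1) fx] by simp
  qed
  moreover have "measure_pmf.prob p {t. dtree_run t y = True} = measure_pmf.prob p {t. dtree_run t x = True}"
    by (rule measure_pmf.finite_measure_eq_AE) (auto simp: AE_measure_pmf_iff eq)
  moreover have "measure_pmf.prob p {t. dtree_run t x = True} = 1 - measure_pmf.prob p {t. dtree_run t x = False}"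
  proof -
    have "{t. dtree_run t x = True} = UNIV - {t. dtree_run t x = False}" by auto
    then show ?thesis using measure_pmf.prob_compl[of "{t. dtree_run t x = False}" p] by simp
  qed
  ultimately show False by linarith
qed

section \<open>The lower bound for random matrices\<close>

text \<open>The form in which the restriction on \<open>k\<close> enters the proof.\<close>

lemma eight_power_le:
  assumes n: "n > 0" and k: "real k \<le> 1 / 3 * log 2 (real n) - 1"
  shows "8 ^ (k + 1) \<le> real n"
proof -
  have "real (3 * (k + 1)) \<le> log 2 (real n)" using k by simp
  then have "2 powr real (3 * (k + 1)) \<le> real n" using n by (simp only: le_log_iff)
  then have "(2::real) ^ (3 * (k + 1)) \<le> real n" by (simp only: powr_realpow)
  then show ?thesis by (simp only: power_mult) simp
qed

lemma forrelation_algorithm_lower_bound: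
  assumes m: "m \<ge> 1001" and n: "real n \<ge> 16 * 8 ^ m" and k: "k > 0" "8 ^ (k + 1) \<le> real n"
    and U: "U \<in> orthogonal_group n" and flat: "flat_matrix n (entries U)" "flat_matrix n (\<lambda>i j. entries U j i)"
    and alg: "randomized_algorithm ({..<k} \<times> {..<n}) d p"
      "computes_with_error ({..<k} \<times> {..<n}) p (forrelation_fun n k U) (1 / 2 ^ (k + 1))"
  shows "query_const * query_bound n k \<le> real d"
proof (cases "k = 1")
  case True
  have "(1::real) \<le> 8 ^ m" by (rule one_le_power) simp
  then have n16: "n \<ge> 16" using n by linarith
  have "1 \<le> real d"
    using algorithm_lower_bound_single_block[OF n16 U, of d p] alg unfolding True by (simp add: power2_eq_square)
  moreover have "query_bound n k \<le> 1"
    using ln_ge_1[of n] n16 unfolding query_bound_def True by simp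
  moreover have "query_const \<le> 1"
  proof -
    have "1 \<le> flat_const\<^sup>2" using flat_const_ge_1 by (rule one_le_power)
    then have "1 \<le> 368640 * flat_const\<^sup>2" by linarith
    then show ?thesis unfolding query_const_def by (simp add: divide_le_eq_1)
  qed
  moreover have "query_bound n k \<ge> 0" using query_bound_pos[of n k] n16 by simp
  ultimately show ?thesis
    using mult_mono[of query_const 1 "query_bound n k" 1] by simp
next
  case False
  then obtain K where "k = Suc K" "K \<ge> 1" using k(1) by (cases k) auto
  then show ?thesis using algorithm_lower_bound[OF m n _ _ k(2) U flat alg] by simp
qed

lemma forrelation_complexity_lower_bounds:
  assumes m: "m \<ge> 1001" and n: "real n \<ge> 16 * 8 ^ m" and k: "k > 0" "8 ^ (k + 1) \<le> real n"
    and U: "U \<in> orthogonal_group n" and flat: "flat_matrix n (entries U)" "flat_matrix n (\<lambda>i j. entries U j i)"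
  shows "query_const * query_bound n k \<le> real (forrelation_complexity (1 / 2 ^ (k + 1)) n k U)"
    and "0 \<le> \<gamma> \<Longrightarrow> \<gamma> \<le> 1 / 2 \<Longrightarrow>
      query_const / 3 * (\<gamma>\<^sup>2 / real k * query_bound n k) \<le> real (forrelation_complexity (1 / 2 - \<gamma>) n k U)"
proof -
  note lower = forrelation_algorithm_lower_bound[OF m n k U flat]
  show "query_const * query_bound n k \<le> real (forrelation_complexity (1 / 2 ^ (k + 1)) n k U)"
    unfolding forrelation_complexity_def
    by (rule randomized_query_complexity_ge) (use lower in auto)
  assume g: "0 \<le> \<gamma>" "\<gamma> \<le> 1 / 2"
  show "query_const / 3 * (\<gamma>\<^sup>2 / real k * query_bound n k) \<le> real (forrelation_complexity (1 / 2 - \<gamma>) n k U)"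
  proof (cases "\<gamma> = 0")
    case False
    then have g0: "\<gamma> > 0" using g by simp
    have g2: "\<gamma>\<^sup>2 > 0" "\<gamma>\<^sup>2 \<le> 1"
      using g0 power_le_one[of \<gamma> 2] g by auto
    \<comment> \<open>With this many votes the error \<open>exp (- r \<gamma>^2)\<close> is at most
      \<open>exp (- (k + 1))\<close>. Since \<open>k + 1\<close> is at most \<open>2 k\<close> and
      rounding adds at most \<open>k / \<gamma>^2\<close>, at most \<open>3 k / \<gamma>^2\<close>
      votes are used; hence the divisor 3.\<close>
    define r where "r = nat \<lceil>real (k + 1) / \<gamma>\<^sup>2\<rceil>"
    have r: "real (k + 1) / \<gamma>\<^sup>2 \<le> real r" "real r \<le> real (k + 1) / \<gamma>\<^sup>2 + 1"
      unfolding r_def using g2 by (auto simp: of_nat_nat ceiling_correct intro: less_imp_le)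
    have "real (k + 1) \<le> \<gamma>\<^sup>2 * real r" using r(1) g2 by (simp add: divide_le_eq mult.commute)
    then have "exp (- (\<gamma>\<^sup>2)) ^ r \<le> exp (- real (k + 1))"
      by (simp add: exp_of_nat_mult[symmetric] mult.commute)
    also have "exp (- real (k + 1)) = 1 / exp 1 ^ (k + 1)"
      using exp_of_nat_mult[of "k + 1" "1::real"] by (simp only: exp_minus inverse_eq_divide mult_1_right)
    also have "\<dots> \<le> 1 / 2 ^ (k + 1)"
    proof (intro divide_left_mono power_mono)
      show "2 \<le> exp (1::real)" using exp_ge_add_one_self[of 1] by simp
    qed auto
    finally have small: "exp (- (\<gamma>\<^sup>2)) ^ r \<le> 1 / 2 ^ (k + 1)" .
    have r_le: "real r \<le> 3 * real k / \<gamma>\<^sup>2"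
    proof -
      have "1 \<le> real k / \<gamma>\<^sup>2" using g2 k(1) by (simp add: le_divide_eq)
      moreover have "real (k + 1) / \<gamma>\<^sup>2 \<le> 2 * real k / \<gamma>\<^sup>2"
        using g2 k(1) by (intro divide_right_mono) auto
      moreover have "2 * real k / \<gamma>\<^sup>2 + real k / \<gamma>\<^sup>2 = 3 * real k / \<gamma>\<^sup>2"
        by (simp add: add_divide_distrib[symmetric])
      ultimately show ?thesis using r(2) by linarith
    qed
    show ?thesis
      unfolding forrelation_complexity_def
    proof (rule randomized_query_complexity_ge)
      fix d p
      assume "randomized_algorithm ({..<k} \<times> {..<n}) d p"
        and "computes_with_error ({..<k} \<times> {..<n}) p (forrelation_fun n k U) (1 / 2 - \<gamma>)"
      then obtain p' where "randomized_algorithm ({..<k} \<times> {..<n}) (r * d) p'"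
        "computes_with_error ({..<k} \<times> {..<n}) p' (forrelation_fun n k U) (1 / 2 ^ (k + 1))"
        using randomized_amplification[OF _ _ g small] by metis
      then have "query_const * query_bound n k \<le> real (r * d)" by (rule lower)
      also have "\<dots> \<le> 3 * real k / \<gamma>\<^sup>2 * real d"
        unfolding of_nat_mult using r_le by (rule mult_right_mono) simp
      finally have "\<gamma>\<^sup>2 / (3 * real k) * (query_const * query_bound n k) \<le> \<gamma>\<^sup>2 / (3 * real k) * (3 * real k / \<gamma>\<^sup>2 * real d)"
        using g2 by (intro mult_left_mono) auto
      then show "query_const / 3 * (\<gamma>\<^sup>2 / real k * query_bound n k) \<le> real d"
        using g2 k(1) by (simp add: mult_ac)
    qed (use g in auto)
  qed simp
qed

section \<open>Measurability of the event\<close>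

lemma randomized_query_complexity_cong:
  assumes "\<And>x. x \<in> sign_inputs I \<Longrightarrow> f x = g x"
  shows "randomized_query_complexity I \<epsilon> f = randomized_query_complexity I \<epsilon> g"
proof -
  have "computes_with_error I p f \<epsilon> = computes_with_error I p g \<epsilon>" for p
    unfolding computes_with_error_def using assms by auto
  then show ?thesis unfolding randomized_query_complexity_def by simp
qed

lemma forrelation_measurable:
  assumes M: "haar_orthogonal n M" and k: "k > 0"
  shows "(\<lambda>U. forrelation n k U x) \<in> borel_measurable M"
proof -
  obtain K where K: "k = Suc K" using k by (cases k) auto
  have sp: "space M = orthogonal_group n" using M unfolding haar_orthogonal_def by auto
  have walk: "(\<lambda>U. walk n (entries U) x m j) \<in> borel_measurable M" if "j < n" for m j
    using that
  proof (induction m arbitrary: j)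
    case (Suc m)
    have "(\<lambda>U. (\<Sum>l<n. walk n (entries U) x m l * entries U l j) * x (Suc m, j)) \<in> borel_measurable M"
      using Suc.prems by (intro borel_measurable_times borel_measurable_sum borel_measurable_const Suc.IH
          measurable_orthogonal_entry[OF M]) auto
    then show ?case by simp
  qed simp
  have "(\<lambda>U. chain_form K n (entries U) x) \<in> borel_measurable M"
    unfolding chain_form_def by (intro borel_measurable_times borel_measurable_sum borel_measurable_const walk) auto
  moreover have "forrelation n k U x = chain_form K n (entries U) x" if "U \<in> space M" for U
    unfolding K by (rule forrelation_eq_chain_form) (use that sp in \<open>auto simp: orthogonal_group_def\<close>)
  ultimately show ?thesis by (simp cong: measurable_cong)
qed

lemma forrelation_fun_measurable:
  assumes M: "haar_orthogonal n M" and k: "k > 0"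
  shows "{U \<in> space M. forrelation_fun n k U x = v} \<in> sets M"
proof -
  have [measurable]: "(\<lambda>U. forrelation n k U x) \<in> borel_measurable M"
    by (rule forrelation_measurable[OF M k])
  have "(\<lambda>U. forrelation_fun n k U x) \<in> measurable M (count_space UNIV)"
    unfolding forrelation_fun_def by measurable
  from measurable_sets[OF this, of "{v}"] show ?thesis
    by (simp add: vimage_def Int_def conj_commute)
qed

text \<open>There are finitely many partial functions on the cube, so the event is a finite union of
  sets that prescribe the value at every input. This covers conditions that quantify over all real
  \<open>\<gamma>\<close>.\<close>

lemma forrelation_fun_set_measurable:
  assumes M: "haar_orthogonal n M" and k: "k > 0"
    and P: "\<And>f g. (\<And>x. x \<in> sign_inputs ({..<k} \<times> {..<n}) \<Longrightarrow> f x = g x) \<Longrightarrow> P f \<longleftrightarrow> P g"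
  shows "{U \<in> space M. P (forrelation_fun n k U)} \<in> sets M"
proof -
  define X where "X = sign_inputs ({..<k} \<times> {..<n})"
  have fX: "finite X" unfolding X_def by simp
  define H where "H = {h \<in> X \<rightarrow>\<^sub>E (UNIV :: bool option set). P h}"
  have "finite (X \<rightarrow>\<^sub>E (UNIV :: bool option set))" by (intro finite_PiE fX) simp
  then have fH: "finite H" unfolding H_def by simp
  have "{U \<in> space M. P (forrelation_fun n k U)}
      = (\<Union>h\<in>H. {U \<in> space M. \<forall>x\<in>X. forrelation_fun n k U x = h x})"
  proof (intro equalityI subsetI)
    fix U assume U: "U \<in> {U \<in> space M. P (forrelation_fun n k U)}"
    have "P (restrict (forrelation_fun n k U) X) = P (forrelation_fun n k U)"
      by (rule P) (simp add: X_def)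
    then have "restrict (forrelation_fun n k U) X \<in> H" using U unfolding H_def by simp
    then show "U \<in> (\<Union>h\<in>H. {U \<in> space M. \<forall>x\<in>X. forrelation_fun n k U x = h x})"
      using U by (intro UN_I[of "restrict (forrelation_fun n k U) X"]) auto
  next
    fix U assume "U \<in> (\<Union>h\<in>H. {U \<in> space M. \<forall>x\<in>X. forrelation_fun n k U x = h x})"
    then obtain h where h: "h \<in> H" "U \<in> space M" "\<And>x. x \<in> X \<Longrightarrow> forrelation_fun n k U x = h x" by auto
    have "P (forrelation_fun n k U) = P h" by (rule P) (use h(3) in \<open>simp add: X_def\<close>)
    then show "U \<in> {U \<in> space M. P (forrelation_fun n k U)}" using h unfolding H_def by simp
  qed
  moreover have "{U \<in> space M. \<forall>x\<in>X. forrelation_fun n k U x = h x} \<in> sets M" for h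
    by (intro sets.sets_Collect_finite_All fX forrelation_fun_measurable[OF M k])
  ultimately show ?thesis using fH by auto
qed

theorem theorem5p6:
  shows "\<exists>c1 > 0. \<exists>c2 > 0. \<exists>err :: nat \<Rightarrow> real. err \<longlonglongrightarrow> 0 \<and>
    (\<forall>(n::nat) (k::nat) (M :: real mat measure).
       n > 0 \<longrightarrow> k > 0 \<longrightarrow> real k \<le> 1 / 3 * log 2 (real n) - 1 \<longrightarrow> haar_orthogonal n M \<longrightarrow>
       measure M {U \<in> space M.
           real (forrelation_complexity (1 / 2 ^ (k + 1)) n k U)
             \<ge> c1 * (real n powr (1 - 1 / real k) / ln (real n) powr (2 - 1 / real k)) \<and>
           (\<forall>\<gamma>::real. 0 \<le> \<gamma> \<longrightarrow> \<gamma> \<le> 1 / 2 \<longrightarrow>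
              real (forrelation_complexity (1 / 2 - \<gamma>) n k U)
                \<ge> c2 * (\<gamma>\<^sup>2 / real k * (real n powr (1 - 1 / real k) / ln (real n) powr (2 - 1 / real k))))}
         \<ge> 1 - err n)"
proof -
  \<comment> \<open>The threshold of \<open>success_gap\<close>, kept symbolic so that
    \<open>8 ^ m\<close> is never computed.\<close>
  obtain m :: nat where m: "m \<ge> 1001" by blast
  \<comment> \<open>For the finitely many small \<open>n\<close> the value 1 makes the claim
    trivial.\<close>
  define err where "err n = (if real n < 16 * 8 ^ m then 1 else 4 * exp 4 / real n)" for n :: nat
  have "(\<lambda>n. 4 * exp 4 / real n) \<longlonglongrightarrow> 0"
    by (rule tendsto_divide_0[OF tendsto_const]) (simp add: filterlim_real_sequentially filterlim_at_top_imp_at_infinity)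
  moreover have "eventually (\<lambda>n. 4 * exp 4 / real n = err n) sequentially"
  proof -
    have "eventually (\<lambda>n. real n \<ge> 16 * 8 ^ m) sequentially"
      using filterlim_real_sequentially unfolding filterlim_at_top by blast
    then show ?thesis by eventually_elim (simp add: err_def)
  qed
  ultimately have err: "err \<longlonglongrightarrow> 0" by (rule Lim_transform_eventually)
  have main: "measure M {U \<in> space M.
           real (forrelation_complexity (1 / 2 ^ (k + 1)) n k U) \<ge> query_const * query_bound n k \<and>
           (\<forall>\<gamma>::real. 0 \<le> \<gamma> \<longrightarrow> \<gamma> \<le> 1 / 2 \<longrightarrow>
              real (forrelation_complexity (1 / 2 - \<gamma>) n k U) \<ge> query_const / 3 * (\<gamma>\<^sup>2 / real k * query_bound n k))}
         \<ge> 1 - err n" (is "measure M ?E \<ge> _")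
    if n: "n > 0" and k: "k > 0" "real k \<le> 1 / 3 * log 2 (real n) - 1" and M: "haar_orthogonal n M" for n k M
  proof (cases "real n < 16 * 8 ^ m")
    case False
    then have n16: "real n \<ge> 16 * 8 ^ m" by simp
    interpret prob_space M using M unfolding haar_orthogonal_def by auto
    obtain G where G: "G \<in> sets M" "measure M G \<ge> 1 - 4 * exp 4 / real n"
      "\<And>U. U \<in> G \<Longrightarrow> flat_matrix n (entries U) \<and> flat_matrix n (\<lambda>i j. entries U j i)"
      using haar_flat[OF M n] by blast
    \<comment> \<open>A set outside the sigma-algebra has measure 0 by convention, so the passage
      from \<open>G\<close> to the event depends on this.\<close>
    have "?E \<in> sets M"
      unfolding forrelation_complexity_def
      by (rule forrelation_fun_set_measurable[OF M k(1)]) (simp cong: randomized_query_complexity_cong)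
    moreover have "G \<subseteq> ?E"
    proof
      fix U assume U: "U \<in> G"
      then have sp: "U \<in> space M" using sets.sets_into_space[OF G(1)] by auto
      then have orth: "U \<in> orthogonal_group n" using M unfolding haar_orthogonal_def by auto
      show "U \<in> ?E"
        using sp forrelation_complexity_lower_bounds[OF m n16 k(1) eight_power_le[OF n k(2)] orth]
          G(3)[OF U] by blast
    qed
    ultimately have "measure M G \<le> measure M ?E" by (intro finite_measure_mono)
    then show ?thesis using G(2) False unfolding err_def by simp
  qed (simp add: err_def)
  have "query_const / 3 > 0" using query_const_pos by simp
  then show ?thesis
    using query_const_pos err main unfolding query_bound_def by blast
qed

end
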